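(* For every constant $\delta>0$ the following holds. There is a linear sketch that, given any parameter $\alpha \le n^{1/2-\delta}$ and any $n$-vertex graph $G=(V,E)$ specified via $\mathrm{vec}(E)$, with high probability outputs an $\alpha$-approximate maximum matching of $G$ (a matching of $G$ of size at least $\mu(G)/\alpha$, where $\mu(G)$ is the maximum matching size of $G$), and the sketch uses $O(n^2/\alpha^3)$ bits of space.
   Context: Let $V=[n]$. For a graph $G=(V,E)$, $\mathrm{vec}(E)$ is the $\binom{n}{2}$-dimensional vector whose $i$-th entry is the multiplicity of the $i$-th pair of vertices $e_i$ in $G$. In a dynamic graph stream, $\mathrm{vec}(E)$ is specified by a sequence of updates $(j,\Delta)$ with $j\in[\binom n2]$ and $\Delta\in\{-1,+1\}$ (edge insertions and deletions), and $\mathrm{vec}(E)_j$ is the sum of the $\Delta$'s of updates to coordinate $j$. A linear sketch for a problem on vectors $x\in\mathbb{R}^m$ consists of a sketching matrix $\Phi$ with $\mathrm{poly}(m)$-bounded integer entries, $s$ rows and $m$ columns, possibly chosen randomly and implicitly but independently of $x$, together with a recovery algorithm that, given $\Phi$ and $\Phi\cdot x$, outputs a solution for $x$ (computations may be over the integers or a finite field). The size (space) of the sketch is the number of bits needed to store $\Phi$ (implicitly) and $\Phi\cdot x$. "With high probability" means with probability at least $1-n^{-c}$ for a sufficiently large constant $c>0$.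
   Formalization: The multiplicities in vec(E) are assumed to be at most an arbitrary constant k (k = 1 gives simple graphs), and the constant in O(n²/α³) may depend on k; with unbounded multiplicities the bound fails already for n = 2, α = 1. *)

theory Defs
  imports
    "HOL-Probability.Probability_Mass_Function"
    "HOL-Computational_Algebra.Polynomial"
    "HOL-Computational_Algebra.Primes"
    "HOL-Library.Log_Nat"
    "HOL-Library.Multiset"
    "HOL-Library.Disjoint_Sets"
    "Jordan_Normal_Form.Matrix"
begin

section \<open>Graphs on the vertex set [n], their edge vectors, and matchings\<close>

text \<open>
  The pairs of vertices of [n] in lexicographic order, which fixes what the i-th pair is.
  Positions in the list, like indices of vectors and matrices, start at 0.
\<close>

definition vertex_pairs :: "nat \<Rightarrow> nat set list" where
  "vertex_pairs n = concat (map (\<lambda>u. map (\<lambda>v. {u, v}) [Suc u..<Suc n]) [1..<Suc n])"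

lemma length_vertex_pairs: "length (vertex_pairs n) = n choose 2"
proof -
  have "length (vertex_pairs n) = (\<Sum>u\<leftarrow>[1..<Suc n]. n - u)"
    by (simp add: vertex_pairs_def length_concat o_def del: upt_Suc)
  also have "\<dots> = (\<Sum>u=1..<Suc n. n - u)" by (simp only: sum_list_distinct_conv_sum_set[OF distinct_upt] set_upt)
  also have "\<dots> = (\<Sum>i<n. i)"
    by (rule sum.reindex_bij_witness[of _ "\<lambda>i. n-i" "\<lambda>i. n-i"]) auto
  also have "\<dots> = n choose 2" by (induction n) (auto simp: choose_two lessThan_Suc numeral_2_eq_2)
  finally show ?thesis .
qed

lemma set_vertex_pairs: "set (vertex_pairs n) = {e. e \<subseteq> {1..n} \<and> card e = 2}"
proof -
  have mem: "e \<in> set (vertex_pairs n) \<longleftrightarrow> (\<exists>u \<in> {1..<Suc n}. \<exists>v \<in> {Suc u..<Suc n}. e = {u, v})" for e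
    by (auto simp: vertex_pairs_def simp del: upt_Suc)
  show ?thesis
  proof (intro Set.set_eqI iffI)
    fix e assume "e \<in> set (vertex_pairs n)"
    then obtain u v where "u \<in> {1..<Suc n}" "v \<in> {Suc u..<Suc n}" "e = {u, v}"
      unfolding mem by blast
    then show "e \<in> {e. e \<subseteq> {1..n} \<and> card e = 2}" by auto
  next
    fix e assume e: "e \<in> {e. e \<subseteq> {1..n} \<and> card e = 2}"
    then obtain a b where "e = {a, b}" "a \<noteq> b" by (auto simp: card_2_iff)
    then obtain u v where "e = {u, v}" "u < v"
      by (metis insert_commute linorder_neqE_nat)
    then show "e \<in> set (vertex_pairs n)"
      using e unfolding mem by (intro bexI[of _ u] bexI[of _ v]) auto
  qed
qed

lemma distinct_vertex_pairs: "distinct (vertex_pairs n)"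
proof -
  have "card (set (vertex_pairs n)) = n choose 2"
    unfolding set_vertex_pairs using n_subsets[of "{1..n}" 2] by simp
  then show ?thesis by (metis card_distinct length_vertex_pairs)
qed

text \<open>
  The edges form a multiset, so that a pair has a multiplicity. For \<open>k = 1\<close> these are
  exactly the simple graphs on [n].
\<close>

definition graph_on :: "nat \<Rightarrow> nat \<Rightarrow> nat set multiset \<Rightarrow> bool" where
  "graph_on n k E \<longleftrightarrow> set_mset E \<subseteq> {e. e \<subseteq> {1..n} \<and> card e = 2} \<and> (\<forall>e. count E e \<le> k)"

definition edge_vec :: "nat \<Rightarrow> nat set multiset \<Rightarrow> int Matrix.vec" where
  "edge_vec n E = Matrix.vec (n choose 2) (\<lambda>i. int (count E (vertex_pairs n ! i)))"

definition is_matching :: "nat set multiset \<Rightarrow> nat set set \<Rightarrow> bool" where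
  "is_matching E F \<longleftrightarrow> F \<subseteq> set_mset E \<and> disjoint F"

definition matching_number :: "nat set multiset \<Rightarrow> nat" where
  "matching_number E = Max (card ` {F. is_matching E F})"

definition approx_matching :: "real \<Rightarrow> nat set multiset \<Rightarrow> nat set set \<Rightarrow> bool" where
  "approx_matching \<alpha> E F \<longleftrightarrow> is_matching E F \<and> real (card F) \<ge> real (matching_number E) / \<alpha>"


section \<open>Linear sketches\<close>

text \<open>
  The random matrix is stored implicitly, as a bit string \<open>b\<close> drawn from \<open>sk_code\<close> that
  represents the integer matrix \<open>sk_matrix b\<close>.
  All computations take place over the integers if \<open>sk_char\<close> is 0 and over the prime field
  with \<open>sk_char\<close> elements otherwise. Prime fields suffice: for an integer vector \<open>x\<close>, a row over
  the field with \<open>p ^ d\<close> elements amounts to \<open>d\<close> rows over its prime field.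
\<close>

record 'sol linear_sketch =
  sk_char :: nat
  sk_rows :: nat
  sk_code :: "bool list pmf"
  sk_matrix :: "bool list \<Rightarrow> int mat"
  sk_recover :: "int mat \<Rightarrow> int Matrix.vec \<Rightarrow> 'sol"

definition linear_sketch :: "nat \<Rightarrow> int \<Rightarrow> 'sol linear_sketch \<Rightarrow> bool" where
  "linear_sketch m B S \<longleftrightarrow>
     (sk_char S = 0 \<or> prime (sk_char S)) \<and>
     (\<forall>b \<in> set_pmf (sk_code S).
        sk_matrix S b \<in> carrier_mat (sk_rows S) m \<and>
        (\<forall>i < sk_rows S. \<forall>j < m. \<bar>sk_matrix S b $$ (i, j)\<bar> \<le> B))"

text \<open>Over the integers nothing is reduced, since \<open>a mod 0 = a\<close>.\<close>

definition measurement :: "'sol linear_sketch \<Rightarrow> bool list \<Rightarrow> int Matrix.vec \<Rightarrow> int Matrix.vec" where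
  "measurement S b x = map_vec (\<lambda>a. a mod int (sk_char S)) (mult_mat_vec (sk_matrix S b) x)"

definition sketch_output :: "'sol linear_sketch \<Rightarrow> int Matrix.vec \<Rightarrow> bool list \<Rightarrow> 'sol" where
  "sketch_output S x b = sk_recover S (sk_matrix S b) (measurement S b x)"

text \<open>
  An element of the field with \<open>q\<close> elements takes \<open>\<lceil>log 2 q\<rceil>\<close> bits. An integer is stored in a
  self-delimiting way: the length \<open>l\<close> of the binary representation of its absolute value in
  unary (\<open>l + 1\<close> bits), then, if it is not 0, the binary representation without the leading 1
  (\<open>l - 1\<close> bits) and the sign.
\<close>

definition entry_bits :: "nat \<Rightarrow> int \<Rightarrow> nat" where
  "entry_bits q a = (if q = 0 then 2 * floorlog 2 (nat \<bar>a\<bar>) + 1 else nat \<lceil>log 2 (real q)\<rceil>)"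

definition sketch_bits :: "'sol linear_sketch \<Rightarrow> int Matrix.vec \<Rightarrow> bool list \<Rightarrow> nat" where
  "sketch_bits S x b =
     length b + (\<Sum>i < sk_rows S. entry_bits (sk_char S) (vec_index (measurement S b x) i))"

end

theory Submission
  imports Defs "HOL-Probability.Product_PMF" "HOL-Real_Asymp.Real_Asymp"
begin

text \<open>
  All sums are taken modulo a fixed prime \<open>p > k\<close>, so that a row costs \<open>O(1)\<close> bits, and the random
  bits cost only \<open>O(log n)\<close> by Newman's argument. Let \<open>lam\<close> be a small power of \<open>n\<close>.

  The first part takes \<open>n\<^sup>2 / (\<alpha>\<^sup>3 lam)\<close> probes. A probe isolates an edge inside a random set of
  about \<open>\<alpha>\<close> vertices and identifies it with \<open>O(log n)\<close> rows. Let \<open>T\<close> be the vertex set of a maximal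
  matching of the edges found. If this matching is too small, then \<open>|T| \<le> n / \<alpha>\<close>, so a
  probe misses \<open>T\<close> with constant probability, and the graph \<open>G - T\<close> must be so sparse that a random
  set of \<open>\<alpha>\<close> vertices contains an edge of it with probability at most about \<open>\<alpha>\<^sup>2 / n\<close>. Still \<open>G - T\<close>
  contains most of a maximum matching of \<open>G\<close>.

  The second part samples right vertices with rate \<open>O(1 / \<alpha>)\<close>, hashes them into \<open>O(n / \<alpha>\<^sup>2)\<close> cells and
  the other vertices into \<open>O(n / \<alpha>)\<close> cells, and stores the sum of the edges between any two cells of
  different sides, which takes \<open>O(n\<^sup>2 / \<alpha>\<^sup>3)\<close> sums. A constant fraction of the cells avoids \<open>T\<close>, and
  between those almost all sums are 0. So a pair that is no edge has a nonzero sum with probability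
  \<open>O(1 / lam)\<close>, and a constant number of independent hashings, with the same sample, suffices to
  tell the edges apart without a logarithmic factor. On the other hand, a constant fraction of the
  matching edges with a sampled end survives, by Chebyshev's inequality. This fails with probability
  \<open>O(1 / lam)\<close>, which a constant number of copies makes smaller than any power of \<open>1 / n\<close>.
\<close>

section \<open>Probabilities over finite products\<close>

text \<open>One factor of \<alpha> is saved because only a fraction of about
  \<open>1 / \<alpha>\<close> of a matching has to be output: it is enough to look at pairs with
  exactly one sampled end, and the sampled side gets only \<open>J\<close> of the
  \<open>A * J\<close> cells. The obstacle is to recognise an edge from a single sum. A checksum for
  every sum would cost \<open>O(log n)\<close> rows, and a fresh sample for every hashing would let
  an edge through with probability only about \<open>1 / A\<close> each time. So the sample is
  shared and the cells alone are redrawn. A nonzero sum is credible only if the graph outside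
  \<open>T\<close> is sparse, and this is exactly what the probes certify: the union of two of the
  \<open>A * J\<close> cells is a random vertex set with the same distribution as the set drawn by a
  probe of rate \<open>2 / (A * J)\<close>. Since \<open>T\<close> is computed from the probes
  alone, it is a fixed set once the hashings are analysed, and no union bound over \<open>T\<close>
  is needed there.\<close>

abbreviation pr :: "'a pmf \<Rightarrow> ('a \<Rightarrow> bool) \<Rightarrow> real" where
  "pr p P \<equiv> measure_pmf.prob p {x. P x}"

lemma pr_mono:
  assumes "\<And>x. x \<in> set_pmf p \<Longrightarrow> P x \<Longrightarrow> Q x"
  shows "pr p P \<le> pr p Q"
proof -
  have "pr p P = measure_pmf.prob p ({x. P x} \<inter> set_pmf p)" by (simp add: measure_Int_set_pmf)
  also have "\<dots> \<le> pr p Q" by (rule measure_pmf.finite_measure_mono) (use assms in auto)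
  finally show ?thesis .
qed

lemma pr_cong:
  assumes "\<And>x. x \<in> set_pmf p \<Longrightarrow> P x = Q x"
  shows "pr p P = pr p Q"
  by (intro antisym pr_mono) (simp_all add: assms)

lemma pr_disj: "pr p (\<lambda>x. P x \<or> Q x) \<le> pr p P + pr p Q"
  unfolding Collect_disj_eq by (rule measure_Un_le) auto

lemma pr_not: "pr p (\<lambda>x. \<not> P x) = 1 - pr p P"
  using measure_pmf.prob_compl[of "{x. P x}" p] by (simp add: Collect_neg_eq Compl_eq_Diff_UNIV)

lemma pr_ex:
  assumes "finite I"
  shows "pr p (\<lambda>x. \<exists>i\<in>I. P i x) \<le> (\<Sum>i\<in>I. pr p (P i))"
proof -
  have "{x. \<exists>i\<in>I. P i x} = (\<Union>i\<in>I. {x. P i x})" by auto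
  then show ?thesis
    using measure_pmf.finite_measure_subadditive_finite[OF assms, of "\<lambda>i. {x. P i x}" p] by simp
qed

lemma pr_ex_bound:
  assumes "finite I" "\<And>i. i \<in> I \<Longrightarrow> pr p (P i) \<le> b"
  shows "pr p (\<lambda>x. \<exists>i\<in>I. P i x) \<le> real (card I) * b"
  using pr_ex[OF assms(1), of p P] sum_bounded_above[of I "\<lambda>i. pr p (P i)" b, OF assms(2)] by linarith

lemma pr_map: "pr (map_pmf f p) P = pr p (\<lambda>x. P (f x))"
  by (simp add: vimage_def)

lemma pr_bind: "pr (bind_pmf p f) P = measure_pmf.expectation p (\<lambda>x. pr (f x) P)"
  by (simp add: measure_pmf_bind measure_pmf.measure_bind[where N = "count_space UNIV"]
    measure_pmf_in_subprob_space)

lemma integrable_pr: "integrable (measure_pmf p) (\<lambda>x. pr (f x) P)"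
  by (rule measure_pmf.integrable_const_bound[where B = 1]) auto

lemma pr_bind_le:
  assumes "\<And>x. x \<in> set_pmf p \<Longrightarrow> pr (f x) P \<le> b"
  shows "pr (bind_pmf p f) P \<le> b"
proof -
  have "measure_pmf.expectation p (\<lambda>x. pr (f x) P) \<le> measure_pmf.expectation p (\<lambda>x. b)"
    by (rule integral_mono_AE) (auto simp: integrable_pr AE_measure_pmf_iff assms)
  then show ?thesis by (simp add: pr_bind)
qed

lemma expectation_indicator: "measure_pmf.expectation p (\<lambda>x. of_bool (P x)) = pr p P"
proof -
  have "(\<lambda>x. of_bool (P x) :: real) = indicator {x. P x}" by (auto simp: indicator_def)
  then show ?thesis by simp
qed

lemma integrable_bdd:
  fixes f :: "'a \<Rightarrow> real"
  assumes "\<And>x. \<bar>f x\<bar> \<le> B"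
  shows "integrable (measure_pmf p) f"
  by (rule measure_pmf.integrable_const_bound[where B = B]) (use assms in auto)

lemma integrable_of_bool [simp]: "integrable (measure_pmf p) (\<lambda>x. of_bool (P x) :: real)"
  by (rule integrable_bdd[where B = 1]) auto

lemma pr_bind_le_good:
  assumes "\<And>x. x \<in> set_pmf p \<Longrightarrow> G x \<Longrightarrow> pr (f x) P \<le> b" "pr p (\<lambda>x. \<not> G x) \<le> a" "0 \<le> b"
  shows "pr (bind_pmf p f) P \<le> a + b"
proof -
  have "measure_pmf.expectation p (\<lambda>x. pr (f x) P)
      \<le> measure_pmf.expectation p (\<lambda>x. of_bool (\<not> G x) + b)"
  proof (rule integral_mono_AE)
    have "pr (f x) P \<le> of_bool (\<not> G x) + b" if "x \<in> set_pmf p" for x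
      using assms(1)[OF that] assms(3) measure_pmf.prob_le_1[of "f x" "{x. P x}"]
      by (cases "G x") (auto intro: order_trans)
    then show "AE x in measure_pmf p. pr (f x) P \<le> of_bool (\<not> G x) + b"
      by (simp add: AE_measure_pmf_iff)
  qed (auto intro: integrable_pr integrable_bdd[where B = 1] intro!: Bochner_Integration.integrable_add simp del: of_bool_not_iff)
  also have "\<dots> = pr p (\<lambda>x. \<not> G x) + b"
    by (subst Bochner_Integration.integral_add)
      (auto intro: integrable_bdd[where B = 1] simp: expectation_indicator)
  finally show ?thesis using assms(2) by (simp add: pr_bind)
qed

lemma pr_bind_le_mult:
  assumes "\<And>x. x \<in> set_pmf p \<Longrightarrow> pr (f x) P \<le> of_bool (G x) * b" "pr p G \<le> a" "0 \<le> b"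
  shows "pr (bind_pmf p f) P \<le> a * b"
proof -
  have "measure_pmf.expectation p (\<lambda>x. pr (f x) P)
      \<le> measure_pmf.expectation p (\<lambda>x. of_bool (G x) * b)"
    by (rule integral_mono_AE)
      (use assms in \<open>auto simp: integrable_pr AE_measure_pmf_iff simp del: of_bool_eq \<close>)
  also have "\<dots> = pr p G * b" by (simp add: expectation_indicator)
  also have "\<dots> \<le> a * b" using assms by (intro mult_right_mono) auto
  finally show ?thesis by (simp add: pr_bind)
qed

lemma pr_bind_ge_mult:
  assumes "\<And>x. x \<in> set_pmf p \<Longrightarrow> of_bool (G x) * b \<le> pr (f x) P" "a \<le> pr p G" "0 \<le> b"
  shows "a * b \<le> pr (bind_pmf p f) P"
proof -
  have "a * b \<le> pr p G * b" using assms by (intro mult_right_mono) auto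
  also have "\<dots> = measure_pmf.expectation p (\<lambda>x. of_bool (G x) * b)"
    by (simp add: expectation_indicator)
  also have "\<dots> \<le> measure_pmf.expectation p (\<lambda>x. pr (f x) P)"
    by (rule integral_mono_AE)
      (use assms in \<open>auto simp: integrable_pr AE_measure_pmf_iff \<close>)
  finally show ?thesis by (simp add: pr_bind)
qed

lemma pair_pmf_alt2: "pair_pmf p q = bind_pmf q (\<lambda>y. map_pmf (\<lambda>x. (x, y)) p)"
  unfolding pair_pmf_def map_pmf_def by (subst bind_commute_pmf) simp

lemma pair_pmf_alt1: "pair_pmf p q = bind_pmf p (\<lambda>x. map_pmf (\<lambda>y. (x, y)) q)"
  unfolding pair_pmf_def map_pmf_def by simp

lemma pr_pair_le_fst:
  assumes "\<And>x. x \<in> set_pmf p \<Longrightarrow> pr q (\<lambda>y. P (x, y)) \<le> b"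
  shows "pr (pair_pmf p q) P \<le> b"
  unfolding pair_pmf_alt1 by (rule pr_bind_le) (simp add: assms)

lemma pr_pair_le_snd:
  assumes "\<And>y. y \<in> set_pmf q \<Longrightarrow> pr p (\<lambda>x. P (x, y)) \<le> b"
  shows "pr (pair_pmf p q) P \<le> b"
  unfolding pair_pmf_alt2 by (rule pr_bind_le) (simp add: assms)

lemma pr_pair_indep: "pr (pair_pmf p q) (\<lambda>(x, y). P x \<and> Q y) = pr p P * pr q Q"
proof -
  have "pr (pair_pmf p q) (\<lambda>(x, y). P x \<and> Q y) = measure_pmf.expectation p (\<lambda>x. of_bool (P x) * pr q Q)"
    unfolding pair_pmf_alt1 pr_bind pr_map
    by (intro Bochner_Integration.integral_cong) (auto simp del: of_bool_eq)
  also have "\<dots> = pr p P * pr q Q" by (simp add: expectation_indicator)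
  finally show ?thesis .
qed

lemma pr_pair_fst: "pr (pair_pmf p q) (\<lambda>w. P (fst w)) = pr p P"
  by (metis (no_types) map_fst_pair_pmf pr_map)

lemma pr_Pi_component:
  assumes "finite A" "x \<in> A"
  shows "pr (Pi_pmf A d p) (\<lambda>f. P (f x)) = pr (p x) P"
  using pr_map[of "\<lambda>f. f x" "Pi_pmf A d p" P] Pi_pmf_component[OF assms(1), of x d p] assms(2) by simp

lemma pr_Pi_all:
  assumes "finite A"
  shows "pr (Pi_pmf A d p) (\<lambda>f. \<forall>x\<in>A. P x (f x)) = (\<Prod>x\<in>A. pr (p x) (P x))"
  using measure_Pi_pmf_Pi[OF assms, of d p "\<lambda>x. {y. P x y}"] by (simp add: Pi_def Ball_def)

lemma pr_Pi_all_subset: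
  assumes "finite A" "B \<subseteq> A"
  shows "pr (Pi_pmf A d p) (\<lambda>f. \<forall>x\<in>B. P x (f x)) = (\<Prod>x\<in>B. pr (p x) (P x))"
proof -
  have "pr (Pi_pmf A d p) (\<lambda>f. \<forall>x\<in>B. P x (f x)) =
      pr (Pi_pmf A d p) (\<lambda>f. \<forall>x\<in>A. x \<in> B \<longrightarrow> P x (f x))"
    by (rule pr_cong) (use assms in auto)
  also have "\<dots> = (\<Prod>x\<in>A. pr (p x) (\<lambda>y. x \<in> B \<longrightarrow> P x y))" by (rule pr_Pi_all[OF assms(1)])
  also have "\<dots> = (\<Prod>x\<in>B. pr (p x) (P x))"
    by (rule prod.mono_neutral_cong_right) (use assms in auto)
  finally show ?thesis .
qed

lemma pr_Pi_restrict:
  assumes "finite A" "B \<subseteq> A" "\<And>f g. (\<And>x. x \<in> B \<Longrightarrow> f x = g x) \<Longrightarrow> P f = P g"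
  shows "pr (Pi_pmf B d p) P = pr (Pi_pmf A d p) P"
  unfolding Pi_pmf_subset[OF assms(1,2)] pr_map
  by (rule pr_cong) (rule assms(3), simp)

text \<open>The last two assumptions say that \<open>P\<close> reads only coordinates in
  \<open>A\<close> and \<open>Q\<close> only those in \<open>B\<close>; splitting the product at
  \<open>A\<close> separates them.\<close>

lemma pr_Pi_indep:
  assumes "finite V" "A \<subseteq> V" "B \<subseteq> V" "A \<inter> B = {}"
    and "\<And>f g. (\<And>x. x \<in> A \<Longrightarrow> f x = g x) \<Longrightarrow> P f = P g"
    and "\<And>f g. (\<And>x. x \<in> B \<Longrightarrow> f x = g x) \<Longrightarrow> Q f = Q g"
  shows "pr (Pi_pmf V d p) (\<lambda>f. P f \<and> Q f) = pr (Pi_pmf V d p) P * pr (Pi_pmf V d p) Q"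
proof -
  have fin: "finite A" "finite (V - A)" using assms(1,2) finite_subset by auto
  have V: "V = A \<union> (V - A)" using assms by auto
  have "pr (Pi_pmf V d p) (\<lambda>f. P f \<and> Q f) =
      pr (pair_pmf (Pi_pmf A d p) (Pi_pmf (V - A) d p)) (\<lambda>(f, g). P f \<and> Q g)"
    apply (subst V)
    apply (subst Pi_pmf_union[OF fin], simp)
    unfolding pr_map
    by (rule pr_cong) (use assms(4) in \<open>auto simp: case_prod_unfold intro!: arg_cong2[where f = "(\<and>)"] assms(5,6)\<close>)
  also have "\<dots> = pr (Pi_pmf A d p) P * pr (Pi_pmf (V - A) d p) Q" by (rule pr_pair_indep)
  also have "pr (Pi_pmf A d p) P = pr (Pi_pmf V d p) P"
    by (rule pr_Pi_restrict[OF assms(1,2,5)])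
  also have "pr (Pi_pmf (V - A) d p) Q = pr (Pi_pmf V d p) Q"
    by (rule pr_Pi_restrict[OF assms(1)]) (use assms(3,4) in \<open>auto intro!: assms(6)\<close>)
  finally show ?thesis .
qed

lemma pr_Pi_peel:
  assumes "finite A" "x \<notin> A"
  shows "pr (Pi_pmf (insert x A) d p) P = pr (pair_pmf (p x) (Pi_pmf A d p)) (\<lambda>(y, f). P (f(x := y)))"
  unfolding Pi_pmf_insert[OF assms] pr_map by (rule pr_cong) auto

lemma pr_Pi_peel_le:
  assumes "finite A" "x \<in> A"
    and "\<And>f. pr (p x) (\<lambda>y. P (f(x := y))) \<le> b"
  shows "pr (Pi_pmf A d p) P \<le> b"
proof -
  have "A = insert x (A - {x})" using assms by auto
  then have "pr (Pi_pmf A d p) P = pr (Pi_pmf (insert x (A - {x})) d p) P" by simp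
  also have "\<dots> \<le> b"
    by (subst pr_Pi_peel) (use assms in \<open>auto intro: pr_pair_le_snd\<close>)
  finally show ?thesis .
qed

section \<open>First and second moments of the number of events that occur\<close>

lemma expectation_card:
  assumes "finite I"
  shows "measure_pmf.expectation p (\<lambda>x. real (card {i \<in> I. P i x})) = (\<Sum>i\<in>I. pr p (P i))"
proof -
  have "(\<lambda>x. real (card {i \<in> I. P i x})) = (\<lambda>x. \<Sum>i\<in>I. of_bool (P i x))"
    using assms by (auto simp: Int_def sum.If_cases of_bool_def)
  then show ?thesis
    by (simp add: expectation_indicator integrable_bdd[where B = 1] Bochner_Integration.integral_sum)
qed

lemma pr_card_ge:
  assumes "finite I" "0 < a"
  shows "pr p (\<lambda>x. a \<le> real (card {i \<in> I. P i x})) \<le> (\<Sum>i\<in>I. pr p (P i)) / a"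
proof -
  have "pr p (\<lambda>x. a \<le> real (card {i \<in> I. P i x})) * a \<le> (\<Sum>i\<in>I. pr p (P i))"
  proof -
    have "pr p (\<lambda>x. a \<le> real (card {i \<in> I. P i x})) * a =
        measure_pmf.expectation p (\<lambda>x. of_bool (a \<le> real (card {i \<in> I. P i x})) * a)"
      by (simp add: expectation_indicator)
    also have "\<dots> \<le> measure_pmf.expectation p (\<lambda>x. real (card {i \<in> I. P i x}))"
      using assms
      by (intro integral_mono) (auto intro: integrable_bdd[where B = "card I"] simp: card_mono)
    finally show ?thesis by (simp add: expectation_card[OF assms(1)])
  qed
  then show ?thesis using assms(2) by (simp add: pos_le_divide_eq)
qed

text \<open>Pairwise independence makes the mixed products of the centred indicators vanish in
  expectation, and each diagonal term contributes at most \<eta>.\<close>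

lemma second_moment_card:
  assumes "finite I"
    and indep: "\<And>i j. i \<in> I \<Longrightarrow> j \<in> I \<Longrightarrow> i \<noteq> j \<Longrightarrow> pr p (\<lambda>x. P i x \<and> P j x) = \<eta> * \<eta>"
    and eta: "\<And>i. i \<in> I \<Longrightarrow> pr p (P i) = \<eta>"
  shows "measure_pmf.expectation p (\<lambda>x. (real (card {i \<in> I. P i x}) - real (card I) * \<eta>)\<^sup>2) \<le> real (card I) * \<eta>"
proof (cases "I = {}")
  case False
  then have eta01: "0 \<le> \<eta>" using eta measure_nonneg by (metis all_not_in_conv)
  define Z where "Z = (\<lambda>i x. of_bool (P i x) - \<eta>)"
  have bdd: "\<bar>Z i x\<bar> \<le> 1 + \<eta>" for i x using eta01 by (auto simp: Z_def of_bool_def)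
  have bdd2: "\<bar>Z i x * Z j x\<bar> \<le> (1 + \<eta>) * (1 + \<eta>)" for i j x
    unfolding abs_mult by (intro mult_mono bdd) (use eta01 in auto)
  have sq: "(\<lambda>x. (real (card {i \<in> I. P i x}) - real (card I) * \<eta>)\<^sup>2) = (\<lambda>x. (\<Sum>i\<in>I. Z i x)\<^sup>2)"
    using assms(1) by (auto simp: Z_def sum_subtractf Int_def sum.If_cases of_bool_def)
  have "measure_pmf.expectation p (\<lambda>x. (\<Sum>i\<in>I. Z i x)\<^sup>2) =
      measure_pmf.expectation p (\<lambda>x. \<Sum>i\<in>I. \<Sum>j\<in>I. Z i x * Z j x)"
    by (simp add: power2_eq_square sum_product)
  also have "\<dots> = (\<Sum>i\<in>I. \<Sum>j\<in>I. measure_pmf.expectation p (\<lambda>x. Z i x * Z j x))"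
    by (simp add: Bochner_Integration.integral_sum integrable_bdd[OF bdd2])
  also have "\<dots> \<le> (\<Sum>i\<in>I. \<Sum>j\<in>I. if i = j then \<eta> else 0)"
  proof (intro sum_mono)
    fix i j assume ij: "i \<in> I" "j \<in> I"
    have "(\<lambda>x. Z i x * Z j x) = (\<lambda>x. of_bool (P i x \<and> P j x) - \<eta> * of_bool (P i x) - \<eta> * of_bool (P j x) + \<eta> * \<eta>)"
      by (auto simp: Z_def algebra_simps)
    then have "measure_pmf.expectation p (\<lambda>x. Z i x * Z j x) =
        pr p (\<lambda>x. P i x \<and> P j x) - \<eta> * pr p (P i) - \<eta> * pr p (P j) + \<eta> * \<eta>"
      by (simp add: expectation_indicator integrable_bdd[where B = 1] integrable_bdd[where B = \<eta>]
        del: of_bool_conj)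
    also have "\<dots> \<le> (if i = j then \<eta> else 0)"
      using ij eta indep[of i j] eta01 by auto
    finally show "measure_pmf.expectation p (\<lambda>x. Z i x * Z j x) \<le> (if i = j then \<eta> else 0)" .
  qed
  also have "\<dots> = real (card I) * \<eta>" using assms(1) by simp
  finally show ?thesis unfolding sq .
qed simp

lemma chebyshev_card:
  assumes "finite I"
    and indep: "\<And>i j. i \<in> I \<Longrightarrow> j \<in> I \<Longrightarrow> i \<noteq> j \<Longrightarrow> pr p (\<lambda>x. P i x \<and> P j x) = \<eta> * \<eta>"
    and eta: "\<And>i. i \<in> I \<Longrightarrow> pr p (P i) = \<eta>"
    and d: "0 < d"
  shows "pr p (\<lambda>x. d \<le> \<bar>real (card {i \<in> I. P i x}) - real (card I) * \<eta>\<bar>) \<le> real (card I) * \<eta> / d\<^sup>2"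
proof -
  define W where "W x = real (card {i \<in> I. P i x}) - real (card I) * \<eta>" for x
  have bdd: "\<bar>W x\<bar> \<le> real (card I) + real (card I) * \<bar>\<eta>\<bar>" for x
  proof -
    have "card {i \<in> I. P i x} \<le> card I" using assms(1) by (intro card_mono) auto
    then show ?thesis unfolding W_def
      using abs_triangle_ineq4[of "real (card {i \<in> I. P i x})" "real (card I) * \<eta>"] by (simp add: abs_mult)
  qed
  have "pr p (\<lambda>x. d \<le> \<bar>W x\<bar>) * d\<^sup>2 = measure_pmf.expectation p (\<lambda>x. of_bool (d \<le> \<bar>W x\<bar>) * d\<^sup>2)"
    by (simp add: expectation_indicator)
  also have "\<dots> \<le> measure_pmf.expectation p (\<lambda>x. (W x)\<^sup>2)"
  proof (rule integral_mono)
    show "integrable (measure_pmf p) (\<lambda>x. (W x)\<^sup>2)"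
      by (rule integrable_bdd[where B = "(real (card I) + real (card I) * \<bar>\<eta>\<bar>)\<^sup>2"])
        (use bdd in \<open>auto simp: abs_le_square_iff[symmetric]\<close>)
    show "of_bool (d \<le> \<bar>W x\<bar>) * d\<^sup>2 \<le> (W x)\<^sup>2" for x
      using d by (auto simp: abs_le_square_iff[symmetric])
  qed simp
  also have "\<dots> \<le> real (card I) * \<eta>"
    using second_moment_card[OF assms(1) indep eta] by (simp add: W_def)
  finally show ?thesis using d by (simp add: pos_le_divide_eq W_def)
qed

section \<open>From randomised schemes to linear sketches\<close>

text \<open>Chernoff's method with base 2: the expectation of 2 to the number of bad entries is at
  most \<open>exp (card B * \<xi> / 4)\<close>, while on the event in question this power is at
  least \<open>exp (card B * \<xi> / 2)\<close>, as \<open>ln 2 \<ge> 1 / 2\<close>. The gap between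
  \<xi> and \<open>\<xi> / 4\<close> pays for this crude form.\<close>

lemma card_bad_tail:
  assumes fin: "finite B" and bad: "pr D bad \<le> \<xi> / 4" and \<xi>: "0 \<le> \<xi>"
  shows "pr (Pi_pmf B u (\<lambda>_. D)) (\<lambda>W. \<xi> * real (card B) < real (card {b \<in> B. bad (W b)}))
    \<le> exp (- (real (card B) * \<xi> / 4))"
proof -
  define N where "N = real (card B)"
  define Q where "Q = Pi_pmf B u (\<lambda>_. D)"
  define X where "X W = (\<Prod>b\<in>B. if bad (W b) then 2 else (1 :: real))" for W
  have X: "X W = 2 powr real (card {b \<in> B. bad (W b)})" for W
    using fin by (simp add: X_def prod.If_cases powr_realpow Int_def)
  have bdd: "\<bar>if P then 2 else (1 :: real)\<bar> \<le> 2" for P by simp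
  have intX: "integrable (measure_pmf Q) X"
    unfolding X_def Q_def by (rule integrable_prod_Pi_pmf[OF fin]) (rule integrable_bdd[OF bdd])
  have "(\<lambda>w. if bad w then 2 else (1 :: real)) = (\<lambda>w. 1 + of_bool (bad w))" by auto
  then have E1: "measure_pmf.expectation D (\<lambda>w. if bad w then 2 else (1 :: real)) = 1 + pr D bad"
    by (simp add: expectation_indicator)
  have "measure_pmf.expectation Q X = (\<Prod>b\<in>B. measure_pmf.expectation D (\<lambda>w. if bad w then 2 else 1))"
    unfolding X_def Q_def
    by (rule expectation_prod_Pi_pmf[OF fin]) (auto intro: integrable_bdd[OF bdd])
  also have "\<dots> = (1 + pr D bad) ^ card B" by (simp add: E1)
  also have "\<dots> \<le> exp (\<xi> / 4) ^ card B"
    by (intro power_mono order_trans[OF _ exp_ge_add_one_self]) (use bad in auto)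
  also have "\<dots> = exp (N * \<xi> / 4)" by (simp add: N_def exp_of_nat_mult[symmetric])
  finally have EX: "measure_pmf.expectation Q X \<le> exp (N * \<xi> / 4)" .
  have "pr Q (\<lambda>W. \<xi> * N < real (card {b \<in> B. bad (W b)})) * exp (N * \<xi> / 2)
      = measure_pmf.expectation Q (\<lambda>W. of_bool (\<xi> * N < real (card {b \<in> B. bad (W b)})) * exp (N * \<xi> / 2))"
    by (simp add: expectation_indicator)
  also have "\<dots> \<le> measure_pmf.expectation Q X"
  proof (rule integral_mono)
    fix W
    have "exp (N * \<xi> / 2) \<le> X W" if "\<xi> * N < real (card {b \<in> B. bad (W b)})"
    proof -
      have "N * \<xi> / 2 \<le> real (card {b \<in> B. bad (W b)}) * (1 / 2)" using that by (simp add: mult.commute)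
      also have "\<dots> \<le> real (card {b \<in> B. bad (W b)}) * ln 2"
        using ln2_ge_two_thirds by (intro mult_left_mono) auto
      finally show ?thesis by (simp add: X powr_def)
    qed
    then show "of_bool (\<xi> * N < real (card {b \<in> B. bad (W b)})) * exp (N * \<xi> / 2) \<le> X W"
      by (auto simp: X)
  qed (simp_all add: intX)
  also note EX
  finally have "pr Q (\<lambda>W. \<xi> * N < real (card {b \<in> B. bad (W b)})) \<le> exp (N * \<xi> / 4) / exp (N * \<xi> / 2)"
    by (simp add: pos_le_divide_eq)
  also have "\<dots> = exp (- (N * \<xi> / 4))" by (simp add: exp_diff[symmetric])
  finally show ?thesis by (simp add: N_def Q_def)
qed

text \<open>The probabilistic method: a random table \<open>W\<close> fails for some
  \<open>x\<close> with probability less than 1, so one table is good for every \<open>x\<close> at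
  once. A random index \<open>b\<close> is then all the randomness that remains.\<close>

lemma derandomise:
  assumes fin: "finite B" "finite X"
    and bad: "\<And>x. x \<in> X \<Longrightarrow> pr D (bad x) \<le> \<xi> / 4" and \<xi>: "0 \<le> \<xi>"
    and small: "real (card X) * exp (- (real (card B) * \<xi> / 4)) < 1"
  shows "\<exists>W. \<forall>x\<in>X. real (card {b \<in> B. bad x (W b)}) \<le> \<xi> * real (card B)"
proof -
  define Q where "Q = Pi_pmf B undefined (\<lambda>_. D)"
  define P where "P W = (\<exists>x\<in>X. \<xi> * real (card B) < real (card {b \<in> B. bad x (W b)}))" for W
  have "pr Q P \<le> real (card X) * exp (- (real (card B) * \<xi> / 4))"
    unfolding P_def Q_def by (rule pr_ex_bound[OF fin(2)]) (rule card_bad_tail[OF fin(1) bad \<xi>])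
  then have "pr Q P < 1" using small by simp
  then have "\<exists>W. \<not> P W" by (metis UNIV_I Collect_cong UNIV_def measure_pmf_UNIV less_irrefl)
  then show ?thesis by (auto simp: P_def not_less)
qed

section \<open>Measurements modulo a prime and the number of graphs\<close>

definition pairs :: "nat \<Rightarrow> nat set set" where
  "pairs n = {e. e \<subseteq> {1..n} \<and> card e = 2}"

lemma finite_pairs [simp]: "finite (pairs n)"
  by (rule finite_subset[of _ "Pow {1..n}"]) (auto simp: pairs_def)

lemma card_pairs: "card (pairs n) = n choose 2"
  unfolding pairs_def using n_subsets[of "{1..n}" 2] by simp

text \<open>Rows are indexed by an arbitrary type, so that probes and cells keep their natural
  indices until the matrix is assembled.\<close>

definition meas :: "nat \<Rightarrow> nat \<Rightarrow> ('i \<Rightarrow> nat set \<Rightarrow> int) \<Rightarrow> (nat set \<Rightarrow> int) \<Rightarrow> 'i \<Rightarrow> int" where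
  "meas n p \<Phi> x i = (\<Sum>e\<in>pairs n. \<Phi> i e * x e) mod int p"

lemma sum_pairs: "(\<Sum>e\<in>pairs n. f e) = (\<Sum>j<n choose 2. f (vertex_pairs n ! j))"
proof -
  have "bij_betw ((!) (vertex_pairs n)) {..<n choose 2} (pairs n)"
    using bij_betw_nth[OF distinct_vertex_pairs, of "{..<n choose 2}" n "pairs n"]
    by (simp add: length_vertex_pairs set_vertex_pairs pairs_def)
  then show ?thesis by (rule sum.reindex_bij_betw[symmetric])
qed

text \<open>A graph is determined by its multiplicities on \<open>pairs n\<close>, each one of
  \<open>k + 1\<close> values. The logarithm of this count is quadratic in \<open>n\<close>, hence
  \<open>O(log n)\<close> seed bits suffice.\<close>

lemma finite_graphs: "finite {E. graph_on n k E}"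
  and card_graphs: "card {E. graph_on n k E} \<le> (k + 1) ^ (n choose 2)"
proof -
  define F where "F E = restrict (count E) (pairs n)" for E :: "nat set multiset"
  have inj: "inj_on F {E. graph_on n k E}"
  proof (rule inj_onI)
    fix E E' assume E: "E \<in> {E. graph_on n k E}" "E' \<in> {E. graph_on n k E}" and eq: "F E = F E'"
    show "E = E'"
    proof (rule multiset_eqI)
      fix e
      show "count E e = count E' e"
      proof (cases "e \<in> pairs n")
        case True
        with fun_cong[OF eq, of e] show ?thesis by (simp add: F_def)
      next
        case False
        then have "e \<notin># E" "e \<notin># E'" using E by (auto simp: graph_on_def pairs_def)
        then show ?thesis by (simp add: not_in_iff)
      qed
    qed
  qed
  have sub: "F ` {E. graph_on n k E} \<subseteq> PiE (pairs n) (\<lambda>_. {..k})"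
    by (auto simp: F_def graph_on_def)
  have finP: "finite (PiE (pairs n) (\<lambda>_. {..k}))" by (intro finite_PiE) auto
  show "finite {E. graph_on n k E}"
    using finite_subset[OF sub finP] inj finite_imageD by blast
  have "card {E. graph_on n k E} = card (F ` {E. graph_on n k E})" by (rule card_image[OF inj, symmetric])
  also have "\<dots> \<le> card (PiE (pairs n) (\<lambda>_. {..k}))" by (rule card_mono[OF finP sub])
  also have "\<dots> = (k + 1) ^ (n choose 2)" by (simp add: card_PiE card_pairs)
  finally show "card {E. graph_on n k E} \<le> (k + 1) ^ (n choose 2)" .
qed

text \<open>The seed is written into the first row of the matrix as multiples of \<open>p\<close>, which the
  measurement does not see, so that the recovery algorithm can read it off.\<close>

lemma sketch_of_seeds:
  fixes W :: "bool list \<Rightarrow> 'w" and \<Phi> :: "'w \<Rightarrow> 'i \<Rightarrow> nat set \<Rightarrow> int" and Out :: "'w \<Rightarrow> (nat set \<Rightarrow> int) \<Rightarrow> 'sol"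
  assumes p: "prime p" and I: "finite I" and l: "l \<le> n choose 2" "I = {} \<Longrightarrow> l = 0"
    and factor: "\<And>w x y. (\<And>i. i \<in> I \<Longrightarrow> meas n p (\<Phi> w) x i = meas n p (\<Phi> w) y i) \<Longrightarrow> Out w x = Out w y"
    and seeds: "\<And>E. graph_on n k E \<Longrightarrow>
      real (card {b. length b = l \<and> \<not> ok E (Out (W b) (\<lambda>e. int (count E e)))}) \<le> \<xi> * 2 ^ l"
  shows "\<exists>S. linear_sketch (n choose 2) (2 * int p) S \<and>
    (\<forall>E. graph_on n k E \<longrightarrow>
      measure_pmf.prob (sk_code S) {b. ok E (sketch_output S (edge_vec n E) b)} \<ge> 1 - \<xi> \<and>
      (\<forall>b\<in>set_pmf (sk_code S). sketch_bits S (edge_vec n E) b = l + card I * nat \<lceil>log 2 (real p)\<rceil>))"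
proof -
  define m where "m = n choose 2"
  define B where "B = {b :: bool list. length b = l}"
  have p0: "p > 0" using p prime_gt_0_nat by blast
  have B: "finite B" "card B = 2 ^ l" "B \<noteq> {}"
    using finite_lists_length_eq[of "UNIV :: bool set" l] card_lists_length_eq[of "UNIV :: bool set" l]
      Ex_list_of_length[of l]
    by (auto simp: B_def)
  obtain g where g: "bij_betw g {..<card I} I"
    using ex_bij_betw_nat_finite[OF I] by (auto simp: atLeast0LessThan)
  define M where "M b = Matrix.mat (card I) m (\<lambda>(i, j). \<Phi> (W b) (g i) (vertex_pairs n ! j) mod int p
    + (if i = 0 \<and> j < l \<and> b ! j then int p else 0))" for b
  \<comment> \<open>A reduced entry is below \<open>p\<close>, so an entry of the first row reaches
    \<open>p\<close> exactly if the seed bit was added to it.\<close>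
  define bits where "bits A = map (\<lambda>j. int p \<le> A $$ (0, j)) [0..<l]" for A :: "int mat"
  \<comment> \<open>Any vector with the observed measurements will do, since by
    \<open>factor\<close> the output depends on the measurements only.\<close>
  define rec where "rec A y = (let w = W (bits A) in
    Out w (SOME x. \<forall>i<card I. meas n p (\<Phi> w) x (g i) = vec_index y i))" for A y
  define S where "S = \<lparr>sk_char = p, sk_rows = card I, sk_code = pmf_of_set B, sk_matrix = M, sk_recover = rec\<rparr>"
  have bits: "bits (M b) = b" if "b \<in> B" for b
  proof (rule nth_equalityI)
    fix j assume "j < length (bits (M b))"
    then have j: "j < l" by (simp add: bits_def)
    \<comment> \<open>A nonempty seed needs a first row to be written into.\<close>
    then have "I \<noteq> {}" using l by auto
    then have "0 < card I" using I by (simp add: card_gt_0_iff)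
    then show "bits (M b) ! j = b ! j"
      using j l p0 pos_mod_bound[of "int p"] pos_mod_sign[of "int p"] by (auto simp: bits_def M_def m_def not_le)
  qed (use that in \<open>simp add: bits_def B_def\<close>)
  have vec: "vec_index (measurement S b (edge_vec n E)) i = meas n p (\<Phi> (W b)) (\<lambda>e. int (count E e)) (g i)"
    if "i < card I" for b E i
  proof -
    have "vec_index (measurement S b (edge_vec n E)) i =
        (\<Sum>j<m. (M b $$ (i, j)) * int (count E (vertex_pairs n ! j))) mod int p"
      using that by (simp add: measurement_def S_def M_def edge_vec_def m_def mult_mat_vec_def
        scalar_prod_def atLeast0LessThan Matrix.row_def)
    also have "\<dots> = (\<Sum>j<m. (M b $$ (i, j)) * int (count E (vertex_pairs n ! j)) mod int p) mod int p"
      by (simp add: mod_sum_eq)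
    also have "\<dots> = (\<Sum>j<m. \<Phi> (W b) (g i) (vertex_pairs n ! j) * int (count E (vertex_pairs n ! j)) mod int p) mod int p"
      by (rule arg_cong[where f = "\<lambda>s. s mod int p"], rule sum.cong[OF refl], rule mod_mult_cong[OF _ refl])
        (use that in \<open>auto simp: M_def\<close>)
    also have "\<dots> = meas n p (\<Phi> (W b)) (\<lambda>e. int (count E e)) (g i)"
      by (simp add: meas_def sum_pairs m_def mod_sum_eq)
    finally show ?thesis .
  qed
  have out: "sketch_output S (edge_vec n E) b = Out (W b) (\<lambda>e. int (count E e))" if b: "b \<in> B" for b E
  proof -
    let ?x = "\<lambda>e. int (count E e)"
    let ?P = "\<lambda>x. \<forall>i<card I. meas n p (\<Phi> (W b)) x (g i) = vec_index (measurement S b (edge_vec n E)) i"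
    have "?P ?x" by (simp add: vec)
    then have P: "?P (SOME x. ?P x)" by (rule someI[where P = ?P])
    have "Out (W b) (SOME x. ?P x) = Out (W b) ?x"
    proof (rule factor)
      fix i assume "i \<in> I"
      then obtain j where "j < card I" "i = g j" using g by (auto simp: bij_betw_def)
      then show "meas n p (\<Phi> (W b)) (SOME x. ?P x) i = meas n p (\<Phi> (W b)) ?x i"
        using P vec by simp
    qed
    then show ?thesis
      using bits[OF b] by (simp add: sketch_output_def S_def rec_def Let_def)
  qed
  have lin: "linear_sketch (n choose 2) (2 * int p) S"
    unfolding linear_sketch_def
  proof (intro conjI ballI allI impI)
    fix b i j assume ij: "i < sk_rows S" "j < n choose 2"
    have "0 \<le> a mod int p" "a mod int p \<le> int p" "a mod int p \<le> 2 * int p" for a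
      using p0 pos_mod_bound[of "int p" a] pos_mod_sign[of "int p" a] by linarith+
    then show "\<bar>sk_matrix S b $$ (i, j)\<bar> \<le> 2 * int p"
      using ij by (auto simp: S_def M_def m_def less_imp_le)
  qed (auto simp: S_def p M_def m_def)
  have "1 - \<xi> \<le> measure_pmf.prob (sk_code S) {b. ok E (sketch_output S (edge_vec n E) b)}"
    if E: "graph_on n k E" for E
  proof -
    have "pr (pmf_of_set B) (\<lambda>b. \<not> ok E (sketch_output S (edge_vec n E) b)) =
        pr (pmf_of_set B) (\<lambda>b. \<not> ok E (Out (W b) (\<lambda>e. int (count E e))))"
      by (rule pr_cong) (use B in \<open>simp add: out\<close>)
    also have "\<dots> = real (card {b. length b = l \<and> \<not> ok E (Out (W b) (\<lambda>e. int (count E e)))}) / real (card B)"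
      using B by (subst measure_pmf_of_set) (auto simp: Int_def B_def)
    also have "\<dots> \<le> \<xi>"
      using seeds[OF E] B by (auto simp: divide_le_eq card_gt_0_iff)
    finally show ?thesis by (simp add: S_def pr_not)
  qed
  moreover have "sketch_bits S (edge_vec n E) b = l + card I * nat \<lceil>log 2 (real p)\<rceil>"
    if "b \<in> set_pmf (sk_code S)" for E b
    using that B p0 by (simp add: sketch_bits_def S_def entry_bits_def B_def)
  ultimately show ?thesis using lin by blast
qed

text \<open>Newman's argument: random seeds serve all the finitely many graphs at once.\<close>

lemma sketch_of_randomised_scheme:
  fixes \<Phi> :: "'w \<Rightarrow> 'i \<Rightarrow> nat set \<Rightarrow> int" and Out :: "'w \<Rightarrow> (nat set \<Rightarrow> int) \<Rightarrow> 'sol"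
  assumes p: "prime p" and I: "finite I" and l: "l \<le> n choose 2" "I = {} \<Longrightarrow> l = 0" and \<xi>: "0 \<le> \<xi>"
    and factor: "\<And>w x y. (\<And>i. i \<in> I \<Longrightarrow> meas n p (\<Phi> w) x i = meas n p (\<Phi> w) y i) \<Longrightarrow> Out w x = Out w y"
    and seeds: "real ((k + 1) ^ (n choose 2)) * exp (- (2 ^ l * \<xi> / 4)) < 1"
    and prob: "\<And>E. graph_on n k E \<Longrightarrow> pr D (\<lambda>w. \<not> ok E (Out w (\<lambda>e. int (count E e)))) \<le> \<xi> / 4"
  shows "\<exists>S. linear_sketch (n choose 2) (2 * int p) S \<and>
    (\<forall>E. graph_on n k E \<longrightarrow>
      measure_pmf.prob (sk_code S) {b. ok E (sketch_output S (edge_vec n E) b)} \<ge> 1 - \<xi> \<and>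
      (\<forall>b\<in>set_pmf (sk_code S). sketch_bits S (edge_vec n E) b = l + card I * nat \<lceil>log 2 (real p)\<rceil>))"
proof -
  define X where "X = {E. graph_on n k E}"
  define B where "B = {b :: bool list. length b = l}"
  have B: "finite B" "card B = 2 ^ l"
    using finite_lists_length_eq[of "UNIV :: bool set" l] card_lists_length_eq[of "UNIV :: bool set" l]
    by (auto simp: B_def)
  have "real (card X) * exp (- (2 ^ l * \<xi> / 4)) \<le> real ((k + 1) ^ (n choose 2)) * exp (- (2 ^ l * \<xi> / 4))"
    unfolding X_def by (intro mult_right_mono of_nat_mono card_graphs) simp
  then have small: "real (card X) * exp (- (real (card B) * \<xi> / 4)) < 1"
    using seeds by (simp only: B(2) of_nat_power of_nat_numeral)
  obtain W where "\<forall>E\<in>X. real (card {b \<in> B. \<not> ok E (Out (W b) (\<lambda>e. int (count E e)))}) \<le> \<xi> * real (card B)"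
    using derandomise[OF B(1) _ _ \<xi> small, of D "\<lambda>E w. \<not> ok E (Out w (\<lambda>e. int (count E e)))"]
      finite_graphs[of n k] prob by (auto simp: X_def)
  then show ?thesis
    by (intro sketch_of_seeds[where W = W and \<Phi> = \<Phi> and Out = Out] p I l factor) (simp_all add: X_def B(2), simp add: B_def)
qed

section \<open>Probing for edges\<close>

text \<open>This quantity links the two parts. It governs the success of a probe with rate \<rho>,
  and for \<open>\<rho> = 2 / M\<close> it bounds the chance that a given pair of \<open>M\<close>
  cells receives an edge of \<open>G\<close>.\<close>

definition touch :: "nat set \<Rightarrow> real \<Rightarrow> nat set set \<Rightarrow> real" where
  "touch V \<rho> G = pr (Pi_pmf V False (\<lambda>_. bernoulli_pmf \<rho>)) (\<lambda>S. \<exists>f\<in>G. \<forall>v\<in>f. S v)"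

definition avoid :: "nat set set \<Rightarrow> nat set \<Rightarrow> nat set set" where
  "avoid E T = {e \<in> E. e \<inter> T = {}}"

text \<open>The level \<open>l\<close> guesses the number of edges inside \<open>S\<close>: if it is right, then a single one
  survives with constant probability.\<close>

definition edge_probe :: "nat \<Rightarrow> nat \<Rightarrow> real \<Rightarrow> nat set set pmf" where
  "edge_probe n L \<rho> = bind_pmf (Pi_pmf {1..n} False (\<lambda>_. bernoulli_pmf \<rho>)) (\<lambda>S.
     bind_pmf (pmf_of_set {..L}) (\<lambda>l.
       map_pmf (\<lambda>F. {e \<in> pairs n. (\<forall>v\<in>e. S v) \<and> F e})
         (Pi_pmf (pairs n) False (\<lambda>_. bernoulli_pmf (1 / 2 ^ l)))))"

lemma pr_bernoulli: "0 \<le> r \<Longrightarrow> r \<le> 1 \<Longrightarrow> pr (bernoulli_pmf r) (\<lambda>b. b) = r"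
  "0 \<le> r \<Longrightarrow> r \<le> 1 \<Longrightarrow> pr (bernoulli_pmf r) (\<lambda>b. \<not> b) = 1 - r"
  "0 \<le> r \<Longrightarrow> r \<le> 1 \<Longrightarrow> pr (bernoulli_pmf r) (\<lambda>b. b = c) = (if c then r else 1 - r)"
proof -
  have 1: "{b. b} = {True}" "{b. \<not> b} = {False}" "{b :: bool. b = c} = {c}" by auto
  show "0 \<le> r \<Longrightarrow> r \<le> 1 \<Longrightarrow> pr (bernoulli_pmf r) (\<lambda>b. b) = r"
    "0 \<le> r \<Longrightarrow> r \<le> 1 \<Longrightarrow> pr (bernoulli_pmf r) (\<lambda>b. \<not> b) = 1 - r"
    "0 \<le> r \<Longrightarrow> r \<le> 1 \<Longrightarrow> pr (bernoulli_pmf r) (\<lambda>b. b = c) = (if c then r else 1 - r)"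
    unfolding 1 by (auto simp: measure_pmf_single)
qed

lemma pr_bind_ge_atom: "pmf p x * pr (f x) P \<le> pr (bind_pmf p f) P"
proof (rule pr_bind_ge_mult)
  show "pmf p x \<le> pr p (\<lambda>y. y = x)" by (simp add: measure_pmf_single)
qed auto

text \<open>The events that \<open>f\<close> alone survives are disjoint and have probability
  \<open>r * (1 - r) ^ (card Z - 1)\<close> each. Here \<open>card Z * r \<ge> 1 / 4\<close>, and
  the power is at least \<open>1 / 2\<close> by Bernoulli's inequality.\<close>

lemma isolate_rate:
  assumes P: "finite P" "Z \<subseteq> P" and r: "0 \<le> r" "1 / (4 * real (card Z)) \<le> r" "r \<le> 1 / (2 * real (card Z))" and Z: "Z \<noteq> {}"
  shows "1 / 8 \<le> pr (Pi_pmf P False (\<lambda>_. bernoulli_pmf r)) (\<lambda>F. \<exists>f. {e \<in> Z. F e} = {f})"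
proof -
  have finZ: "finite Z" using P finite_subset by auto
  then have z: "1 \<le> card Z" using Z by (simp add: Suc_le_eq card_gt_0_iff)
  have r1: "r \<le> 1" using r(3) z by (auto intro: order_trans simp: divide_le_eq)
  let ?Q = "Pi_pmf P False (\<lambda>_. bernoulli_pmf r)"
  define A where "A f = {F. \<forall>e\<in>Z. F e = (e = f)}" for f
  have A: "measure_pmf.prob ?Q (A f) = r * (1 - r) ^ (card Z - 1)" if "f \<in> Z" for f
  proof -
    have "measure_pmf.prob ?Q (A f) = (\<Prod>e\<in>Z. pr (bernoulli_pmf r) (\<lambda>b. b = (e = f)))"
      unfolding A_def by (rule pr_Pi_all_subset[OF P])
    also have "\<dots> = (\<Prod>e\<in>Z. if e = f then r else 1 - r)"
      using r(1) r1 by (intro prod.cong refl) (simp only: pr_bernoulli)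
    also have "\<dots> = r * (1 - r) ^ (card Z - 1)"
      using finZ that by (subst prod.remove[of _ f]) (auto simp: prod.If_cases)
    finally show ?thesis .
  qed
  have "1 / 8 \<le> real (card Z) * r * (1 / 2)"
    using r(2) z by (simp add: divide_le_eq mult.commute)
  also have "\<dots> \<le> real (card Z) * r * (1 - r) ^ (card Z - 1)"
  proof (rule mult_left_mono)
    have "real (card Z - 1) * r \<le> real (card Z) * (1 / (2 * real (card Z)))"
      using r by (intro mult_mono) auto
    also have "\<dots> = 1 / 2" using z by simp
    finally have "1 / 2 \<le> 1 + real (card Z - 1) * (- r)" by simp
    also have "\<dots> \<le> (1 + (- r)) ^ (card Z - 1)" by (rule Bernoulli_inequality) (use r1 in simp)
    finally show "1 / 2 \<le> (1 - r) ^ (card Z - 1)" by simp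
  qed (use r in simp)
  also have "\<dots> = (\<Sum>f\<in>Z. measure_pmf.prob ?Q (A f))" by (simp add: A)
  also have "\<dots> = measure_pmf.prob ?Q (\<Union>f\<in>Z. A f)"
    by (rule measure_pmf.finite_measure_finite_Union[symmetric])
      (use finZ in \<open>auto simp: A_def disjoint_family_on_def\<close>)
  also have "\<dots> \<le> pr ?Q (\<lambda>F. \<exists>f. {e \<in> Z. F e} = {f})"
    by (rule measure_pmf.finite_measure_mono) (auto simp: A_def)
  finally show ?thesis .
qed

lemma isolate:
  assumes P: "finite P" "Z \<subseteq> P" and Z: "Z \<noteq> {}" and L: "4 * card P \<le> 2 ^ L"
  shows "1 / (8 * (real L + 1)) \<le> pr (bind_pmf (pmf_of_set {..L}) (\<lambda>l.
    Pi_pmf P False (\<lambda>_. bernoulli_pmf (1 / 2 ^ l)))) (\<lambda>F. \<exists>f. {e \<in> Z. F e} = {f})"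
proof -
  have finZ: "finite Z" using P finite_subset by auto
  then have z: "1 \<le> card Z" using Z by (simp add: Suc_le_eq card_gt_0_iff)
  then obtain l0 where l0: "2 ^ l0 \<le> card Z" "card Z < 2 ^ (l0 + 1)"
    using ex_power_ivl1[of 2 "card Z"] by auto
  \<comment> \<open>The shift by 2 gives \<open>2 * card Z \<le> 2 ^ l \<le> 4 * card Z\<close>, the
    range of rates that \<open>isolate_rate\<close> accepts, and still
    \<open>l \<le> L\<close>.\<close>
  define l where "l = l0 + 2"
  have "(2 :: nat) ^ l \<le> 4 * card Z" using l0 by (simp add: l_def)
  also have "\<dots> \<le> 4 * card P" using P by (simp add: card_mono)
  also note L
  finally have lL: "l \<le> L" by simp
  have l1: "real (2 ^ l) \<le> real (4 * card Z)" "real (2 * card Z) \<le> real (2 ^ l)"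
    using l0 unfolding of_nat_le_iff l_def by (auto simp: numeral_eq_Suc)
  have "1 / (8 * (real L + 1)) = pmf (pmf_of_set {..L}) l * (1 / 8)"
    using lL by (simp add: pmf_of_set)
  also have "\<dots> \<le> pmf (pmf_of_set {..L}) l *
      pr (Pi_pmf P False (\<lambda>_. bernoulli_pmf (1 / 2 ^ l))) (\<lambda>F. \<exists>f. {e \<in> Z. F e} = {f})"
    using l1 z by (intro mult_left_mono isolate_rate[OF P _ _ _ Z]) (auto intro!: divide_left_mono)
  also have "\<dots> \<le> pr (bind_pmf (pmf_of_set {..L}) (\<lambda>l.
    Pi_pmf P False (\<lambda>_. bernoulli_pmf (1 / 2 ^ l)))) (\<lambda>F. \<exists>f. {e \<in> Z. F e} = {f})"
    by (rule pr_bind_ge_atom)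
  finally show ?thesis .
qed

lemma pr_miss:
  assumes "finite V" "T \<subseteq> V" "0 \<le> \<rho>" "\<rho> \<le> 1"
  shows "1 - real (card T) * \<rho> \<le> pr (Pi_pmf V False (\<lambda>_. bernoulli_pmf \<rho>)) (\<lambda>S. \<forall>v\<in>T. \<not> S v)"
proof -
  have "1 - real (card T) * \<rho> = 1 + real (card T) * (- \<rho>)" by simp
  also have "\<dots> \<le> (1 + (- \<rho>)) ^ card T" by (rule Bernoulli_inequality) (use assms in simp)
  also have "\<dots> = pr (Pi_pmf V False (\<lambda>_. bernoulli_pmf \<rho>)) (\<lambda>S. \<forall>v\<in>T. \<not> S v)"
    using assms by (subst pr_Pi_all_subset) (auto simp: pr_bernoulli)
  finally show ?thesis .
qed

text \<open>Missing \<open>T\<close> and containing an edge that avoids \<open>T\<close> concern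
  disjoint sets of vertices, so both happen with probability at least half of the touch probability.
  Then all edges inside the sample avoid \<open>T\<close>, in particular the isolated one. The rest
  of the 16 is the 8 from \<open>isolate\<close>.\<close>

lemma edge_probe_hit:
  assumes T: "T \<subseteq> {1..n}" "real (card T) * \<rho> \<le> 1 / 2" and \<rho>: "0 \<le> \<rho>" "\<rho> \<le> 1"
    and E: "E \<subseteq> pairs n" and L: "4 * card (pairs n) \<le> 2 ^ L"
  shows "touch {1..n} \<rho> (avoid E T) / (16 * (real L + 1)) \<le>
    pr (edge_probe n L \<rho>) (\<lambda>Q. \<exists>f. Q \<inter> E = {f} \<and> f \<inter> T = {})"
proof -
  let ?V = "{1..n}" and ?S = "Pi_pmf {1..n} False (\<lambda>_. bernoulli_pmf \<rho>)"
  define G where "G S = ((\<forall>v\<in>T. \<not> S v) \<and> (\<exists>f\<in>avoid E T. \<forall>v\<in>f. S v))" for S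
  have "pr ?S G = pr ?S (\<lambda>S. \<forall>v\<in>T. \<not> S v) * touch ?V \<rho> (avoid E T)"
    unfolding G_def touch_def
  proof (rule pr_Pi_indep[of ?V T "?V - T"])
    fix f g :: "nat \<Rightarrow> bool" assume "\<And>x. x \<in> ?V - T \<Longrightarrow> f x = g x"
    moreover have "e \<subseteq> ?V - T" if "e \<in> avoid E T" for e using that E by (auto simp: avoid_def pairs_def)
    ultimately show "(\<exists>e\<in>avoid E T. \<forall>v\<in>e. f v) = (\<exists>e\<in>avoid E T. \<forall>v\<in>e. g v)"
      by (metis subsetD)
  qed (use T in auto)
  moreover have "1 / 2 \<le> pr ?S (\<lambda>S. \<forall>v\<in>T. \<not> S v)"
    using pr_miss[of ?V T \<rho>] T \<rho> by auto
  ultimately have G: "touch ?V \<rho> (avoid E T) / 2 \<le> pr ?S G"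
    using mult_right_mono[of "1 / 2" "pr ?S (\<lambda>S. \<forall>v\<in>T. \<not> S v)" "touch ?V \<rho> (avoid E T)"]
    by (simp add: touch_def)
  have "touch ?V \<rho> (avoid E T) / (16 * (real L + 1)) =
      touch ?V \<rho> (avoid E T) / 2 * (1 / (8 * (real L + 1)))" by simp
  also have "\<dots> \<le> pr (edge_probe n L \<rho>) (\<lambda>Q. \<exists>f. Q \<inter> E = {f} \<and> f \<inter> T = {})"
    unfolding edge_probe_def
  proof (rule pr_bind_ge_mult[OF _ G])
    fix S
    show "of_bool (G S) * (1 / (8 * (real L + 1))) \<le> pr (bind_pmf (pmf_of_set {..L}) (\<lambda>l.
       map_pmf (\<lambda>F. {e \<in> pairs n. (\<forall>v\<in>e. S v) \<and> F e})
         (Pi_pmf (pairs n) False (\<lambda>_. bernoulli_pmf (1 / 2 ^ l))))) (\<lambda>Q. \<exists>f. Q \<inter> E = {f} \<and> f \<inter> T = {})"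
    proof (cases "G S")
      case True
      define Z where "Z = {e \<in> E. \<forall>v\<in>e. S v}"
      have "1 / (8 * (real L + 1)) \<le> pr (bind_pmf (pmf_of_set {..L}) (\<lambda>l.
        Pi_pmf (pairs n) False (\<lambda>_. bernoulli_pmf (1 / 2 ^ l)))) (\<lambda>F. \<exists>f. {e \<in> Z. F e} = {f})"
        by (rule isolate) (use E L True in \<open>auto simp: Z_def G_def avoid_def\<close>)
      also have "\<dots> \<le> pr (bind_pmf (pmf_of_set {..L}) (\<lambda>l. Pi_pmf (pairs n) False (\<lambda>_. bernoulli_pmf (1 / 2 ^ l))))
        (\<lambda>F. \<exists>f. {e \<in> pairs n. (\<forall>v\<in>e. S v) \<and> F e} \<inter> E = {f} \<and> f \<inter> T = {})"
      proof (rule pr_mono)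
        fix F assume "\<exists>f. {e \<in> Z. F e} = {f}"
        then obtain f where f: "{e \<in> Z. F e} = {f}" by blast
        then have "f \<in> Z" by auto
        then have "f \<inter> T = {}" using True by (auto simp: Z_def G_def)
        moreover have "{e \<in> pairs n. (\<forall>v\<in>e. S v) \<and> F e} \<inter> E = {e \<in> Z. F e}"
          using E unfolding Z_def by blast
        ultimately show "\<exists>f. {e \<in> pairs n. (\<forall>v\<in>e. S v) \<and> F e} \<inter> E = {f} \<and> f \<inter> T = {}"
          using f by (intro exI[of _ f]) simp
      qed
      finally show ?thesis using True unfolding map_bind_pmf[symmetric] pr_map by simp
    qed simp
  qed simp
  finally show ?thesis .
qed

section \<open>Fingerprints that identify the isolated edge\<close>

definition probe :: "nat \<Rightarrow> nat \<Rightarrow> nat \<Rightarrow> nat \<Rightarrow> real \<Rightarrow> (nat set set \<times> (nat \<Rightarrow> nat set \<Rightarrow> int)) pmf" where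
  "probe n p L K \<rho> = pair_pmf (edge_probe n L \<rho>)
     (Pi_pmf {..<K} (\<lambda>_. 0) (\<lambda>_. Pi_pmf (pairs n) 0 (\<lambda>_. pmf_of_set {0..<int p})))"

text \<open>\<open>B\<close> indexes the sampling rates. Each rate gets \<open>s\<close> probes, as
  the right one depends on the unknown matching number.\<close>

definition probes :: "nat \<Rightarrow> nat \<Rightarrow> nat \<Rightarrow> nat \<Rightarrow> ('b \<Rightarrow> real) \<Rightarrow> 'b set \<Rightarrow> nat \<Rightarrow>
    ('b \<times> nat \<Rightarrow> nat set set \<times> (nat \<Rightarrow> nat set \<Rightarrow> int)) pmf" where
  "probes n p L K \<rho> B s = Pi_pmf (B \<times> {..<s}) ({}, \<lambda>_ _. 0) (\<lambda>t. probe n p L K (\<rho> (fst t)))"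

definition probe_row :: "('t \<Rightarrow> nat set set \<times> (nat \<Rightarrow> nat set \<Rightarrow> int)) \<Rightarrow> 't \<times> nat \<Rightarrow> nat set \<Rightarrow> int" where
  "probe_row \<omega> i e = (if e \<in> fst (\<omega> (fst i)) then snd (\<omega> (fst i)) (snd i) e else 0)"

text \<open>Decoding: \<open>f\<close> is reported if the \<open>K\<close> random combinations look
  like those of a vector supported on \<open>f\<close> alone with some nonzero value
  \<open>a\<close>.\<close>

definition found :: "nat \<Rightarrow> nat \<Rightarrow> nat \<Rightarrow> 't set \<Rightarrow> ('t \<Rightarrow> nat set set \<times> (nat \<Rightarrow> nat set \<Rightarrow> int)) \<Rightarrow>
    (nat set \<Rightarrow> int) \<Rightarrow> nat set set" where
  "found n p K I \<omega> x = {f \<in> pairs n. \<exists>t\<in>I. f \<in> fst (\<omega> t) \<and> (\<exists>a\<in>{1..<int p}. \<forall>\<kappa><K.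
     meas n p (probe_row \<omega>) x (t, \<kappa>) = (a * snd (\<omega> t) \<kappa> f) mod int p)}"

lemma found_cong:
  assumes "\<And>t \<kappa>. t \<in> I \<Longrightarrow> \<kappa> < K \<Longrightarrow> meas n p (probe_row \<omega>) x (t, \<kappa>) = meas n p (probe_row \<omega>) y (t, \<kappa>)"
  shows "found n p K I \<omega> x = found n p K I \<omega> y"
  using assms unfolding found_def by auto

text \<open>With all other coefficients fixed, at most one residue of the coefficient at
  \<open>e0\<close> makes the sum vanish, because \<open>w e0\<close> is invertible modulo
  \<open>p\<close>.\<close>

lemma random_row_kills:
  assumes p: "prime p" and P: "finite P" "e0 \<in> P" "\<not> int p dvd w e0"
  shows "pr (Pi_pmf P 0 (\<lambda>_. pmf_of_set {0..<int p})) (\<lambda>\<gamma>. int p dvd (\<Sum>e\<in>P. \<gamma> e * w e)) \<le> 1 / real p"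
proof (rule pr_Pi_peel_le[OF P(1,2)])
  fix \<gamma> :: "'a \<Rightarrow> int"
  have p0: "p > 0" using p prime_gt_0_nat by blast
  define s where "s = (\<Sum>e\<in>P - {e0}. \<gamma> e * w e)"
  have sum: "(\<Sum>e\<in>P. (\<gamma>(e0 := y)) e * w e) = y * w e0 + s" for y
    using P by (subst sum.remove[of _ e0]) (auto simp: s_def intro!: sum.cong)
  have fin: "finite {y \<in> {0..<int p}. int p dvd y * w e0 + s}"
    by (rule finite_subset[of _ "{0..<int p}"]) auto
  have "y = z" if y: "y \<in> {0..<int p}" "z \<in> {0..<int p}" "int p dvd y * w e0 + s" "int p dvd z * w e0 + s" for y z
  proof -
    from dvd_diff[OF y(3,4)] have "int p dvd (y - z) * w e0" by (simp add: algebra_simps)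
    then have "int p dvd y - z" using p P(3) by (simp add: prime_dvd_mult_iff)
    then have "y mod int p = z mod int p" by (simp add: mod_eq_dvd_iff)
    then show "y = z" using y by auto
  qed
  then have "card {y \<in> {0..<int p}. int p dvd y * w e0 + s} \<le> 1"
    unfolding One_nat_def card_le_Suc0_iff_eq[OF fin] by blast
  moreover have "pr (pmf_of_set {0..<int p}) (\<lambda>y. int p dvd y * w e0 + s) =
      real (card {y \<in> {0..<int p}. int p dvd y * w e0 + s}) / real p"
    using p0 by (subst measure_pmf_of_set) (auto simp: Int_def)
  ultimately show "pr (pmf_of_set {0..<int p}) (\<lambda>y. int p dvd (\<Sum>e\<in>P. (\<gamma>(e0 := y)) e * w e)) \<le> 1 / real p"
    unfolding sum by (simp add: divide_right_mono)
qed

lemma random_rows_kill: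
  assumes "prime p" "finite P" "e0 \<in> P" "\<not> int p dvd w e0"
  shows "pr (Pi_pmf {..<K} (\<lambda>_. 0) (\<lambda>_. Pi_pmf P 0 (\<lambda>_. pmf_of_set {0..<int p})))
    (\<lambda>\<gamma>. \<forall>\<kappa>\<in>{..<K}. int p dvd (\<Sum>e\<in>P. \<gamma> \<kappa> e * w e)) \<le> (1 / real p) ^ K"
proof -
  have "(\<Prod>\<kappa>\<in>{..<K}. pr (Pi_pmf P 0 (\<lambda>_. pmf_of_set {0..<int p})) (\<lambda>\<gamma>. int p dvd (\<Sum>e\<in>P. \<gamma> e * w e)))
      \<le> (\<Prod>\<kappa>\<in>{..<K}. 1 / real p)"
    by (intro prod_mono conjI random_row_kills[where w = w, OF assms]) auto
  then show ?thesis by (subst pr_Pi_all) auto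
qed

text \<open>If \<open>f\<close> is reported with value \<open>a\<close> although \<open>x f\<close>
  is 0 modulo \<open>p\<close>, then all \<open>K\<close> rows vanish on the vector that is
  \<open>x\<close> inside the probed set, less \<open>a\<close> at \<open>f\<close>. This vector is
  nonzero at \<open>f\<close>, so the rows do so with probability at most
  \<open>(1 / p) ^ K\<close>; the other factors count probes, pairs and values.\<close>

lemma found_sound:
  assumes p: "prime p" and B: "finite B"
  shows "pr (probes n p L K \<rho> B s) (\<lambda>\<omega>. \<exists>f\<in>found n p K (B \<times> {..<s}) \<omega> x. int p dvd x f)
    \<le> real (card B * s) * (real (n choose 2) * (real p * (1 / real p) ^ K))"
proof -
  let ?I = "B \<times> {..<s}"
  define bad where "bad f a \<equiv> \<lambda>(Q, \<gamma>). f \<in> Q \<and> (\<forall>\<kappa>\<in>{..<K}.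
    int p dvd (\<Sum>e\<in>pairs n. \<gamma> \<kappa> e * (if e \<in> Q then x e - (if e = f then a else 0) else 0)))" for f a
  have bad: "pr (probe n p L K r) (bad f a) \<le> (1 / real p) ^ K"
    if fa: "f \<in> pairs n" "int p dvd x f" "a \<in> {1..<int p}" for f a r
    unfolding probe_def
  proof (rule pr_pair_le_fst)
    fix Q
    let ?w = "\<lambda>e. if e \<in> Q then x e - (if e = f then a else 0) else 0"
    show "pr (Pi_pmf {..<K} (\<lambda>_. 0) (\<lambda>_. Pi_pmf (pairs n) 0 (\<lambda>_. pmf_of_set {0..<int p})))
        (\<lambda>y. bad f a (Q, y)) \<le> (1 / real p) ^ K"
    proof (cases "f \<in> Q")
      case True
      have "\<not> int p dvd a" using fa(3) by (auto dest: zdvd_imp_le)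
      then have "\<not> int p dvd ?w f" using fa(2) True by (simp add: dvd_diff_right_iff)
      from random_rows_kill[of p "pairs n" f ?w, OF p finite_pairs fa(1) this] True
      show ?thesis by (simp add: bad_def)
    qed (simp add: bad_def)
  qed
  have "pr (probes n p L K \<rho> B s) (\<lambda>\<omega>. \<exists>f\<in>found n p K ?I \<omega> x. int p dvd x f)
      \<le> pr (probes n p L K \<rho> B s) (\<lambda>\<omega>. \<exists>t\<in>?I. \<exists>f\<in>{f \<in> pairs n. int p dvd x f}. \<exists>a\<in>{1..<int p}. bad f a (\<omega> t))"
  proof (rule pr_mono)
    fix \<omega> assume "\<exists>f\<in>found n p K ?I \<omega> x. int p dvd x f"
    then obtain f t a where f: "f \<in> pairs n" "int p dvd x f" "t \<in> ?I" "f \<in> fst (\<omega> t)" "a \<in> {1..<int p}"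
      and eq: "\<And>\<kappa>. \<kappa> < K \<Longrightarrow> meas n p (probe_row \<omega>) x (t, \<kappa>) = (a * snd (\<omega> t) \<kappa> f) mod int p"
      unfolding found_def by blast
    have "bad f a (\<omega> t)"
    proof -
      have "int p dvd (\<Sum>e\<in>pairs n. snd (\<omega> t) \<kappa> e * (if e \<in> fst (\<omega> t) then x e - (if e = f then a else 0) else 0))"
        if "\<kappa> < K" for \<kappa>
      proof -
        have "(\<Sum>e\<in>pairs n. snd (\<omega> t) \<kappa> e * (if e \<in> fst (\<omega> t) then x e - (if e = f then a else 0) else 0)) =
          (\<Sum>e\<in>pairs n. probe_row \<omega> (t, \<kappa>) e * x e - (if e = f then a * snd (\<omega> t) \<kappa> f else 0))"
          by (rule sum.cong[OF refl]) (use f(4) in \<open>auto simp: probe_row_def algebra_simps\<close>)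
        also have "\<dots> = (\<Sum>e\<in>pairs n. probe_row \<omega> (t, \<kappa>) e * x e) - a * snd (\<omega> t) \<kappa> f"
          using f(1) by (simp add: sum_subtractf)
        finally show ?thesis using eq[OF that] by (simp add: meas_def mod_eq_dvd_iff)
      qed
      then show ?thesis using f(4) by (simp add: bad_def case_prod_unfold)
    qed
    then show "\<exists>t\<in>?I. \<exists>f\<in>{f \<in> pairs n. int p dvd x f}. \<exists>a\<in>{1..<int p}. bad f a (\<omega> t)" using f by blast
  qed
  also have "\<dots> \<le> real (card ?I) * (real (n choose 2) * (real p * (1 / real p) ^ K))"
  proof (rule pr_ex_bound)
    fix t assume t: "t \<in> ?I"
    have "pr (probes n p L K \<rho> B s) (\<lambda>\<omega>. \<exists>f\<in>{f \<in> pairs n. int p dvd x f}. \<exists>a\<in>{1..<int p}. bad f a (\<omega> t)) =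
      pr (probe n p L K (\<rho> (fst t))) (\<lambda>\<omega>. \<exists>f\<in>{f \<in> pairs n. int p dvd x f}. \<exists>a\<in>{1..<int p}. bad f a \<omega>)"
      unfolding probes_def by (rule pr_Pi_component) (use t B in auto)
    also have "\<dots> \<le> real (card {f \<in> pairs n. int p dvd x f}) * (real (card {1..<int p}) * (1 / real p) ^ K)"
      by (intro pr_ex_bound bad) auto
    also have "\<dots> \<le> real (n choose 2) * (real p * (1 / real p) ^ K)"
    proof (intro mult_mono order_refl)
      show "real (card {f \<in> pairs n. int p dvd x f}) \<le> real (n choose 2)"
        unfolding card_pairs[symmetric] by (intro of_nat_mono card_mono) auto
      show "real (card {1..<int p}) \<le> real p" by simp
    qed auto
    finally show "pr (probes n p L K \<rho> B s) (\<lambda>\<omega>. \<exists>f\<in>{f \<in> pairs n. int p dvd x f}. \<exists>a\<in>{1..<int p}. bad f a (\<omega> t))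
      \<le> real (n choose 2) * (real p * (1 / real p) ^ K)" .
  qed (use B in auto)
  finally show ?thesis by (simp add: card_cartesian_product)
qed

lemma found_complete:
  assumes t: "t \<in> I" and Q: "fst (\<omega> t) \<inter> {e \<in> pairs n. \<not> int p dvd x e} = {f}" and p: "prime p"
  shows "f \<in> found n p K I \<omega> x"
proof -
  have f: "f \<in> pairs n" "f \<in> fst (\<omega> t)" "\<not> int p dvd x f" using Q by blast+
  have p0: "p > 0" using p prime_gt_0_nat by blast
  let ?a = "x f mod int p"
  have a: "?a \<in> {1..<int p}"
  proof -
    have "x f mod int p \<noteq> 0" using f(3) by (simp add: dvd_eq_mod_eq_0)
    then show ?thesis
      using p0 pos_mod_sign[of "int p" "x f"] pos_mod_bound[of "int p" "x f"]
      unfolding atLeastLessThan_iff by linarith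
  qed
  have "meas n p (probe_row \<omega>) x (t, \<kappa>) = (?a * snd (\<omega> t) \<kappa> f) mod int p" for \<kappa>
  proof -
    have "(\<Sum>e\<in>pairs n. probe_row \<omega> (t, \<kappa>) e * x e) mod int p =
        (\<Sum>e\<in>pairs n. probe_row \<omega> (t, \<kappa>) e * x e mod int p) mod int p" by (simp add: mod_sum_eq)
    also have "(\<Sum>e\<in>pairs n. probe_row \<omega> (t, \<kappa>) e * x e mod int p) =
        (\<Sum>e\<in>pairs n. if e = f then probe_row \<omega> (t, \<kappa>) f * x f mod int p else 0)"
    proof (rule sum.cong[OF refl])
      fix e assume e: "e \<in> pairs n"
      have "int p dvd x e" if "e \<noteq> f" "e \<in> fst (\<omega> t)" using Q that e by blast
      then show "probe_row \<omega> (t, \<kappa>) e * x e mod int p =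
          (if e = f then probe_row \<omega> (t, \<kappa>) f * x f mod int p else 0)"
        by (auto simp: probe_row_def dvd_eq_mod_eq_0[symmetric])
    qed
    also have "\<dots> = snd (\<omega> t) \<kappa> f * x f mod int p" using f by (simp add: probe_row_def)
    finally show ?thesis by (simp add: meas_def mod_mult_left_eq mult.commute[of "x f"])
  qed
  then show ?thesis using f t a unfolding found_def by blast
qed

text \<open>Sets are listed as words of length exactly \<open>t\<close>, padded with 0, which is no
  vertex and is removed by the intersection.\<close>

lemma card_small_subsets: "card {T. T \<subseteq> {1..n} \<and> card T \<le> t} \<le> (n + 1) ^ t"
proof -
  let ?A = "{xs. set xs \<subseteq> {0..n} \<and> length xs = t}"
  have sub: "{T. T \<subseteq> {1..n} \<and> card T \<le> t} \<subseteq> (\<lambda>xs. set xs \<inter> {1..n}) ` ?A"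
  proof safe
    fix T assume T: "T \<subseteq> {1..n}" "card T \<le> t"
    then have "finite T" using finite_subset by auto
    then obtain xs where xs: "set xs = T" "distinct xs" using finite_distinct_list by auto
    then have len: "length xs = card T" using distinct_card by metis
    show "T \<in> (\<lambda>xs. set xs \<inter> {1..n}) ` ?A"
      by (rule image_eqI[of _ _ "xs @ replicate (t - card T) 0"]) (use T xs len in auto)
  qed
  have fin: "finite ?A" by (rule finite_lists_length_eq) simp
  have "card {T. T \<subseteq> {1..n} \<and> card T \<le> t} \<le> card ?A"
    using card_mono[OF finite_imageI[OF fin] sub] card_image_le[OF fin] le_trans by blast
  then show ?thesis by (simp add: card_lists_length_eq)
qed

text \<open>The set \<open>T\<close> will be the set of vertices of a maximal matching of the edges found, which
  depends on the probes. Hence the union bound over all \<open>T\<close>.\<close>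

lemma found_blocks:
  fixes x :: "nat set \<Rightarrow> int"
  assumes p: "prime p" and B: "finite B" "b \<in> B" and \<rho>: "0 \<le> \<rho> b" "\<rho> b \<le> 1"
    and L: "4 * card (pairs n) \<le> 2 ^ L" and \<tau>: "0 \<le> \<tau>"
  defines "E \<equiv> {e \<in> pairs n. \<not> int p dvd x e}"
  shows "pr (probes n p L K \<rho> B s) (\<lambda>\<omega>. \<exists>T. T \<subseteq> {1..n} \<and> card T \<le> t \<and> real (card T) * \<rho> b \<le> 1 / 2 \<and>
      \<tau> \<le> touch {1..n} (\<rho> b) (avoid E T) \<and> (\<forall>f\<in>found n p K (B \<times> {..<s}) \<omega> x. f \<inter> T \<noteq> {}))
    \<le> real ((n + 1) ^ t) * exp (- (real s * \<tau> / (16 * (real L + 1))))"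
proof -
  define TT where "TT = {T. T \<subseteq> {1..n} \<and> card T \<le> t}"
  define TG where "TG = {T \<in> TT. real (card T) * \<rho> b \<le> 1 / 2 \<and> \<tau> \<le> touch {1..n} (\<rho> b) (avoid E T)}"
  have finTT: "finite TT" unfolding TT_def by (rule finite_subset[of _ "Pow {1..n}"]) auto
  then have finTG: "finite TG" by (simp add: TG_def)
  define hit where "hit T Q = (\<exists>f. Q \<inter> E = {f} \<and> f \<inter> T = {})" for T Q
  define q where "q = \<tau> / (16 * (real L + 1))"
  have miss: "pr (probe n p L K (\<rho> b)) (\<lambda>w. \<not> hit T (fst w)) \<le> exp (- q)" if "T \<in> TG" for T
  proof -
    have "q \<le> touch {1..n} (\<rho> b) (avoid E T) / (16 * (real L + 1))"
      unfolding q_def using that by (intro divide_right_mono) (auto simp: TG_def)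
    also have "\<dots> \<le> pr (edge_probe n L (\<rho> b)) (hit T)"
      unfolding hit_def
      by (rule edge_probe_hit) (use that \<rho> L in \<open>auto simp: TG_def TT_def E_def\<close>)
    finally have "pr (edge_probe n L (\<rho> b)) (\<lambda>Q. \<not> hit T Q) \<le> 1 + (- q)" by (simp add: pr_not)
    also have "\<dots> \<le> exp (- q)" by (rule exp_ge_add_one_self)
    finally show ?thesis unfolding probe_def by (subst pr_pair_fst[where P = "\<lambda>Q. \<not> hit T Q"])
  qed
  have "pr (probes n p L K \<rho> B s) (\<lambda>\<omega>. \<exists>T. T \<subseteq> {1..n} \<and> card T \<le> t \<and> real (card T) * \<rho> b \<le> 1 / 2 \<and>
      \<tau> \<le> touch {1..n} (\<rho> b) (avoid E T) \<and> (\<forall>f\<in>found n p K (B \<times> {..<s}) \<omega> x. f \<inter> T \<noteq> {}))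
    \<le> pr (probes n p L K \<rho> B s) (\<lambda>\<omega>. \<exists>T\<in>TG. \<forall>i\<in>{b} \<times> {..<s}. \<not> hit T (fst (\<omega> i)))"
  proof (rule pr_mono)
    fix \<omega> assume "\<exists>T. T \<subseteq> {1..n} \<and> card T \<le> t \<and> real (card T) * \<rho> b \<le> 1 / 2 \<and>
      \<tau> \<le> touch {1..n} (\<rho> b) (avoid E T) \<and> (\<forall>f\<in>found n p K (B \<times> {..<s}) \<omega> x. f \<inter> T \<noteq> {})"
    then obtain T where T: "T \<in> TG" "\<forall>f\<in>found n p K (B \<times> {..<s}) \<omega> x. f \<inter> T \<noteq> {}"
      by (auto simp: TG_def TT_def)
    \<comment> \<open>A hit isolates an edge disjoint from \<open>T\<close>, and an isolated edge is
      always decoded, so it would be a found edge that \<open>T\<close> does not meet.\<close>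
    have "\<not> hit T (fst (\<omega> i))" if "i \<in> {b} \<times> {..<s}" for i
      using T(2) found_complete[of i "B \<times> {..<s}" \<omega> n p x _ K] that p B
      unfolding hit_def E_def by blast
    with T show "\<exists>T\<in>TG. \<forall>i\<in>{b} \<times> {..<s}. \<not> hit T (fst (\<omega> i))" by blast
  qed
  also have "\<dots> \<le> real (card TG) * exp (- (real s * q))"
  proof (rule pr_ex_bound[OF finTG])
    fix T assume T: "T \<in> TG"
    have "pr (probes n p L K \<rho> B s) (\<lambda>\<omega>. \<forall>i\<in>{b} \<times> {..<s}. \<not> hit T (fst (\<omega> i))) =
        (\<Prod>i\<in>{b} \<times> {..<s}. pr (probe n p L K (\<rho> (fst i))) (\<lambda>w. \<not> hit T (fst w)))"
      unfolding probes_def by (rule pr_Pi_all_subset) (use B in auto)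
    also have "\<dots> \<le> (\<Prod>i\<in>{b} \<times> {..<s}. exp (- q))"
      by (intro prod_mono) (use miss[OF T] in auto)
    also have "\<dots> = exp (- (real s * q))" by (simp add: card_cartesian_product exp_of_nat_mult[symmetric])
    finally show "pr (probes n p L K \<rho> B s) (\<lambda>\<omega>. \<forall>i\<in>{b} \<times> {..<s}. \<not> hit T (fst (\<omega> i))) \<le> exp (- (real s * q))" .
  qed
  also have "\<dots> \<le> real ((n + 1) ^ t) * exp (- (real s * q))"
  proof (intro mult_right_mono of_nat_mono)
    have "card TG \<le> card TT" using finTT by (intro card_mono) (auto simp: TG_def)
    also have "\<dots> \<le> (n + 1) ^ t" unfolding TT_def by (rule card_small_subsets)
    finally show "card TG \<le> (n + 1) ^ t" .
  qed simp
  finally show ?thesis by (simp add: q_def)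
qed

section \<open>Lower bounds for touch probabilities\<close>

lemma pr_Pi_bernoulli_all:
  assumes "finite V" "A \<subseteq> V" "0 \<le> \<rho>" "\<rho> \<le> 1"
  shows "pr (Pi_pmf V False (\<lambda>_. bernoulli_pmf \<rho>)) (\<lambda>S. \<forall>v\<in>A. S v) = \<rho> ^ card A"
  using assms by (subst pr_Pi_all_subset) (auto simp: pr_bernoulli)

text \<open>The second Bonferroni inequality, in the form that the indicator of \<open>N \<ge> 1\<close> is at
  least \<open>(3 * N - N\<^sup>2) / 2\<close>.\<close>

lemma touch_lower:
  assumes V: "finite V" and Z: "Z \<subseteq> G" "finite Z" "\<And>f. f \<in> Z \<Longrightarrow> f \<subseteq> V \<and> card f = 2"
    and deg: "\<And>v. card {f \<in> Z. v \<in> f} \<le> D" and \<rho>: "0 \<le> \<rho>" "real D * \<rho> \<le> 1 / 8" "real (card Z) * \<rho>\<^sup>2 \<le> 1 / 2"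
    and \<rho>1: "\<rho> \<le> 1"
  shows "real (card Z) * \<rho>\<^sup>2 / 2 \<le> touch V \<rho> G"
proof -
  let ?Q = "Pi_pmf V False (\<lambda>_. bernoulli_pmf \<rho>)"
  let ?z = "real (card Z)"
  define A where "A f S = (\<forall>v\<in>f. S v)" for f and S :: "nat \<Rightarrow> bool"
  define N where "N S = real (card {f \<in> Z. A f S})" for S
  have Nsum: "N S = (\<Sum>f\<in>Z. of_bool (A f S))" for S
    using Z(2) by (auto simp: N_def Int_def sum.If_cases of_bool_def)
  have finf: "finite f" if "f \<in> Z" for f using Z(3)[OF that] V finite_subset by blast
  have prA: "pr ?Q (A f) = \<rho>\<^sup>2" if "f \<in> Z" for f
    unfolding A_def using Z(3)[OF that] pr_Pi_bernoulli_all[OF V _ \<rho>(1) \<rho>1, of f] by simp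
  \<comment> \<open>The union of two edges has 2, at least 3, or 4 vertices, according to whether
    they are equal, share one vertex, or are disjoint. Adding all the applicable terms avoids a case
    distinction in the sum.\<close>
  have prAA: "pr ?Q (\<lambda>S. A f S \<and> A g S) \<le>
      (if f = g then \<rho>\<^sup>2 else 0) + (if f \<inter> g \<noteq> {} then \<rho> ^ 3 else 0) + \<rho> ^ 4"
    if fg: "f \<in> Z" "g \<in> Z" for f g
  proof -
    have "pr ?Q (\<lambda>S. A f S \<and> A g S) = pr ?Q (\<lambda>S. \<forall>v\<in>f \<union> g. S v)"
      by (rule pr_cong) (auto simp: A_def)
    also have "\<dots> = \<rho> ^ card (f \<union> g)"
      using Z(3)[OF fg(1)] Z(3)[OF fg(2)] by (intro pr_Pi_bernoulli_all V \<rho>(1) \<rho>1) auto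
    also have "\<dots> \<le> (if f = g then \<rho>\<^sup>2 else 0) + (if f \<inter> g \<noteq> {} then \<rho> ^ 3 else 0) + \<rho> ^ 4"
    proof (cases "f = g")
      case False
      have c: "card f = 2" "card g = 2" using Z(3) fg by auto
      have un: "card (f \<union> g) + card (f \<inter> g) = 4" using card_Un_Int[OF finf[OF fg(1)] finf[OF fg(2)]] c by simp
      show ?thesis
      proof (cases "f \<inter> g = {}")
        case True
        then show ?thesis using un False by simp
      next
        case int: False
        have "card (f \<inter> g) < 2"
        proof (rule ccontr)
          assume "\<not> card (f \<inter> g) < 2"
          then have "f \<inter> g = f" "f \<inter> g = g" using c finf fg
            by (metis card_seteq Int_lower1 not_less, metis card_seteq Int_lower2 not_less)
          then show False using False by simp
        qed
        then have "3 \<le> card (f \<union> g)" using un by simp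
        then have "\<rho> ^ card (f \<union> g) \<le> \<rho> ^ 3" by (rule power_decreasing[OF _ \<rho>(1) \<rho>1])
        then show ?thesis using int False \<rho>(1) by (auto intro: order_trans simp: add_increasing2)
      qed
    qed (use Z(3) fg \<rho>(1) in \<open>auto intro!: add_increasing2\<close>)
    finally show ?thesis .
  qed
  have int_card: "card {g \<in> Z. f \<inter> g \<noteq> {}} \<le> 2 * D" if f: "f \<in> Z" for f
  proof -
    have "{g \<in> Z. f \<inter> g \<noteq> {}} = (\<Union>v\<in>f. {g \<in> Z. v \<in> g})" by auto
    then have "card {g \<in> Z. f \<inter> g \<noteq> {}} \<le> (\<Sum>v\<in>f. card {g \<in> Z. v \<in> g})"
      using card_UN_le[OF finf[OF f]] by simp
    also have "\<dots> \<le> card f * D" using sum_bounded_above[of f "\<lambda>v. card {g \<in> Z. v \<in> g}" D] deg by simp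
    finally show ?thesis using Z(3)[OF f] by simp
  qed
  have NN: "N S * N S = (\<Sum>f\<in>Z. \<Sum>g\<in>Z. of_bool (A f S \<and> A g S))" for S
    by (simp add: Nsum sum_product of_bool_conj)
  have "measure_pmf.expectation ?Q (\<lambda>S. N S * N S) = (\<Sum>f\<in>Z. \<Sum>g\<in>Z. pr ?Q (\<lambda>S. A f S \<and> A g S))"
    unfolding NN by (simp add: expectation_indicator Bochner_Integration.integral_sum del: of_bool_conj)
  also have "\<dots> \<le> (\<Sum>f\<in>Z. \<Sum>g\<in>Z. (if f = g then \<rho>\<^sup>2 else 0) + (if f \<inter> g \<noteq> {} then \<rho> ^ 3 else 0) + \<rho> ^ 4)"
    by (intro sum_mono prAA)
  also have "\<dots> = (\<Sum>f\<in>Z. \<rho>\<^sup>2 + real (card {g \<in> Z. f \<inter> g \<noteq> {}}) * \<rho> ^ 3 + ?z * \<rho> ^ 4)"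
  proof (intro sum.cong refl)
    fix f assume "f \<in> Z"
    have "(\<Sum>g\<in>Z. if f \<inter> g \<noteq> {} then \<rho> ^ 3 else 0) = (\<Sum>g\<in>{g \<in> Z. f \<inter> g \<noteq> {}}. \<rho> ^ 3)"
      by (rule sum.inter_filter[OF Z(2), symmetric])
    then show "(\<Sum>g\<in>Z. (if f = g then \<rho>\<^sup>2 else 0) + (if f \<inter> g \<noteq> {} then \<rho> ^ 3 else 0) + \<rho> ^ 4) =
        \<rho>\<^sup>2 + real (card {g \<in> Z. f \<inter> g \<noteq> {}}) * \<rho> ^ 3 + ?z * \<rho> ^ 4"
      using Z(2) \<open>f \<in> Z\<close> by (simp add: sum.distrib)
  qed
  also have "\<dots> \<le> (\<Sum>f\<in>Z. \<rho>\<^sup>2 + 2 * real D * \<rho> ^ 3 + ?z * \<rho> ^ 4)"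
  proof (intro sum_mono add_mono mult_right_mono order_refl)
    fix f assume "f \<in> Z"
    from int_card[OF this] show "real (card {g \<in> Z. f \<inter> g \<noteq> {}}) \<le> 2 * real D"
      by (metis of_nat_le_iff of_nat_mult of_nat_numeral)
  qed (use \<rho>(1) in auto)
  also have "\<dots> = ?z * \<rho>\<^sup>2 * (1 + 2 * (real D * \<rho>) + ?z * \<rho>\<^sup>2)"
    by (simp add: power2_eq_square power3_eq_cube power4_eq_xxxx algebra_simps)
  \<comment> \<open>The bounds on \<rho> keep the bracket below
    \<open>1 + 1 / 4 + 1 / 2\<close>.\<close>
  also have "\<dots> \<le> ?z * \<rho>\<^sup>2 * 2" using \<rho> by (intro mult_left_mono) auto
  finally have EN2: "measure_pmf.expectation ?Q (\<lambda>S. N S * N S) \<le> ?z * \<rho>\<^sup>2 * 2" .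
  have EN: "measure_pmf.expectation ?Q N = ?z * \<rho>\<^sup>2"
    unfolding N_def by (simp add: expectation_card[OF Z(2)] prA)
  have Nz: "\<bar>N S\<bar> \<le> ?z" for S using Z(2) by (simp add: N_def card_mono)
  have iN: "integrable (measure_pmf ?Q) N" by (rule integrable_bdd[OF Nz])
  have iNN: "integrable (measure_pmf ?Q) (\<lambda>S. N S * N S)"
    by (rule integrable_bdd[where B = "?z * ?z"]) (simp only: abs_mult, intro mult_mono Nz, auto)
  have "?z * \<rho>\<^sup>2 / 2 = (3 * (?z * \<rho>\<^sup>2) - ?z * \<rho>\<^sup>2 * 2) / 2" by simp
  also have "\<dots> \<le> (3 * measure_pmf.expectation ?Q N - measure_pmf.expectation ?Q (\<lambda>S. N S * N S)) / 2"
    using EN EN2 by simp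
  also have "\<dots> = measure_pmf.expectation ?Q (\<lambda>S. (3 * N S - N S * N S) / 2)"
    using iN iNN by simp
  also have "\<dots> \<le> measure_pmf.expectation ?Q (\<lambda>S. of_bool (\<exists>f\<in>Z. A f S))"
  proof (rule integral_mono)
    fix S
    show "(3 * N S - N S * N S) / 2 \<le> of_bool (\<exists>f\<in>Z. A f S)"
    proof (cases "\<exists>f\<in>Z. A f S")
      case True
      define m where "m = card {f \<in> Z. A f S}"
      \<comment> \<open>No integer lies strictly between 1 and 2; this is where integrality of the
        count enters.\<close>
      have "0 \<le> (real m - 1) * (real m - 2)"
      proof (cases "m \<le> 1")
        case True then show ?thesis by (intro mult_nonpos_nonpos) auto
      qed (intro mult_nonneg_nonneg; simp)
      then show ?thesis using True by (simp add: N_def m_def[symmetric] algebra_simps)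
    next
      case False
      then have "N S = 0" by (simp add: Nsum)
      then show ?thesis using False by simp
    qed
  qed (use iN iNN in simp_all)
  also have "\<dots> = pr ?Q (\<lambda>S. \<exists>f\<in>Z. A f S)" by (rule expectation_indicator)
  also have "\<dots> \<le> touch V \<rho> G"
    unfolding touch_def by (rule pr_mono) (use Z(1) in \<open>auto simp: A_def\<close>)
  finally show ?thesis .
qed

lemma touch_restrict:
  assumes "finite V" "W \<subseteq> V" "\<And>f. f \<in> G \<Longrightarrow> f \<subseteq> W" "G \<subseteq> G'"
  shows "touch W \<rho> G \<le> touch V \<rho> G'"
proof -
  have "touch W \<rho> G = touch V \<rho> G"
    unfolding touch_def
  proof (rule pr_Pi_restrict[OF assms(1,2)])
    fix S S' :: "nat \<Rightarrow> bool" assume "\<And>x. x \<in> W \<Longrightarrow> S x = S' x"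
    then have "(\<forall>v\<in>f. S v) = (\<forall>v\<in>f. S' v)" if "f \<in> G" for f using assms(3)[OF that] by (metis subsetD)
    then show "(\<exists>f\<in>G. \<forall>v\<in>f. S v) = (\<exists>f\<in>G. \<forall>v\<in>f. S' v)" by simp
  qed
  also have "\<dots> \<le> touch V \<rho> G'" unfolding touch_def by (rule pr_mono) (use assms(4) in auto)
  finally show ?thesis .
qed

text \<open>Under uniform hashing each vertex falls into cell \<open>i\<close> or \<open>j\<close>
  independently with probability \<open>2 / M\<close>, so the vertices of two cells form a sample
  with that rate.\<close>

lemma touch_two_cells:
  assumes V: "finite V" and ij: "i < M" "j < M" "i \<noteq> j"
  shows "pr (Pi_pmf V M (\<lambda>_. pmf_of_set {0..<M})) (\<lambda>c. \<exists>f\<in>G. \<forall>v\<in>f. c v \<in> {i, j}) = touch V (2 / real M) G"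
proof -
  have M: "2 \<le> M" using ij by auto
  have eq: "map_pmf (\<lambda>c. c \<in> {i, j}) (pmf_of_set {0..<M}) = bernoulli_pmf (2 / real M)"
  proof (rule pmf_eqI)
    fix b
    have set1: "{0..<M} \<inter> {x. x = i \<or> x = j} = {i, j}" using ij by auto
    have T: "pr (pmf_of_set {0..<M}) (\<lambda>c. c \<in> {i, j}) = 2 / real M"
      using M ij by (subst measure_pmf_of_set) (auto simp: set1)
    have "pmf (map_pmf (\<lambda>c. c \<in> {i, j}) (pmf_of_set {0..<M})) b = pr (pmf_of_set {0..<M}) (\<lambda>c. (c \<in> {i, j}) = b)"
      by (simp add: pmf_map vimage_def)
    also have "\<dots> = (if b then 2 / real M else 1 - 2 / real M)"
      using T pr_not[of "pmf_of_set {0..<M}" "\<lambda>c. c \<in> {i, j}"] by (cases b) simp_all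
    also have "\<dots> = pmf (bernoulli_pmf (2 / real M)) b" using M by simp
    finally show "pmf (map_pmf (\<lambda>c. c \<in> {i, j}) (pmf_of_set {0..<M})) b = pmf (bernoulli_pmf (2 / real M)) b" .
  qed
  have "Pi_pmf V False (\<lambda>_. bernoulli_pmf (2 / real M)) =
      map_pmf (\<lambda>c. (\<lambda>x. x \<in> {i, j}) \<circ> c) (Pi_pmf V M (\<lambda>_. pmf_of_set {0..<M}))"
    unfolding eq[symmetric] using ij by (intro Pi_pmf_map V) auto
  then show ?thesis unfolding touch_def by (simp only: pr_map o_def)
qed

definition degree_in :: "nat set set \<Rightarrow> nat \<Rightarrow> nat" where
  "degree_in G v = card {f \<in> G. v \<in> f}"

text \<open>Otherwise keep \<open>d\<close> edges at each of \<open>h\<close> vertices of high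
  degree. These are at least \<open>h * d / 2\<close> edges with all degrees at most
  \<open>d + h\<close>, and truncating the degrees is what makes \<open>touch_lower\<close>
  applicable; it yields a touch probability of at least the forbidden value.\<close>

lemma high_degree_few:
  assumes G: "G \<subseteq> pairs n" and d: "real d * \<rho> \<le> 1 / 16" and h: "real h * \<rho> \<le> 1 / 16"
    and \<rho>: "0 \<le> \<rho>" "\<rho> \<le> 1" and touch: "touch {1..n} \<rho> G < real h * real d * \<rho>\<^sup>2 / 4"
  shows "card {v \<in> {1..n}. d \<le> degree_in G v} < h"
proof (rule ccontr)
  assume "\<not> ?thesis"
  then have "h \<le> card {v \<in> {1..n}. d \<le> degree_in G v}" by simp
  then obtain H where H: "H \<subseteq> {v \<in> {1..n}. d \<le> degree_in G v}" "card H = h" "finite H"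
    by (rule obtain_subset_with_card_n)
  have finG: "finite G" using G finite_subset finite_pairs by blast
  have "\<exists>N. N \<subseteq> {f \<in> G. v \<in> f} \<and> card N = d" if "v \<in> H" for v
      proof -
    have "d \<le> card {f \<in> G. v \<in> f}" using that H by (auto simp: degree_in_def)
    then show ?thesis by (rule obtain_subset_with_card_n) blast
  qed
  then obtain N where N: "\<And>v. v \<in> H \<Longrightarrow> N v \<subseteq> {f \<in> G. v \<in> f} \<and> card (N v) = d" by metis
  define Z where "Z = (\<Union>v\<in>H. N v)"
  have ZG: "Z \<subseteq> G" using N by (auto simp: Z_def)
  then have finZ: "finite Z" using finG finite_subset by blast
  have finN: "finite (N v)" if "v \<in> H" for v by (rule finite_subset[OF _ finG]) (use N[OF that] in blast)
  have Zle: "card Z \<le> h * d"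
    unfolding Z_def using card_UN_le[OF H(3), of N] N H(2) by simp
  have "h * d = (\<Sum>v\<in>H. card (N v))" using N H(2) by simp
  also have "\<dots> = (\<Sum>v\<in>H. \<Sum>f\<in>Z. if f \<in> N v then 1 else 0)"
    using finZ finN by (intro sum.cong refl) (auto simp: sum.If_cases Z_def intro!: arg_cong[where f = card])
  also have "\<dots> = (\<Sum>f\<in>Z. \<Sum>v\<in>H. if f \<in> N v then 1 else 0)" by (rule sum.swap)
  \<comment> \<open>An edge is kept only by its own ends, hence at most twice.\<close>
  also have "\<dots> \<le> (\<Sum>f\<in>Z. 2)"
  proof (rule sum_mono)
    fix f assume f: "f \<in> Z"
    have "card f = 2" using f ZG G by (auto simp: pairs_def)
    then have "finite f" by (intro card_ge_0_finite) simp
    have "(\<Sum>v\<in>H. if f \<in> N v then 1 else 0 :: nat) = card {v \<in> H. f \<in> N v}"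
      using H(3) by (simp add: sum.If_cases Int_def)
    also have "\<dots> \<le> card f" by (rule card_mono) (use N \<open>finite f\<close> in blast)+
    finally show "(\<Sum>v\<in>H. if f \<in> N v then 1 else 0 :: nat) \<le> 2" using \<open>card f = 2\<close> by simp
  qed
  finally have Zge: "h * d \<le> 2 * card Z" by simp
  \<comment> \<open>At \<open>v\<close> there are at most \<open>d\<close> edges that
    \<open>v\<close> keeps itself, and for every other \<open>w\<close> in \<open>H\<close> at most
    the single pair of \<open>w\<close> and \<open>v\<close>.\<close>
  have deg: "card {f \<in> Z. v \<in> f} \<le> d + h" for v
  proof -
    have sub: "{f \<in> Z. v \<in> f} \<subseteq> (if v \<in> H then N v else {}) \<union> (\<lambda>w. {w, v}) ` H"
    proof
      fix f assume "f \<in> {f \<in> Z. v \<in> f}"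
      then obtain w where w: "w \<in> H" "f \<in> N w" "v \<in> f" by (auto simp: Z_def)
      show "f \<in> (if v \<in> H then N v else {}) \<union> (\<lambda>w. {w, v}) ` H"
      proof (cases "v = w")
        case False
        have "w \<in> f" "card f = 2" using N[OF w(1)] w(2) G by (auto simp: pairs_def)
        then have "f = {w, v}" using w(3) False by (auto simp: card_2_iff)
        then show ?thesis using w by auto
      qed (use w in simp)
    qed
    have "card {f \<in> Z. v \<in> f} \<le> card ((if v \<in> H then N v else {}) \<union> (\<lambda>w. {w, v}) ` H)"
      by (rule card_mono[OF _ sub]) (use finN H(3) in auto)
    also have "\<dots> \<le> d + h"
    proof (rule order_trans[OF card_Un_le add_mono])
      show "card ((\<lambda>w. {w, v}) ` H) \<le> h" using card_image_le[OF H(3)] H(2) by metis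
    qed (use N in auto)
    finally show ?thesis .
  qed
  have "real h * real d * \<rho>\<^sup>2 / 4 \<le> real (card Z) * \<rho>\<^sup>2 / 2"
  proof -
    have "real h * real d \<le> 2 * real (card Z)" using Zge by (metis of_nat_le_iff of_nat_mult of_nat_numeral)
    then have "real h * real d * \<rho>\<^sup>2 \<le> 2 * real (card Z) * \<rho>\<^sup>2" by (rule mult_right_mono) simp
    then show ?thesis by linarith
  qed
  also have "\<dots> \<le> touch {1..n} \<rho> G"
  proof (rule touch_lower[OF _ ZG finZ _ deg \<rho>(1) _ _ \<rho>(2)])
    show "f \<subseteq> {1..n} \<and> card f = 2" if "f \<in> Z" for f using that ZG G by (auto simp: pairs_def)
    show "real (d + h) * \<rho> \<le> 1 / 8" using d h by (simp add: algebra_simps)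
    have "real (card Z) * \<rho>\<^sup>2 \<le> real (h * d) * \<rho>\<^sup>2"
      using Zle by (intro mult_right_mono of_nat_mono) auto
    also have "\<dots> = (real h * \<rho>) * (real d * \<rho>)" by (simp add: power2_eq_square)
    also have "\<dots> \<le> 1 / 16 * (1 / 16)" using d h \<rho> by (intro mult_mono) auto
    finally show "real (card Z) * \<rho>\<^sup>2 \<le> 1 / 2" by simp
  qed simp
  finally show False using touch by simp
qed

lemma touch_matching:
  assumes G: "G \<subseteq> pairs n" "disjoint Z" "Z \<subseteq> G" and \<rho>: "0 \<le> \<rho>" "\<rho> \<le> 1 / 8" "real (card Z) * \<rho>\<^sup>2 \<le> 1 / 2"
  shows "real (card Z) * \<rho>\<^sup>2 / 2 \<le> touch {1..n} \<rho> G"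
proof (rule touch_lower[where D = 1])
  show finZ: "finite Z" using G finite_subset finite_pairs by metis
  show "card {f \<in> Z. v \<in> f} \<le> 1" for v
  proof -
    have "finite {f \<in> Z. v \<in> f}" using finZ by simp
    moreover have "f = g" if "f \<in> {f \<in> Z. v \<in> f}" "g \<in> {f \<in> Z. v \<in> f}" for f g
      using that disjointD[OF G(2), of f g] by auto
    ultimately show ?thesis unfolding One_nat_def by (subst card_le_Suc0_iff_eq) blast+
  qed
qed (use assms in \<open>auto simp: pairs_def\<close>)

section \<open>Hashing into cells: pairs that are no edges\<close>

text \<open>Draws the cells of \<open>u\<close> and \<open>r\<close> last. With everything else
  fixed, the probability becomes a count over pairs of cells.\<close>

lemma Pi_pmf_peel2:
  assumes V: "finite V" "u \<in> V" "r \<in> V" "u \<noteq> r"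
  shows "Pi_pmf V d q = bind_pmf (Pi_pmf (V - {u, r}) d q)
    (\<lambda>f. map_pmf (\<lambda>(i, j). f(u := i, r := j)) (pair_pmf (q u) (q r)))"
proof -
  let ?W = "V - {u, r}"
  have V': "V = insert r (insert u ?W)" using V by auto
  have "Pi_pmf V d q = bind_pmf (q r) (\<lambda>j. bind_pmf (q u) (\<lambda>i. bind_pmf (Pi_pmf ?W d q)
      (\<lambda>f. return_pmf (f(u := i, r := j)))))"
    by (subst V', subst Pi_pmf_insert', use V in simp, use V in simp,
        subst Pi_pmf_insert', use V in simp, use V in simp) (simp add: bind_assoc_pmf bind_return_pmf)
  also have "\<dots> = bind_pmf (q u) (\<lambda>i. bind_pmf (q r) (\<lambda>j. bind_pmf (Pi_pmf ?W d q)
      (\<lambda>f. return_pmf (f(u := i, r := j)))))"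
    by (rule bind_commute_pmf)
  also have "\<dots> = bind_pmf (q u) (\<lambda>i. bind_pmf (Pi_pmf ?W d q) (\<lambda>f. bind_pmf (q r) (\<lambda>j.
      return_pmf (f(u := i, r := j)))))"
    by (subst bind_commute_pmf) (rule refl)
  also have "\<dots> = bind_pmf (Pi_pmf ?W d q) (\<lambda>f. bind_pmf (q u) (\<lambda>i. bind_pmf (q r) (\<lambda>j.
      return_pmf (f(u := i, r := j)))))"
    by (rule bind_commute_pmf)
  finally show ?thesis
    by (simp add: pair_pmf_def map_pmf_def bind_assoc_pmf bind_return_pmf)
qed

lemma pr_pair_pmf_of_set:
  assumes "finite A" "A \<noteq> {}" "finite B" "B \<noteq> {}"
  shows "pr (pair_pmf (pmf_of_set A) (pmf_of_set B)) P = real (card {w \<in> A \<times> B. P w}) / (real (card A) * real (card B))"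
proof -
  have "pair_pmf (pmf_of_set A) (pmf_of_set B) = pmf_of_set (A \<times> B)"
  proof (rule pmf_eqI)
    fix w :: "'a \<times> 'b"
    obtain a b where w: "w = (a, b)" by force
    show "pmf (pair_pmf (pmf_of_set A) (pmf_of_set B)) w = pmf (pmf_of_set (A \<times> B)) w"
      unfolding w pmf_pair using assms by (simp add: pmf_of_set indicator_def card_cartesian_product)
  qed
  moreover have "A \<times> B \<inter> {w. P w} = {w \<in> A \<times> B. P w}" by blast
  ultimately show ?thesis
    using assms measure_pmf_of_set[of "A \<times> B" "{w. P w}"] by (simp add: card_cartesian_product)
qed

text \<open>If some \<open>j\<close> qualifies, then at most \<open>b\<close> other positions are
  marked at all, so no more than \<open>b + 1\<close> can qualify.\<close>

lemma card_leave_one_out: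
  assumes "finite X" "0 \<le> b"
  shows "real (card {j \<in> X. z j \<and> real (card {j' \<in> X. j' \<noteq> j \<and> z j'}) \<le> b}) \<le> b + 1" (is "real (card ?S) \<le> _")
proof (cases "?S = {}")
  case False
  then obtain j where j: "j \<in> ?S" by blast
  have "card ?S \<le> card (insert j {j' \<in> X. j' \<noteq> j \<and> z j'})"
    by (rule card_mono) (use assms in auto)
  also have "\<dots> = Suc (card {j' \<in> X. j' \<noteq> j \<and> z j'})" using assms by simp
  finally show ?thesis using j by simp
next
  case True
  show ?thesis unfolding True using assms by simp
qed

text \<open>The two-dimensional version: one qualifying position bounds the marked ones outside its
  row and column by \<open>b\<close>, and the cross itself is counted in full.\<close>

lemma card_leave_cross_out:
  assumes "finite X" "finite Y" "0 \<le> b"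
  shows "real (card {w \<in> X \<times> Y. z w \<and>
    real (card {w' \<in> X \<times> Y. fst w' \<noteq> fst w \<and> snd w' \<noteq> snd w \<and> z w'}) \<le> b}) \<le> b + real (card X) + real (card Y)"
  (is "real (card ?S) \<le> _")
proof (cases "?S = {}")
  case False
  then obtain i j where ij: "(i, j) \<in> ?S" by auto
  let ?Z = "{w' \<in> X \<times> Y. fst w' \<noteq> i \<and> snd w' \<noteq> j \<and> z w'}"
  have "card ?S \<le> card (?Z \<union> (X \<times> {j} \<union> {i} \<times> Y))"
    by (rule card_mono) (use assms in auto)
  also have "\<dots> \<le> card ?Z + (card (X \<times> {j}) + card ({i} \<times> Y))"
    by (intro order_trans[OF card_Un_le] add_mono card_Un_le order_refl)
  finally show ?thesis using ij by (simp add: card_cartesian_product)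
next
  case True
  show ?thesis unfolding True using assms by simp
qed

lemma card_rows:
  assumes "finite X" "finite Y" "\<And>i. i \<in> X \<Longrightarrow> real (card {j \<in> Y. P i j}) \<le> b"
  shows "real (card {w \<in> X \<times> Y. P (fst w) (snd w)}) \<le> real (card X) * b"
proof -
  have "{w \<in> X \<times> Y. P (fst w) (snd w)} = Sigma X (\<lambda>i. {j \<in> Y. P i j})" by auto
  then have "real (card {w \<in> X \<times> Y. P (fst w) (snd w)}) = (\<Sum>i\<in>X. real (card {j \<in> Y. P i j}))"
    using assms by simp
  also have "\<dots> \<le> real (card X) * b" by (rule sum_bounded_above) (rule assms(3))
  finally show ?thesis .
qed

lemma card_cols:
  assumes "finite X" "finite Y" "\<And>j. j \<in> Y \<Longrightarrow> real (card {i \<in> X. P i j}) \<le> b"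
  shows "real (card {w \<in> X \<times> Y. P (fst w) (snd w)}) \<le> real (card Y) * b"
proof -
  have "{w \<in> X \<times> Y. P (fst w) (snd w)} = prod.swap ` {w \<in> Y \<times> X. P (snd w) (fst w)}" by auto
  then have "card {w \<in> X \<times> Y. P (fst w) (snd w)} = card {w \<in> Y \<times> X. P (snd w) (fst w)}"
    by (simp add: card_image inj_on_def)
  also have "real \<dots> \<le> real (card Y) * b"
    by (rule card_rows[OF assms(2,1), where P = "\<lambda>j i. P i j"]) (rule assms(3))
  finally show ?thesis .
qed

text \<open>Comparing the image of \<open>e\<close> with a doubleton treats unordered pairs without
  naming their ends.\<close>

definition cell_row :: "('a \<Rightarrow> nat \<Rightarrow> nat) \<Rightarrow> 'a \<times> nat \<times> nat \<Rightarrow> nat set \<Rightarrow> int" where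
  "cell_row \<omega> i e = of_bool (\<omega> (fst i) ` e = {fst (snd i), snd (snd i)})"

definition cell_sum :: "nat \<Rightarrow> nat \<Rightarrow> (nat \<Rightarrow> nat) \<Rightarrow> (nat set \<Rightarrow> int) \<Rightarrow> nat \<Rightarrow> nat \<Rightarrow> int" where
  "cell_sum n p c x i j = (\<Sum>e\<in>pairs n. of_bool (c ` e = {i, j}) * x e) mod int p"

text \<open>Cells below \<open>J\<close> hold the sampled right vertices, cells from \<open>J\<close> on the left vertices.
  The three counts in \<open>good_cell\<close> bound how easily a pair that is no edge is accepted.\<close>

definition good_cell :: "nat \<Rightarrow> nat \<Rightarrow> real \<Rightarrow> nat set \<Rightarrow> (nat \<Rightarrow> nat \<Rightarrow> int) \<Rightarrow> nat \<Rightarrow> nat \<Rightarrow> bool" where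
  "good_cell J M lam D Y i j \<longleftrightarrow> i \<in> {J..<M} - D \<and> j \<in> {..<J} - D \<and> Y i j \<noteq> 0 \<and>
     real (card {j' \<in> {..<J} - D. Y i j' \<noteq> 0}) \<le> real J / lam \<and>
     real (card {i' \<in> {J..<M} - D. Y i' j \<noteq> 0}) \<le> real (M - J) / lam \<and>
     real (card {w \<in> ({J..<M} - D) \<times> ({..<J} - D). Y (fst w) (snd w) \<noteq> 0}) \<le> real (M - J) * real J / lam"

definition side_cells :: "nat \<Rightarrow> nat \<Rightarrow> bool \<Rightarrow> nat set" where
  "side_cells J M s = (if s then {..<J} else {J..<M})"

text \<open>Sorts the edges by which of \<open>u\<close> and \<open>r\<close> they contain. The
  point is that \<open>S0\<close>, \<open>Su\<close> and \<open>Sr\<close> do not depend on the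
  cells \<open>i\<close> and \<open>j\<close> of \<open>u\<close> and \<open>r\<close>; the pair
  itself contributes a multiple of \<open>p\<close>.\<close>

lemma cell_sum_split:
  fixes x :: "nat set \<Rightarrow> int" and f :: "nat \<Rightarrow> nat" and n :: nat
  assumes u: "u \<noteq> r" "J \<le> i" "J \<le> i'" "j < J" "j' < J" and x: "int p dvd x {u, r}"
  defines "S0 \<equiv> \<lambda>i' j'. \<Sum>e\<in>pairs n. of_bool (u \<notin> e \<and> r \<notin> e \<and> f ` e = {i', j'}) * x e"
    and "Su \<equiv> \<lambda>j'. \<Sum>e\<in>pairs n. of_bool (u \<in> e \<and> r \<notin> e \<and> f ` (e - {u}) = {j'}) * x e"
    and "Sr \<equiv> \<lambda>i'. \<Sum>e\<in>pairs n. of_bool (u \<notin> e \<and> r \<in> e \<and> f ` (e - {r}) = {i'}) * x e"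
  shows "cell_sum n p (f(u := i, r := j)) x i' j' \<noteq> 0 \<longleftrightarrow>
    \<not> int p dvd S0 i' j' + (if i' = i then Su j' else 0) + (if j' = j then Sr i' else 0)"
proof -
  let ?c = "f(u := i, r := j)"
  have pw: "of_bool (?c ` e = {i', j'}) * x e =
      of_bool (u \<notin> e \<and> r \<notin> e \<and> f ` e = {i', j'}) * x e
      + of_bool (i' = i) * (of_bool (u \<in> e \<and> r \<notin> e \<and> f ` (e - {u}) = {j'}) * x e)
      + of_bool (j' = j) * (of_bool (u \<notin> e \<and> r \<in> e \<and> f ` (e - {r}) = {i'}) * x e)
      + of_bool (i' = i \<and> j' = j) * (if e = {u, r} then x {u, r} else 0)"
    if e: "e \<in> pairs n" for e
  proof -
    have c2: "card e = 2" using e by (simp add: pairs_def)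
    consider (none) "u \<notin> e" "r \<notin> e" | (u) "u \<in> e" "r \<notin> e" | (r) "u \<notin> e" "r \<in> e" | (both) "u \<in> e" "r \<in> e" by blast
    then show ?thesis
    proof cases
      case none
      then have "?c ` e = f ` e" by (auto intro!: image_cong)
      then show ?thesis using none by auto
    next
      case u
      then obtain v where v: "e = {u, v}" "v \<noteq> u" "v \<noteq> r" using c2 by (auto simp: card_2_iff)
      then have "?c ` e = {i, f v}" "e - {u} = {v}" using assms(1) by auto
      moreover have "{i, f v} = {i', j'} \<longleftrightarrow> i = i' \<and> f v = j'" using assms(2-5) by (auto simp: doubleton_eq_iff)
      ultimately show ?thesis using u v by auto
    next
      case r
      then obtain v where v: "e = {r, v}" "v \<noteq> u" "v \<noteq> r" using c2 by (auto simp: card_2_iff)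
      then have "?c ` e = {j, f v}" "e - {r} = {v}" using assms(1) by auto
      moreover have "{j, f v} = {i', j'} \<longleftrightarrow> j = j' \<and> f v = i'" using assms(2-5) by (auto simp: doubleton_eq_iff)
      ultimately show ?thesis using r v by auto
    next
      case both
      then have e: "e = {u, r}" using c2 assms(1) by (auto simp: card_2_iff)
      then have "?c ` e = {i, j}" using assms(1) by auto
      moreover have "{i, j} = {i', j'} \<longleftrightarrow> i' = i \<and> j' = j" using assms(2-5) by (auto simp: doubleton_eq_iff)
      ultimately show ?thesis using both e by auto
    qed
  qed
  have "(\<Sum>e\<in>pairs n. of_bool (?c ` e = {i', j'}) * x e) =
      S0 i' j' + of_bool (i' = i) * Su j' + of_bool (j' = j) * Sr i'
      + of_bool (i' = i \<and> j' = j) * (\<Sum>e\<in>pairs n. if e = {u, r} then x {u, r} else 0)"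
    unfolding S0_def Su_def Sr_def sum_distrib_left sum.distrib[symmetric] by (intro sum.cong refl pw)
  moreover have "int p dvd of_bool (i' = i \<and> j' = j) * (\<Sum>e\<in>pairs n. if e = {u, r} then x {u, r} else 0)"
    using x by simp
  ultimately show ?thesis
    unfolding cell_sum_def dvd_eq_mod_eq_0[symmetric] by (auto simp: dvd_add_left_iff)
qed

text \<open>Fix the cells of all vertices but \<open>u\<close> and \<open>r\<close>. A nonzero sum in the cell pair of \<open>u\<close> and \<open>r\<close>
  needs a nonzero sum there without \<open>u\<close>, without \<open>r\<close>, or without both. As \<open>u\<close> and \<open>r\<close> do not
  influence the rest of their column and row, the counts in \<open>good_cell\<close> leave few such cell pairs.\<close>

lemma nonedge_good_cell:
  assumes V: "u \<in> {1..n}" "r \<in> {1..n}" "u \<noteq> r" and T: "u \<notin> T" "r \<notin> T" and sd: "\<not> sd u" "sd r"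
    and x: "int p dvd x {u, r}" and J: "0 < J" "J < M" and lam: "0 < lam"
  shows "pr (Pi_pmf {1..n} M (\<lambda>v. pmf_of_set (side_cells J M (sd v))))
      (\<lambda>c. good_cell J M lam (c ` T) (cell_sum n p c x) (c u) (c r))
    \<le> 3 / lam + 2 / real J + 2 / real (M - J)"
proof -
  let ?N = "M - J"
  let ?b = "3 / lam + 2 / real J + 2 / real ?N"
  show ?thesis
    unfolding Pi_pmf_peel2[OF finite_atLeastAtMost V]
  proof (rule pr_bind_le, unfold pr_map)
    fix f :: "nat \<Rightarrow> nat"
    define D where "D = f ` T"
    define R where "R = {J..<M} - D"
    define L where "L = {..<J} - D"
    have fin: "finite R" "finite L" by (auto simp: R_def L_def)
    have cR: "card R \<le> ?N" using card_mono[of "{J..<M}" R] by (auto simp: R_def)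
    have cL: "card L \<le> J" using card_mono[of "{..<J}" L] by (auto simp: L_def)
    define S0 where "S0 i' j' = (\<Sum>e\<in>pairs n. of_bool (u \<notin> e \<and> r \<notin> e \<and> f ` e = {i', j'}) * x e)" for i' j'
    define Su where "Su j' = (\<Sum>e\<in>pairs n. of_bool (u \<in> e \<and> r \<notin> e \<and> f ` (e - {u}) = {j'}) * x e)" for j'
    define Sr where "Sr i' = (\<Sum>e\<in>pairs n. of_bool (u \<notin> e \<and> r \<in> e \<and> f ` (e - {r}) = {i'}) * x e)" for i'
    define nz where "nz a = (\<not> int p dvd a)" for a
    define B1 where "B1 = {w \<in> R \<times> L. nz (S0 (fst w) (snd w)) \<and>
      real (card {w' \<in> R \<times> L. fst w' \<noteq> fst w \<and> snd w' \<noteq> snd w \<and> nz (S0 (fst w') (snd w'))}) \<le> real ?N * real J / lam}"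
    define B2 where "B2 = {w \<in> R \<times> L. nz (S0 (fst w) (snd w) + Su (snd w)) \<and>
      real (card {j' \<in> L. j' \<noteq> snd w \<and> nz (S0 (fst w) j' + Su j')}) \<le> real J / lam}"
    define B3 where "B3 = {w \<in> R \<times> L. nz (S0 (fst w) (snd w) + Sr (fst w)) \<and>
      real (card {i' \<in> R. i' \<noteq> fst w \<and> nz (S0 i' (snd w) + Sr i')}) \<le> real ?N / lam}"
    define W where "W = {w \<in> {J..<M} \<times> {..<J}. case w of (i, j) \<Rightarrow>
      good_cell J M lam (f(u := i, r := j) ` T) (cell_sum n p (f(u := i, r := j)) x) i j}"
    have "W \<subseteq> B1 \<union> (B2 \<union> B3)"
    proof
      fix w assume "w \<in> W"
      then obtain i j where w: "w = (i, j)" "i \<in> {J..<M}" "j < J"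
        and good: "good_cell J M lam (f(u := i, r := j) ` T) (cell_sum n p (f(u := i, r := j)) x) i j"
        by (auto simp: W_def)
      let ?c = "f(u := i, r := j)"
      \<comment> \<open>As \<open>u\<close> and \<open>r\<close> are outside \<open>T\<close>, the
        cells of \<open>T\<close> are already fixed by \<open>f\<close>.\<close>
      have D: "?c ` T = D" unfolding D_def using T by (intro image_cong) auto
      have Y: "cell_sum n p ?c x i' j' \<noteq> 0 \<longleftrightarrow>
          nz (S0 i' j' + (if i' = i then Su j' else 0) + (if j' = j then Sr i' else 0))"
        if "i' \<in> R" "j' \<in> L" for i' j'
        unfolding S0_def Su_def Sr_def nz_def
        by (rule cell_sum_split[where x = x, OF V(3) _ _ w(3) _ x]) (use that w in \<open>auto simp: R_def L_def\<close>)
      have Y0: "cell_sum n p ?c x i' j' = 0 \<longleftrightarrow>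
          \<not> nz (S0 i' j' + (if i' = i then Su j' else 0) + (if j' = j then Sr i' else 0))"
        if "i' \<in> R" "j' \<in> L" for i' j' using Y[OF that] by blast
      have ij: "i \<in> R" "j \<in> L" using good unfolding D good_cell_def R_def L_def by blast+
      have row: "real (card {j' \<in> L. cell_sum n p ?c x i j' \<noteq> 0}) \<le> real J / lam"
        and col: "real (card {i' \<in> R. cell_sum n p ?c x i' j \<noteq> 0}) \<le> real ?N / lam"
        and all: "real (card {w \<in> R \<times> L. cell_sum n p ?c x (fst w) (snd w) \<noteq> 0}) \<le> real ?N * real J / lam"
        using good unfolding good_cell_def D R_def L_def by blast+
      have "nz (S0 i j + Su j + Sr i)" using good Y[OF ij] by (simp add: good_cell_def)
      moreover have "S0 i j + Su j + Sr i = (S0 i j + Su j) + (S0 i j + Sr i) - S0 i j" by simp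
      ultimately consider (1) "nz (S0 i j)" | (2) "nz (S0 i j + Su j)" | (3) "nz (S0 i j + Sr i)"
        unfolding nz_def by (metis dvd_add dvd_diff)
      then show "w \<in> B1 \<union> (B2 \<union> B3)"
      proof cases
        case 1
        have "card {w' \<in> R \<times> L. fst w' \<noteq> i \<and> snd w' \<noteq> j \<and> nz (S0 (fst w') (snd w'))}
            \<le> card {w \<in> R \<times> L. cell_sum n p ?c x (fst w) (snd w) \<noteq> 0}"
          by (rule card_mono) (use fin in \<open>auto simp: Y0\<close>)
        then show ?thesis using 1 all ij by (auto simp: B1_def w intro: order_trans[rotated])
      next
        case 2
        have "card {j' \<in> L. j' \<noteq> j \<and> nz (S0 i j' + Su j')} \<le> card {j' \<in> L. cell_sum n p ?c x i j' \<noteq> 0}"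
          by (rule card_mono) (use fin ij in \<open>auto simp: Y0\<close>)
        then show ?thesis using 2 row ij by (auto simp: B2_def w intro: order_trans[rotated])
      next
        case 3
        have "card {i' \<in> R. i' \<noteq> i \<and> nz (S0 i' j + Sr i')} \<le> card {i' \<in> R. cell_sum n p ?c x i' j \<noteq> 0}"
          by (rule card_mono) (use fin ij in \<open>auto simp: Y0\<close>)
        then show ?thesis using 3 col ij by (auto simp: B3_def w intro: order_trans[rotated])
      qed
    qed
    moreover have "finite (B1 \<union> (B2 \<union> B3))" using fin by (auto simp: B1_def B2_def B3_def)
    ultimately have "card W \<le> card (B1 \<union> (B2 \<union> B3))" by (intro card_mono)
    also have "\<dots> \<le> card B1 + (card B2 + card B3)"
      by (intro order_trans[OF card_Un_le] add_mono card_Un_le order_refl)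
    finally have "real (card W) \<le> real (card B1) + (real (card B2) + real (card B3))" by linarith
    also have "\<dots> \<le> (real ?N * real J / lam + real ?N + real J) + (real ?N * (real J / lam + 1) + real J * (real ?N / lam + 1))"
    proof (intro add_mono)
      have "real (card B1) \<le> real ?N * real J / lam + real (card R) + real (card L)"
        unfolding B1_def by (rule card_leave_cross_out[OF fin]) (use lam in simp)
      then show "real (card B1) \<le> real ?N * real J / lam + real ?N + real J" using cR cL by linarith
      have "real (card B2) \<le> real (card R) * (real J / lam + 1)"
        unfolding B2_def by (rule card_rows[OF fin], rule card_leave_one_out[OF fin(2)]) (use lam in simp)
      also have "\<dots> \<le> real ?N * (real J / lam + 1)" using cR lam by (intro mult_right_mono) auto
      finally show "real (card B2) \<le> real ?N * (real J / lam + 1)" .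
      have "real (card B3) \<le> real (card L) * (real ?N / lam + 1)"
        unfolding B3_def by (rule card_cols[OF fin], rule card_leave_one_out[OF fin(1)]) (use lam in simp)
      also have "\<dots> \<le> real J * (real ?N / lam + 1)" using cL lam by (intro mult_right_mono) auto
      finally show "real (card B3) \<le> real J * (real ?N / lam + 1)" .
    qed
    also have "\<dots> = ?b * (real ?N * real J)"
      using J lam by (simp add: field_simps)
    finally have W: "real (card W) \<le> ?b * (real ?N * real J)" .
    have "pr (pair_pmf (pmf_of_set (side_cells J M (sd u))) (pmf_of_set (side_cells J M (sd r))))
        (\<lambda>w. good_cell J M lam ((case w of (i, j) \<Rightarrow> f(u := i, r := j)) ` T)
          (cell_sum n p (case w of (i, j) \<Rightarrow> f(u := i, r := j)) x)
          ((case w of (i, j) \<Rightarrow> f(u := i, r := j)) u) ((case w of (i, j) \<Rightarrow> f(u := i, r := j)) r)) =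
      real (card W) / (real ?N * real J)"
      unfolding W_def using sd J V(3) by (subst pr_pair_pmf_of_set) (auto simp: side_cells_def case_prod_unfold)
    also have "\<dots> \<le> ?b" using W J by (simp add: divide_le_eq)
    finally show "pr (pair_pmf (pmf_of_set (side_cells J M (sd u))) (pmf_of_set (side_cells J M (sd r))))
        (\<lambda>w. good_cell J M lam ((case w of (i, j) \<Rightarrow> f(u := i, r := j)) ` T)
          (cell_sum n p (case w of (i, j) \<Rightarrow> f(u := i, r := j)) x)
          ((case w of (i, j) \<Rightarrow> f(u := i, r := j)) u) ((case w of (i, j) \<Rightarrow> f(u := i, r := j)) r)) \<le> ?b" .
  qed
qed

text \<open>The sides \<open>sd\<close> are drawn once for all \<open>C\<close> hashings. Given the
  sides, the hashings are independent.\<close>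

definition hashes :: "nat \<Rightarrow> nat \<Rightarrow> nat \<Rightarrow> nat \<Rightarrow> (nat \<Rightarrow> nat \<Rightarrow> nat) pmf" where
  "hashes n C A J = bind_pmf (Pi_pmf {1..n} False (\<lambda>_. bernoulli_pmf (1 / real A))) (\<lambda>sd.
     Pi_pmf {..<C} (\<lambda>_. A * J) (\<lambda>_. Pi_pmf {1..n} (A * J) (\<lambda>v. pmf_of_set (side_cells J (A * J) (sd v)))))"

text \<open>Since \<open>good_cell\<close> demands a left and a right cell, the quantified ends
  \<open>u\<close> and \<open>r\<close> are determined by the sides. The sums are read through
  \<open>meas\<close>, so that this is computable from the sketch.\<close>

definition accepted :: "nat \<Rightarrow> nat \<Rightarrow> nat \<Rightarrow> nat \<Rightarrow> nat \<Rightarrow> real \<Rightarrow> nat set \<Rightarrow> (nat \<Rightarrow> nat \<Rightarrow> nat) \<Rightarrow>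
    (nat set \<Rightarrow> int) \<Rightarrow> nat set set" where
  "accepted n p C J M lam T \<omega> x = {e \<in> pairs n. e \<inter> T = {} \<and> (\<forall>a\<in>{..<C}. \<exists>u r. e = {u, r} \<and>
     good_cell J M lam (\<omega> a ` T) (\<lambda>i j. meas n p (cell_row \<omega>) x (a, i, j)) (\<omega> a u) (\<omega> a r))}"

lemma meas_cell_row: "meas n p (cell_row \<omega>) x (a, i, j) = cell_sum n p (\<omega> a) x i j"
  by (simp add: meas_def cell_row_def cell_sum_def)

text \<open>Only sums between a left and a right cell are consulted. So \<open>(M - J) * J\<close>
  sums per hashing have to be stored, not a quadratic number in \<open>M\<close>.\<close>

lemma good_cell_cong:
  assumes "\<And>i j. i \<in> {J..<M} \<Longrightarrow> j < J \<Longrightarrow> Y i j = Y' i j"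
  shows "good_cell J M lam D Y i j = good_cell J M lam D Y' i j"
proof (cases "i \<in> {J..<M} \<and> j < J")
  case True
  have 1: "{j' \<in> {..<J} - D. Y i j' \<noteq> 0} = {j' \<in> {..<J} - D. Y' i j' \<noteq> 0}" using assms True by auto
  have 2: "{i' \<in> {J..<M} - D. Y i' j \<noteq> 0} = {i' \<in> {J..<M} - D. Y' i' j \<noteq> 0}" using assms True by auto
  have 3: "{w \<in> ({J..<M} - D) \<times> ({..<J} - D). Y (fst w) (snd w) \<noteq> 0} =
      {w \<in> ({J..<M} - D) \<times> ({..<J} - D). Y' (fst w) (snd w) \<noteq> 0}" using assms by auto
  show ?thesis unfolding good_cell_def 1 2 3 using assms True by auto
qed (auto simp: good_cell_def)

lemma accepted_cong:
  assumes "\<And>a i j. a < C \<Longrightarrow> i \<in> {J..<M} \<Longrightarrow> j < J \<Longrightarrow>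
    meas n p (cell_row \<omega>) x (a, i, j) = meas n p (cell_row \<omega>) y (a, i, j)"
  shows "accepted n p C J M lam T \<omega> x = accepted n p C J M lam T \<omega> y"
proof -
  have "good_cell J M lam (\<omega> a ` T) (\<lambda>i j. meas n p (cell_row \<omega>) x (a, i, j)) i j =
      good_cell J M lam (\<omega> a ` T) (\<lambda>i j. meas n p (cell_row \<omega>) y (a, i, j)) i j" if "a < C" for a i j
    by (rule good_cell_cong) (use that assms in auto)
  then show ?thesis unfolding accepted_def by (metis (no_types, lifting) lessThan_iff)
qed

lemma side_cells_support:
  fixes n :: nat
  assumes "0 < J" "J < M" and "c \<in> set_pmf (Pi_pmf {1..n} d (\<lambda>v. pmf_of_set (side_cells J M (sd v))))"
    and "v \<in> {1..n}"
  shows "c v \<in> side_cells J M (sd v)"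
proof -
  have "c v \<in> set_pmf (pmf_of_set (side_cells J M (sd v)))"
    using assms(3,4) by (auto simp: set_Pi_pmf PiE_dflt_def)
  moreover have "finite (side_cells J M (sd v))" "side_cells J M (sd v) \<noteq> {}"
    using assms(1,2) by (auto simp: side_cells_def)
  ultimately show ?thesis by simp
qed

text \<open>Given the sides, a pair that is no edge has to be accepted by \<open>C\<close>
  independent hashings, which raises the bound of \<open>nonedge_good_cell\<close> to the power
  \<open>C\<close>. The remaining factor counts the pairs. A pair that does not cross is never
  accepted.\<close>

lemma accepted_sound:
  assumes AJ: "2 \<le> A" "0 < J" and lam: "0 < lam"
  shows "pr (hashes n C A J) (\<lambda>\<omega>. \<exists>e\<in>accepted n p C J (A * J) lam T \<omega> x. int p dvd x e)
    \<le> real (n choose 2) * (3 / lam + 2 / real J + 2 / real (A * J - J)) ^ C"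
proof -
  let ?M = "A * J" and ?b = "3 / lam + 2 / real J + 2 / real (A * J - J)"
  have M: "J < ?M" using AJ by simp
  define P where "P e c = (e \<inter> T = {} \<and> (\<exists>u r. e = {u, r} \<and> good_cell J ?M lam (c ` T) (cell_sum n p c x) (c u) (c r)))" for e c
  have P: "pr (Pi_pmf {1..n} ?M (\<lambda>v. pmf_of_set (side_cells J ?M (sd v)))) (P e) \<le> ?b"
    if e: "e \<in> pairs n" "int p dvd x e" for e sd
  proof (cases "e \<inter> T = {} \<and> (\<exists>u r. e = {u, r} \<and> \<not> sd u \<and> sd r)")
    case True
    then obtain u r where ur: "e = {u, r}" "\<not> sd u" "sd r" "u \<notin> T" "r \<notin> T" by auto
    have V: "u \<in> {1..n}" "r \<in> {1..n}" "u \<noteq> r" using ur e by (auto simp: pairs_def)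
    have "pr (Pi_pmf {1..n} ?M (\<lambda>v. pmf_of_set (side_cells J ?M (sd v)))) (P e) \<le>
        pr (Pi_pmf {1..n} ?M (\<lambda>v. pmf_of_set (side_cells J ?M (sd v))))
        (\<lambda>c. good_cell J ?M lam (c ` T) (cell_sum n p c x) (c u) (c r))"
    proof (rule pr_mono)
      fix c assume c: "c \<in> set_pmf (Pi_pmf {1..n} ?M (\<lambda>v. pmf_of_set (side_cells J ?M (sd v))))" and "P e c"
      then obtain u' r' where ur': "e = {u', r'}" "good_cell J ?M lam (c ` T) (cell_sum n p c x) (c u') (c r')"
        by (auto simp: P_def)
      have "c v \<in> side_cells J ?M (sd v)" if "v \<in> {1..n}" for v
        by (rule side_cells_support[OF _ M c that]) (use AJ in simp)
      from this[OF V(1)] this[OF V(2)] have "c u \<ge> J" "c r < J" using ur by (auto simp: side_cells_def)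
      moreover have "c u' \<ge> J" "c r' < J" using ur'(2) by (auto simp: good_cell_def)
      \<comment> \<open>The orientation chosen in \<open>accepted\<close> is the one given by the
        sides.\<close>
      ultimately have "u' = u" "r' = r" using ur(1) ur'(1) by (auto simp: doubleton_eq_iff)
      then show "good_cell J ?M lam (c ` T) (cell_sum n p c x) (c u) (c r)" using ur'(2) by simp
    qed
    also have "\<dots> \<le> ?b"
      by (rule nonedge_good_cell) (use ur V e M AJ lam in auto)
    finally show ?thesis .
  next
    case False
    have "pr (Pi_pmf {1..n} ?M (\<lambda>v. pmf_of_set (side_cells J ?M (sd v)))) (P e) \<le>
        pr (Pi_pmf {1..n} ?M (\<lambda>v. pmf_of_set (side_cells J ?M (sd v)))) (\<lambda>_. False)"
    proof (rule pr_mono)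
      fix c assume c: "c \<in> set_pmf (Pi_pmf {1..n} ?M (\<lambda>v. pmf_of_set (side_cells J ?M (sd v))))" and "P e c"
      then obtain u r where ur: "e \<inter> T = {}" "e = {u, r}" "good_cell J ?M lam (c ` T) (cell_sum n p c x) (c u) (c r)"
        by (auto simp: P_def)
      have "c v \<in> side_cells J ?M (sd v)" if "v \<in> {1..n}" for v
        by (rule side_cells_support[OF _ M c that]) (use AJ in simp)
      moreover have "u \<in> {1..n}" "r \<in> {1..n}" using e ur(2) by (auto simp: pairs_def)
      ultimately have "c u \<in> side_cells J ?M (sd u)" "c r \<in> side_cells J ?M (sd r)" by blast+
      moreover have "c u \<ge> J" "c r < J" using ur(3) by (auto simp: good_cell_def)
      ultimately have "\<not> sd u" "sd r" by (auto simp: side_cells_def split: if_splits)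
      then show False using False ur by blast
    qed
    also have "\<dots> = 0" by simp
    finally show ?thesis using lam by (auto intro: order_trans)
  qed
  have "pr (hashes n C A J) (\<lambda>\<omega>. \<exists>e\<in>accepted n p C J ?M lam T \<omega> x. int p dvd x e) \<le>
      pr (hashes n C A J) (\<lambda>\<omega>. \<exists>e\<in>{e \<in> pairs n. int p dvd x e}. \<forall>a\<in>{..<C}. P e (\<omega> a))"
    by (rule pr_mono) (auto simp: accepted_def P_def meas_cell_row)
  also have "\<dots> \<le> real (card {e \<in> pairs n. int p dvd x e}) * ?b ^ C"
  proof (rule pr_ex_bound)
    fix e assume e: "e \<in> {e \<in> pairs n. int p dvd x e}"
    show "pr (hashes n C A J) (\<lambda>\<omega>. \<forall>a\<in>{..<C}. P e (\<omega> a)) \<le> ?b ^ C"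
      unfolding hashes_def
    proof (rule pr_bind_le)
      fix sd
      have "(\<Prod>a\<in>{..<C}. pr (Pi_pmf {1..n} ?M (\<lambda>v. pmf_of_set (side_cells J ?M (sd v)))) (P e)) \<le> (\<Prod>a\<in>{..<C}. ?b)"
        by (intro prod_mono conjI P) (use e in auto)
      then show "pr (Pi_pmf {..<C} (\<lambda>_. ?M) (\<lambda>_. Pi_pmf {1..n} ?M (\<lambda>v. pmf_of_set (side_cells J ?M (sd v)))))
        (\<lambda>\<omega>. \<forall>a\<in>{..<C}. P e (\<omega> a)) \<le> ?b ^ C"
        by (subst pr_Pi_all) auto
    qed
  qed simp
  also have "\<dots> \<le> real (n choose 2) * ?b ^ C"
  proof (rule mult_right_mono)
    show "real (card {e \<in> pairs n. int p dvd x e}) \<le> real (n choose 2)"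
      unfolding card_pairs[symmetric] by (intro of_nat_mono card_mono) auto
  qed (use lam in auto)
  finally show ?thesis .
qed

section \<open>Hashing into cells: edges of a matching\<close>

text \<open>A vertex is on the right with probability \<open>1 / A\<close>, and \<open>J\<close> of
  the \<open>A * J\<close> cells are right ones, so every cell gets the same probability. This is
  why the total number of cells is a multiple of \<open>J\<close>: one hashing alone is a uniform
  map, whose sides can be read off the cells.\<close>

lemma bind_side_cells:
  assumes "2 \<le> A" "0 < J"
  shows "bind_pmf (bernoulli_pmf (1 / real A)) (\<lambda>s. pmf_of_set (side_cells J (A * J) s)) = pmf_of_set {0..<A * J}"
proof (rule pmf_eqI)
  fix x
  have JM: "J < A * J" using assms by simp
  have 1: "pmf (pmf_of_set (side_cells J (A * J) True)) x = (if x < J then 1 / real J else 0)"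
    using assms by (subst pmf_of_set) (auto simp: side_cells_def indicator_def)
  have 2: "pmf (pmf_of_set (side_cells J (A * J) False)) x = (if J \<le> x \<and> x < A * J then 1 / real (A * J - J) else 0)"
    using JM by (subst pmf_of_set) (auto simp: side_cells_def indicator_def)
  have 3: "pmf (pmf_of_set {0..<A * J}) x = (if x < A * J then 1 / real (A * J) else 0)"
    using JM by (subst pmf_of_set) (auto simp: indicator_def)
  have 4: "real (A * J - J) = (real A - 1) * real J" using JM by (simp add: of_nat_diff algebra_simps)
  have "pmf (bind_pmf (bernoulli_pmf (1 / real A)) (\<lambda>s. pmf_of_set (side_cells J (A * J) s))) x =
      pmf (pmf_of_set (side_cells J (A * J) True)) x * (1 / real A)
      + pmf (pmf_of_set (side_cells J (A * J) False)) x * (1 - 1 / real A)"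
    using assms by (simp add: pmf_bind)
  also have "\<dots> = pmf (pmf_of_set {0..<A * J}) x"
    unfolding 1 2 3 4 using assms less_trans[OF _ JM, of x] by (auto simp: field_simps)
  finally show "pmf (bind_pmf (bernoulli_pmf (1 / real A)) (\<lambda>s. pmf_of_set (side_cells J (A * J) s))) x =
    pmf (pmf_of_set {0..<A * J}) x" .
qed

abbreviation cells :: "nat set \<Rightarrow> nat \<Rightarrow> (nat \<Rightarrow> nat) pmf" where
  "cells W M \<equiv> Pi_pmf W M (\<lambda>_. pmf_of_set {0..<M})"

lemma hashes_component:
  assumes "2 \<le> A" "0 < J" "a < C"
  shows "pr (hashes n C A J) (\<lambda>\<omega>. P (\<omega> a)) = pr (cells {1..n} (A * J)) P"
proof -
  have "map_pmf (\<lambda>\<omega>. \<omega> a) (hashes n C A J) =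
      bind_pmf (Pi_pmf {1..n} False (\<lambda>_. bernoulli_pmf (1 / real A))) (\<lambda>sd.
        Pi_pmf {1..n} (A * J) (\<lambda>v. pmf_of_set (side_cells J (A * J) (sd v))))"
    unfolding hashes_def map_bind_pmf using assms(3)
    by (subst Pi_pmf_component) auto
  also have "\<dots> = Pi_pmf {1..n} (A * J) (\<lambda>v. bind_pmf (bernoulli_pmf (1 / real A))
      (\<lambda>s. pmf_of_set (side_cells J (A * J) s)))"
    by (rule Pi_pmf_bind[symmetric]) simp
  also have "\<dots> = cells {1..n} (A * J)" by (simp add: bind_side_cells[OF assms(1,2)])
  finally show ?thesis using pr_map[of "\<lambda>\<omega>. \<omega> a" "hashes n C A J" P] by simp
qed

text \<open>An edge that crosses in one hashing crosses in all of them, so the loss of a factor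
  \<open>A\<close> is suffered once and not \<open>C\<close> times.\<close>

lemma hashes_sides:
  assumes "2 \<le> A" "0 < J" "\<omega> \<in> set_pmf (hashes n C A J)" "a < C" "b < C" "v \<in> {1..n}"
  shows "\<omega> a v < J \<longleftrightarrow> \<omega> b v < J"
    and "\<omega> a v < A * J"
proof -
  have JM: "J < A * J" using assms by simp
  obtain sd where sd: "\<omega> \<in> set_pmf (Pi_pmf {..<C} (\<lambda>_. A * J)
      (\<lambda>_. Pi_pmf {1..n} (A * J) (\<lambda>v. pmf_of_set (side_cells J (A * J) (sd v)))))"
    using assms(3) unfolding hashes_def by auto
  have *: "\<omega> a' v \<in> side_cells J (A * J) (sd v)" if "a' < C" for a'
  proof -
    have "\<omega> a' \<in> set_pmf (Pi_pmf {1..n} (A * J) (\<lambda>v. pmf_of_set (side_cells J (A * J) (sd v))))"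
      using sd that by (auto simp: set_Pi_pmf[of "{..<C}"] PiE_dflt_def)
    from side_cells_support[OF assms(2) JM this assms(6)] show ?thesis .
  qed
  show "\<omega> a v < J \<longleftrightarrow> \<omega> b v < J" "\<omega> a v < A * J"
    using *[OF assms(4)] *[OF assms(5)] JM less_trans[OF _ JM, of "\<omega> a v"] by (auto simp: side_cells_def split: if_splits)
qed

text \<open>The opposite order: \<open>u\<close> and \<open>r\<close> are exposed first, which
  leaves the other vertices uniform and independent.\<close>

lemma Pi_pmf_peel2':
  assumes "finite V" "u \<in> V" "r \<in> V" "u \<noteq> r"
  shows "Pi_pmf V d q = bind_pmf (pair_pmf (q u) (q r))
    (\<lambda>(i, j). map_pmf (\<lambda>f. f(u := i, r := j)) (Pi_pmf (V - {u, r}) d q))"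
  unfolding Pi_pmf_peel2[OF assms] map_pmf_def case_prod_unfold by (rule bind_commute_pmf)

text \<open>Edges of a matching have disjoint ends, so their cells are independent and all have the
  same chance \<eta>; Chebyshev's inequality applies.\<close>

lemma matching_count_deviation:
  fixes Q :: "'b \<Rightarrow> 'b \<Rightarrow> bool" and q :: "'b pmf" and W :: "'a set"
  assumes W: "finite W" and Ms: "finite Ms" "disjoint Ms" "\<And>e. e \<in> Ms \<Longrightarrow> e \<subseteq> W \<and> card e = 2" and d: "0 < d"
  defines "P \<equiv> \<lambda>e c. \<exists>u r. e = {u, r} \<and> Q (c u) (c r)"
    and "\<eta> \<equiv> pr (pair_pmf q q) (\<lambda>(i, j). Q i j \<or> Q j i)"
  shows "pr (Pi_pmf W z (\<lambda>_. q)) (\<lambda>c. d \<le> \<bar>real (card {e \<in> Ms. P e c}) - real (card Ms) * \<eta>\<bar>)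
    \<le> real (card Ms) * \<eta> / d\<^sup>2"
proof (rule chebyshev_card[OF Ms(1) _ _ d])
  have dep: "P e c = P e c'" if "\<And>v. v \<in> e \<Longrightarrow> c v = c' v" for e c c'
    unfolding P_def using that by (metis insertCI)
  show eta: "pr (Pi_pmf W z (\<lambda>_. q)) (P e) = \<eta>" if e: "e \<in> Ms" for e
  proof -
    obtain u r where ur: "e = {u, r}" "u \<noteq> r" using Ms(3)[OF e] by (auto simp: card_2_iff)
    have V: "u \<in> W" "r \<in> W" using Ms(3)[OF e] ur by auto
    have Pe: "P e c = (Q (c u) (c r) \<or> Q (c r) (c u))" for c
      unfolding P_def ur(1) by (metis doubleton_eq_iff)
    have "pr (Pi_pmf W z (\<lambda>_. q)) (P e) = measure_pmf.expectation (Pi_pmf (W - {u, r}) z (\<lambda>_. q)) (\<lambda>f. \<eta>)"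
      unfolding Pi_pmf_peel2[OF W V ur(2)] pr_bind pr_map \<eta>_def Pe
      using ur(2) by (intro Bochner_Integration.integral_cong refl arg_cong[where f = "measure_pmf.prob _"]) auto
    then show ?thesis by simp
  qed
  show "pr (Pi_pmf W z (\<lambda>_. q)) (\<lambda>c. P e c \<and> P g c) = \<eta> * \<eta>" if "e \<in> Ms" "g \<in> Ms" "e \<noteq> g" for e g
  proof -
    have "pr (Pi_pmf W z (\<lambda>_. q)) (\<lambda>c. P e c \<and> P g c) =
        pr (Pi_pmf W z (\<lambda>_. q)) (P e) * pr (Pi_pmf W z (\<lambda>_. q)) (P g)"
      by (rule pr_Pi_indep[OF W, of e g])
        (use that Ms(3) disjointD[OF Ms(2)] in \<open>auto intro!: dep\<close>)
    then show ?thesis using eta that by simp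
  qed
qed

text \<open>A crossing pair is rejected although it shares no cell with \<open>T\<close> and the third count is fine.\<close>

definition spoiled :: "nat \<Rightarrow> nat \<Rightarrow> nat \<Rightarrow> nat \<Rightarrow> real \<Rightarrow> nat set \<Rightarrow> (nat set \<Rightarrow> int) \<Rightarrow> (nat \<Rightarrow> nat) \<Rightarrow> nat \<Rightarrow> nat \<Rightarrow> bool" where
  "spoiled n p J M lam T x c u r \<longleftrightarrow> c u \<in> {J..<M} \<and> c r < J \<and> c u \<notin> c ` T \<and> c r \<notin> c ` T \<and>
     real (card {w \<in> ({J..<M} - c ` T) \<times> ({..<J} - c ` T). cell_sum n p c x (fst w) (snd w) \<noteq> 0})
       \<le> real (M - J) * real J / lam \<and>
     \<not> good_cell J M lam (c ` T) (cell_sum n p c x) (c u) (c r)"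

text \<open>A pair of cells without vertices of \<open>T\<close> collects only edges avoiding
  \<open>T\<close>. The converse fails, as edges may cancel modulo \<open>p\<close>.\<close>

lemma cell_sum_nonzero:
  assumes "cell_sum n p c x i j \<noteq> 0" "i \<notin> c ` T" "j \<notin> c ` T"
  shows "\<exists>g\<in>avoid {e \<in> pairs n. \<not> int p dvd x e} T. c ` g = {i, j}"
proof (rule ccontr)
  assume no: "\<not> ?thesis"
  have "int p dvd of_bool (c ` e = {i, j}) * x e" if "e \<in> pairs n" for e
  proof (rule ccontr)
    assume "\<not> int p dvd of_bool (c ` e = {i, j}) * x e"
    then have e: "c ` e = {i, j}" "\<not> int p dvd x e" by (auto simp: of_bool_def split: if_splits)
    have "e \<inter> T = {}"
    proof (rule ccontr)
      assume "e \<inter> T \<noteq> {}"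
      then obtain v where "v \<in> e" "v \<in> T" by blast
      then have "c v \<in> {i, j}" "c v \<in> c ` T" using e(1) by blast+
      then show False using assms by auto
    qed
    then show False using no e that by (auto simp: avoid_def)
  qed
  then have "int p dvd (\<Sum>e\<in>pairs n. of_bool (c ` e = {i, j}) * x e)" by (intro dvd_sum) auto
  then show False using assms(1) by (simp add: cell_sum_def dvd_eq_mod_eq_0)
qed

lemma pr_uniform_cell: "a < M \<Longrightarrow> pr (pmf_of_set {0..<M}) (\<lambda>i. i = a) = 1 / real M"
  by (simp add: measure_pmf_single pmf_of_set)

lemma pr_star_hits:
  assumes G: "G \<subseteq> pairs n" and W: "finite W" and deg: "real (degree_in G u) \<le> d" and a: "a < M"
  shows "pr (cells W M) (\<lambda>f. \<exists>v\<in>W. v \<noteq> u \<and> {u, v} \<in> G \<and> f v = a) \<le> d / real M"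
proof -
  define N where "N = {v \<in> W. v \<noteq> u \<and> {u, v} \<in> G}"
  have "pr (cells W M) (\<lambda>f. \<exists>v\<in>W. v \<noteq> u \<and> {u, v} \<in> G \<and> f v = a) = pr (cells W M) (\<lambda>f. \<exists>v\<in>N. f v = a)"
    by (rule pr_cong) (auto simp: N_def)
  also have "\<dots> \<le> real (card N) * (1 / real M)"
  proof (rule pr_ex_bound)
    show "finite N" using W by (simp add: N_def)
    show "pr (cells W M) (\<lambda>f. f v = a) \<le> 1 / real M" if "v \<in> N" for v
      using that W pr_Pi_component[of W v M "\<lambda>_. pmf_of_set {0..<M}" "\<lambda>i. i = a"] pr_uniform_cell[OF a]
      by (simp add: N_def)
  qed
  also have "\<dots> \<le> d / real M"
  proof -
    have finG: "finite G" using G finite_subset finite_pairs by blast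
    have "card N = card ((\<lambda>v. {u, v}) ` N)"
      by (rule card_image[symmetric]) (auto simp: inj_on_def N_def doubleton_eq_iff)
    also have "\<dots> \<le> degree_in G u"
      unfolding degree_in_def using finG by (intro card_mono) (auto simp: N_def)
    finally have "real (card N) \<le> d" using deg by linarith
    then show ?thesis by (simp add: divide_right_mono)
  qed
  finally show ?thesis .
qed

lemma pr_cell_pair_hit:
  assumes "G \<subseteq> pairs n" "i < M" "j < M" "i \<noteq> j" "W \<subseteq> {1..n}"
  shows "pr (cells W M) (\<lambda>f. \<exists>g\<in>G. g \<subseteq> W \<and> f ` g = {i, j}) \<le> touch {1..n} (2 / real M) G"
proof -
  have finW: "finite W" using assms(5) finite_subset by blast
  have "pr (cells W M) (\<lambda>f. \<exists>g\<in>G. g \<subseteq> W \<and> f ` g = {i, j}) \<le>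
      pr (cells W M) (\<lambda>f. \<exists>g\<in>{g \<in> G. g \<subseteq> W}. \<forall>v\<in>g. f v \<in> {i, j})"
    by (rule pr_mono) blast
  also have "\<dots> = touch W (2 / real M) {g \<in> G. g \<subseteq> W}"
    by (rule touch_two_cells[OF finW assms(2-4)])
  also have "\<dots> \<le> touch {1..n} (2 / real M) G"
    by (rule touch_restrict) (use assms in auto)
  finally show ?thesis .
qed

text \<open>Expose the cells of \<open>u\<close> and \<open>r\<close> first. They are a left and a
  right one with probability at most \<open>1 / A\<close>, a factor that must be kept because only
  about such a fraction of a matching crosses at all. Another pair of cells in their row or column
  then gets an edge avoiding both ends with probability at most \<tau>, and an edge at the end it
  shares with probability at most \<open>d / (A * J)\<close>. Markov's inequality bounds the two
  counts.\<close>

lemma spoiled_pr: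
  fixes x :: "nat set \<Rightarrow> int" and p :: nat
  assumes T: "T \<subseteq> {1..n}"
  defines "G \<equiv> avoid {e \<in> pairs n. \<not> int p dvd x e} T"
  assumes e: "{u, r} \<in> G" "u \<noteq> r" and deg: "real (degree_in G u) \<le> d" "real (degree_in G r) \<le> d"
    and touch: "touch {1..n} (2 / real (A * J)) G \<le> \<tau>"
    and AJ: "2 \<le> A" and lam: "1 \<le> lam" "2 * lam \<le> real J" "2 * lam \<le> real (A * J - J)"
  shows "pr (cells {1..n} (A * J)) (\<lambda>c. spoiled n p J (A * J) lam T x c u r)
    \<le> 1 / real A * (6 * lam * (\<tau> + d / real (A * J)))"
proof -
  let ?M = "A * J" and ?V = "{1..n}"
  let ?N = "?M - J" and ?W = "{1..n} - {u, r}"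
  define \<beta> where "\<beta> = \<tau> + d / real ?M"
  have J0: "0 < J" using lam by linarith
  have JM: "J < ?M" using AJ J0 by simp
  have GV: "G \<subseteq> pairs n" by (auto simp: G_def avoid_def)
  have ur: "u \<in> ?V" "r \<in> ?V" using e GV by (auto simp: pairs_def)
  have urT: "u \<notin> T" "r \<notin> T" using e by (auto simp: G_def avoid_def)
  have \<tau>0: "0 \<le> \<tau>" using touch by (auto simp: touch_def intro: order_trans[rotated])
  have d0: "0 \<le> d" using deg by linarith
  have \<beta>0: "0 \<le> \<beta>" using \<tau>0 d0 by (simp add: \<beta>_def)
  have main: "pr (cells ?W ?M) (\<lambda>f. spoiled n p J ?M lam T x (f(u := i, r := j)) u r) \<le> 6 * lam * \<beta>"
    if ij: "i \<in> {J..<?M}" "j < J" for i j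
  proof -
    let ?H = "cells ?W ?M"
    define hit where "hit i' j' f = (\<exists>g\<in>G. g \<subseteq> ?W \<and> f ` g = {i', j'})" for i' j' and f :: "nat \<Rightarrow> nat"
    define su where "su a f = (\<exists>v\<in>?W. v \<noteq> u \<and> {u, v} \<in> G \<and> f v = a)" for a and f :: "nat \<Rightarrow> nat"
    define sr where "sr a f = (\<exists>v\<in>?W. v \<noteq> r \<and> {r, v} \<in> G \<and> f v = a)" for a and f :: "nat \<Rightarrow> nat"
    have hit: "pr ?H (hit i' j') \<le> \<tau>" if "i' < ?M" "j' < ?M" "i' \<noteq> j'" for i' j'
      using pr_cell_pair_hit[OF GV that, of ?W] touch by (simp add: hit_def)
    have su: "pr ?H (su a) \<le> d / real ?M" if "a < ?M" for a
      unfolding su_def by (rule pr_star_hits[OF GV _ deg(1) that]) simp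
    have sr: "pr ?H (sr a) \<le> d / real ?M" if "a < ?M" for a
      unfolding sr_def by (rule pr_star_hits[OF GV _ deg(2) that]) simp
    define rowc where "rowc f = {j' \<in> {..<J} - {j}. hit i j' f \<or> su j' f}" for f
    define colc where "colc f = {i' \<in> {J..<?M} - {i}. hit i' j f \<or> sr i' f}" for f
    \<comment> \<open>The thresholds are lowered by 1 because the cell pair of \<open>u\<close> and
      \<open>r\<close> itself, which the edge between them is expected to fill, is left out of
      \<open>rowc\<close> and \<open>colc\<close>.\<close>
    have imp: "(hit i j f \<or> su j f) \<or> sr i f \<or> real J / lam - 1 \<le> real (card (rowc f)) \<or> real ?N / lam - 1 \<le> real (card (colc f))"
      if sp: "spoiled n p J ?M lam T x (f(u := i, r := j)) u r" for f
    proof -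
      define c where "c = f(u := i, r := j)"
      let ?Y = "cell_sum n p c x"
      have cu: "c u = i" "c r = j" using e(2) by (auto simp: c_def)
      have cf: "c v = f v" if "v \<noteq> u" "v \<noteq> r" for v using that by (simp add: c_def)
      have img: "c ` {u, r} = {i, j}" using cu by simp
      have cl: "i \<notin> c ` T" "j \<notin> c ` T" and ng: "\<not> good_cell J ?M lam (c ` T) ?Y i j"
        and gl: "real (card {w \<in> ({J..<?M} - c ` T) \<times> ({..<J} - c ` T). ?Y (fst w) (snd w) \<noteq> 0}) \<le> real ?N * real J / lam"
        using sp unfolding spoiled_def c_def[symmetric] cu by auto
      have shape: "hit i' j' f \<or> (i' = i \<and> su j' f) \<or> (j' = j \<and> sr i' f)"
        if g: "g \<in> G" "c ` g = {i', j'}" "g \<noteq> {u, r}" "J \<le> i'" "j' < J" for g i' j'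
      proof -
        have g2: "card g = 2" "g \<subseteq> ?V" using g(1) GV by (auto simp: pairs_def)
        consider (none) "u \<notin> g" "r \<notin> g" | (u) "u \<in> g" "r \<notin> g" | (r) "u \<notin> g" "r \<in> g"
          using g(3) g2 e(2) by (auto simp: card_2_iff)
        then show ?thesis
        proof cases
          case none
          then have "c ` g = f ` g" by (intro image_cong) (auto intro!: cf)
          moreover have "g \<subseteq> ?W" using none g2 by blast
          ultimately have "hit i' j' f" unfolding hit_def using g(1,2) by metis
          then show ?thesis by blast
        next
          case u
          then obtain v where v: "g = {u, v}" "v \<noteq> u" "v \<noteq> r" using g2 by (auto simp: card_2_iff)
          then have "{i, f v} = {i', j'}" using g(2) cu cf by auto
          then have "i' = i" "f v = j'" using g(4,5) ij by (auto simp: doubleton_eq_iff)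
          moreover have "v \<in> ?W" "{u, v} \<in> G" using v g(1) g2 by auto
          ultimately have "i' = i \<and> su j' f" unfolding su_def using v(2) by metis
          then show ?thesis by blast
        next
          case r
          then obtain v where v: "g = {r, v}" "v \<noteq> u" "v \<noteq> r" using g2 by (auto simp: card_2_iff)
          then have "{j, f v} = {i', j'}" using g(2) cu cf by auto
          then have "j' = j" "f v = i'" using g(4,5) ij by (auto simp: doubleton_eq_iff)
          moreover have "v \<in> ?W" "{r, v} \<in> G" using v g(1) g2 by auto
          ultimately have "j' = j \<and> sr i' f" unfolding sr_def using v(3) by metis
          then show ?thesis by blast
        qed
      qed
      have cell: "hit i' j' f \<or> (i' = i \<and> su j' f) \<or> (j' = j \<and> sr i' f)"
        if h: "?Y i' j' \<noteq> 0" "i' \<in> {J..<?M} - c ` T" "j' \<in> {..<J} - c ` T" "(i', j') \<noteq> (i, j)" for i' j'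
      proof -
        obtain g where g: "g \<in> G" "c ` g = {i', j'}"
          using cell_sum_nonzero[OF h(1), of T] h(2,3) unfolding G_def by blast
        have "g \<noteq> {u, r}"
        proof
          assume "g = {u, r}"
          then have "{i, j} = {i', j'}" using g(2) img by auto
          then show False using h ij by (auto simp: doubleton_eq_iff)
        qed
        then show ?thesis using shape[OF g] h by auto
      qed
      consider (1) "?Y i j = 0" | (2) "\<not> real (card {j' \<in> {..<J} - c ` T. ?Y i j' \<noteq> 0}) \<le> real J / lam"
        | (3) "\<not> real (card {i' \<in> {J..<?M} - c ` T. ?Y i' j \<noteq> 0}) \<le> real ?N / lam"
        using ng cl ij gl unfolding good_cell_def by blast
      then show ?thesis
      proof cases
        case 1
        \<comment> \<open>The sum vanishes although the edge between \<open>u\<close> and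
          \<open>r\<close> contributes to it, so another edge must share this pair of cells.\<close>
        have "\<exists>g\<in>pairs n. g \<noteq> {u, r} \<and> c ` g = {i, j} \<and> \<not> int p dvd x g"
        proof (rule ccontr)
          assume no: "\<not> ?thesis"
          have "int p dvd (\<Sum>g\<in>pairs n - {{u, r}}. of_bool (c ` g = {i, j}) * x g)"
            by (rule dvd_sum) (use no in auto)
          moreover have "(\<Sum>g\<in>pairs n. of_bool (c ` g = {i, j}) * x g) =
              x {u, r} + (\<Sum>g\<in>pairs n - {{u, r}}. of_bool (c ` g = {i, j}) * x g)"
            using e GV img by (subst sum.remove[of _ "{u, r}"]) auto
          moreover have "int p dvd (\<Sum>g\<in>pairs n. of_bool (c ` g = {i, j}) * x g)"
            using 1 by (simp add: cell_sum_def dvd_eq_mod_eq_0)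
          ultimately have "int p dvd x {u, r}" by (simp add: dvd_add_left_iff)
          then show False using e by (auto simp: G_def avoid_def)
        qed
        then obtain g where g: "g \<in> pairs n" "g \<noteq> {u, r}" "c ` g = {i, j}" "\<not> int p dvd x g" by blast
        have "g \<inter> T = {}"
        proof (rule ccontr)
          assume "g \<inter> T \<noteq> {}"
          then obtain v where "v \<in> g" "v \<in> T" by blast
          then have "c v \<in> {i, j}" "c v \<in> c ` T" using g(3) by blast+
          then show False using cl by auto
        qed
        then have "g \<in> G" using g by (auto simp: G_def avoid_def)
        then show ?thesis using shape[of g i j] g ij by auto
      next
        case 2
        have "card {j' \<in> {..<J} - c ` T. ?Y i j' \<noteq> 0} \<le> card (insert j (rowc f))"
        proof (rule card_mono)
          show "{j' \<in> {..<J} - c ` T. ?Y i j' \<noteq> 0} \<subseteq> insert j (rowc f)"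
          proof
            fix j' assume j': "j' \<in> {j' \<in> {..<J} - c ` T. ?Y i j' \<noteq> 0}"
            show "j' \<in> insert j (rowc f)"
            proof (cases "j' = j")
              case False
              then show ?thesis using cell[of i j'] j' cl ij by (auto simp: rowc_def)
            qed simp
          qed
        qed (simp add: rowc_def)
        also have "\<dots> = Suc (card (rowc f))" by (subst card_insert_disjoint) (auto simp: rowc_def)
        finally show ?thesis using 2 by linarith
      next
        case 3
        have "card {i' \<in> {J..<?M} - c ` T. ?Y i' j \<noteq> 0} \<le> card (insert i (colc f))"
        proof (rule card_mono)
          show "{i' \<in> {J..<?M} - c ` T. ?Y i' j \<noteq> 0} \<subseteq> insert i (colc f)"
          proof
            fix i' assume i': "i' \<in> {i' \<in> {J..<?M} - c ` T. ?Y i' j \<noteq> 0}"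
            show "i' \<in> insert i (colc f)"
            proof (cases "i' = i")
              case False
              then show ?thesis using cell[of i' j] i' cl ij by (auto simp: colc_def)
            qed simp
          qed
        qed (simp add: colc_def)
        also have "\<dots> = Suc (card (colc f))" by (subst card_insert_disjoint) (auto simp: colc_def)
        finally show ?thesis using 3 by linarith
      qed
    qed
    have row: "pr ?H (\<lambda>f. real J / lam - 1 \<le> real (card (rowc f))) \<le> 2 * lam * \<beta>"
    proof -
      \<comment> \<open>This is what \<open>2 * lam \<le> J\<close> is for: the lowered threshold is
        still at least half of the original one.\<close>
      have ge: "real J / (2 * lam) \<le> real J / lam - 1" using lam by (simp add: field_simps)
      have pos: "0 < real J / (2 * lam)" using J0 lam by simp
      have "pr ?H (\<lambda>f. real J / lam - 1 \<le> real (card (rowc f))) \<le>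
          pr ?H (\<lambda>f. real J / (2 * lam) \<le> real (card {j' \<in> {..<J} - {j}. hit i j' f \<or> su j' f}))"
        by (rule pr_mono) (use ge in \<open>simp add: rowc_def\<close>)
      also have "\<dots> \<le> (\<Sum>j'\<in>{..<J} - {j}. pr ?H (\<lambda>f. hit i j' f \<or> su j' f)) / (real J / (2 * lam))"
        by (rule pr_card_ge[OF _ pos]) simp
      also have "\<dots> \<le> (real J * \<beta>) / (real J / (2 * lam))"
      proof (rule divide_right_mono)
        have "(\<Sum>j'\<in>{..<J} - {j}. pr ?H (\<lambda>f. hit i j' f \<or> su j' f)) \<le> (\<Sum>j'\<in>{..<J} - {j}. \<beta>)"
        proof (rule sum_mono)
          fix j' assume "j' \<in> {..<J} - {j}"
          then show "pr ?H (\<lambda>f. hit i j' f \<or> su j' f) \<le> \<beta>"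
            using pr_disj[of ?H "hit i j'" "su j'"] hit[of i j'] su[of j'] ij JM by (auto simp: \<beta>_def)
        qed
        also have "\<dots> = real (card ({..<J} - {j})) * \<beta>" by simp
        also have "\<dots> \<le> real J * \<beta>"
          using \<beta>0 card_mono[of "{..<J}" "{..<J} - {j}"] by (intro mult_right_mono) auto
        finally show "(\<Sum>j'\<in>{..<J} - {j}. pr ?H (\<lambda>f. hit i j' f \<or> su j' f)) \<le> real J * \<beta>" .
      qed (use pos in simp)
      also have "\<dots> = 2 * lam * \<beta>" using J0 lam by simp
      finally show ?thesis .
    qed
    have col: "pr ?H (\<lambda>f. real ?N / lam - 1 \<le> real (card (colc f))) \<le> 2 * lam * \<beta>"
    proof -
      have N0: "0 < real ?N" using lam by linarith
      have ge: "real ?N / (2 * lam) \<le> real ?N / lam - 1" using lam by (simp add: field_simps)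
      have pos: "0 < real ?N / (2 * lam)" using N0 lam by simp
      have "pr ?H (\<lambda>f. real ?N / lam - 1 \<le> real (card (colc f))) \<le>
          pr ?H (\<lambda>f. real ?N / (2 * lam) \<le> real (card {i' \<in> {J..<?M} - {i}. hit i' j f \<or> sr i' f}))"
        by (rule pr_mono) (use ge in \<open>simp add: colc_def\<close>)
      also have "\<dots> \<le> (\<Sum>i'\<in>{J..<?M} - {i}. pr ?H (\<lambda>f. hit i' j f \<or> sr i' f)) / (real ?N / (2 * lam))"
        by (rule pr_card_ge[OF _ pos]) simp
      also have "\<dots> \<le> (real ?N * \<beta>) / (real ?N / (2 * lam))"
      proof (rule divide_right_mono)
        have "(\<Sum>i'\<in>{J..<?M} - {i}. pr ?H (\<lambda>f. hit i' j f \<or> sr i' f)) \<le> (\<Sum>i'\<in>{J..<?M} - {i}. \<beta>)"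
        proof (rule sum_mono)
          fix i' assume "i' \<in> {J..<?M} - {i}"
          then show "pr ?H (\<lambda>f. hit i' j f \<or> sr i' f) \<le> \<beta>"
            using pr_disj[of ?H "hit i' j" "sr i'"] hit[of i' j] sr[of i'] ij JM by (auto simp: \<beta>_def)
        qed
        also have "\<dots> = real (card ({J..<?M} - {i})) * \<beta>" by simp
        also have "\<dots> \<le> real ?N * \<beta>"
          using \<beta>0 card_mono[of "{J..<?M}" "{J..<?M} - {i}"] by (intro mult_right_mono) auto
        finally show "(\<Sum>i'\<in>{J..<?M} - {i}. pr ?H (\<lambda>f. hit i' j f \<or> sr i' f)) \<le> real ?N * \<beta>" .
      qed (use pos in simp)
      also have "\<dots> = 2 * lam * \<beta>" using N0 lam by simp
      finally show ?thesis .
    qed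
    have "pr ?H (\<lambda>f. spoiled n p J ?M lam T x (f(u := i, r := j)) u r) \<le>
        pr ?H (\<lambda>f. (hit i j f \<or> su j f) \<or> sr i f \<or> real J / lam - 1 \<le> real (card (rowc f)) \<or> real ?N / lam - 1 \<le> real (card (colc f)))"
      by (rule pr_mono) (rule imp)
    also have "\<dots> \<le> (pr ?H (hit i j) + pr ?H (su j)) + (pr ?H (sr i) +
        (pr ?H (\<lambda>f. real J / lam - 1 \<le> real (card (rowc f))) + pr ?H (\<lambda>f. real ?N / lam - 1 \<le> real (card (colc f)))))"
      by (intro order_trans[OF pr_disj] add_mono order_refl)
    also have "\<dots> \<le> (\<tau> + d / real ?M) + (d / real ?M + (2 * lam * \<beta> + 2 * lam * \<beta>))"
      by (intro add_mono hit su sr row col) (use ij JM in auto)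
    also have "\<dots> \<le> 2 * \<beta> + 4 * lam * \<beta>" using \<tau>0 by (simp add: \<beta>_def)
    also have "\<dots> \<le> 6 * lam * \<beta>"
      using mult_right_mono[OF lam(1) \<beta>0] by linarith
    finally show ?thesis .
  qed
  show ?thesis
    unfolding Pi_pmf_peel2'[OF finite_atLeastAtMost ur e(2)] \<beta>_def[symmetric]
  \<comment> \<open>Outcomes that do not cross contribute nothing; the others have total probability
    at most \<open>1 / A\<close>.\<close>
  proof (rule pr_bind_le_mult[where G = "\<lambda>w. fst w \<in> {J..<?M} \<and> snd w < J"])
    fix w
    show "pr (case w of (i, j) \<Rightarrow> map_pmf (\<lambda>f. f(u := i, r := j)) (cells ?W ?M)) (\<lambda>c. spoiled n p J ?M lam T x c u r)
      \<le> of_bool (fst w \<in> {J..<?M} \<and> snd w < J) * (6 * lam * \<beta>)"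
    proof (cases "fst w \<in> {J..<?M} \<and> snd w < J")
      case True
      then show ?thesis using main[of "fst w" "snd w"] unfolding case_prod_unfold pr_map by simp
    next
      case False
      then have "\<not> spoiled n p J ?M lam T x (f(u := fst w, r := snd w)) u r" for f
        using e(2) by (auto simp: spoiled_def)
      then show ?thesis using \<beta>0 lam unfolding case_prod_unfold pr_map by simp
    qed
    have "{w \<in> {0..<?M} \<times> {0..<?M}. fst w \<in> {J..<?M} \<and> snd w < J} = {J..<?M} \<times> {..<J}" using JM by auto
    then have "pr (pair_pmf (pmf_of_set {0..<?M}) (pmf_of_set {0..<?M})) (\<lambda>w. fst w \<in> {J..<?M} \<and> snd w < J) =
        real ?N * real J / (real ?M * real ?M)"
      using JM by (subst pr_pair_pmf_of_set) (auto simp: card_cartesian_product)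
    also have "\<dots> \<le> real ?M * real J / (real ?M * real ?M)"
      by (intro divide_right_mono mult_right_mono of_nat_mono) auto
    also have "\<dots> = 1 / real A" using J0 AJ by (simp add: field_simps)
    finally show "pr (pair_pmf (pmf_of_set {0..<?M}) (pmf_of_set {0..<?M})) (\<lambda>w. fst w \<in> {J..<?M} \<and> snd w < J) \<le> 1 / real A" .
    show "0 \<le> 6 * lam * \<beta>" using \<beta>0 lam by simp
  qed
qed

text \<open>The third count concerns the hashing as a whole and not a single edge, hence it is
  treated apart from \<open>spoiled\<close>, by one Markov bound over all crossing pairs of cells
  and without a factor \<open>1 / A\<close>.\<close>

lemma many_cells_pr:
  fixes x :: "nat set \<Rightarrow> int" and p n :: nat
  defines "G \<equiv> \<lambda>T. avoid {e \<in> pairs n. \<not> int p dvd x e} T"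
  assumes touch: "touch {1..n} (2 / real (A * J)) (G T) \<le> \<tau>" and AJ: "2 \<le> A" "0 < J" and lam: "0 < lam"
  shows "pr (cells {1..n} (A * J)) (\<lambda>c. real (A * J - J) * real J / lam < real (card {w \<in>
    ({J..<A * J} - c ` T) \<times> ({..<J} - c ` T). cell_sum n p c x (fst w) (snd w) \<noteq> 0})) \<le> lam * \<tau>"
proof -
  let ?M = "A * J" and ?N = "A * J - J"
  let ?H = "cells {1..n} ?M" and ?W = "{J..<?M} \<times> {..<J}"
  have JM: "J < ?M" using AJ by simp
  have GV: "G T \<subseteq> pairs n" by (auto simp: G_def avoid_def)
  define hit where "hit w c = (\<exists>g\<in>G T. c ` g = {fst w, snd w})" for w and c :: "nat \<Rightarrow> nat"
  have pos: "0 < real ?N * real J / lam" using JM AJ lam by simp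
  have "pr ?H (\<lambda>c. real ?N * real J / lam < real (card {w \<in>
      ({J..<?M} - c ` T) \<times> ({..<J} - c ` T). cell_sum n p c x (fst w) (snd w) \<noteq> 0})) \<le>
    pr ?H (\<lambda>c. real ?N * real J / lam \<le> real (card {w \<in> ?W. hit w c}))"
  proof (rule pr_mono)
    fix c
    assume "real ?N * real J / lam < real (card {w \<in>
      ({J..<?M} - c ` T) \<times> ({..<J} - c ` T). cell_sum n p c x (fst w) (snd w) \<noteq> 0})"
    also have "\<dots> \<le> real (card {w \<in> ?W. hit w c})"
    proof (intro of_nat_mono card_mono)
      show "{w \<in> ({J..<?M} - c ` T) \<times> ({..<J} - c ` T). cell_sum n p c x (fst w) (snd w) \<noteq> 0} \<subseteq> {w \<in> ?W. hit w c}"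
      proof
        fix w assume w: "w \<in> {w \<in> ({J..<?M} - c ` T) \<times> ({..<J} - c ` T). cell_sum n p c x (fst w) (snd w) \<noteq> 0}"
        then have "hit w c" unfolding hit_def G_def by (intro cell_sum_nonzero) auto
        then show "w \<in> {w \<in> ?W. hit w c}" using w by auto
      qed
    qed simp
    finally show "real ?N * real J / lam \<le> real (card {w \<in> ?W. hit w c})" by simp
  qed
  also have "\<dots> \<le> (\<Sum>w\<in>?W. pr ?H (hit w)) / (real ?N * real J / lam)"
    by (rule pr_card_ge[OF _ pos]) simp
  also have "\<dots> \<le> (real ?N * real J * \<tau>) / (real ?N * real J / lam)"
  proof (rule divide_right_mono)
    have "(\<Sum>w\<in>?W. pr ?H (hit w)) \<le> (\<Sum>w\<in>?W. \<tau>)"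
    proof (rule sum_mono)
      fix w assume w: "w \<in> ?W"
      have "pr ?H (hit w) \<le> pr ?H (\<lambda>c. \<exists>g\<in>G T. g \<subseteq> {1..n} \<and> c ` g = {fst w, snd w})"
        by (rule pr_mono) (use GV in \<open>auto simp: hit_def pairs_def\<close>)
      also have "\<dots> \<le> touch {1..n} (2 / real ?M) (G T)"
        by (rule pr_cell_pair_hit[OF GV]) (use w JM in auto)
      finally show "pr ?H (hit w) \<le> \<tau>" using touch by simp
    qed
    also have "\<dots> = real ?N * real J * \<tau>" by (simp add: card_cartesian_product)
    finally show "(\<Sum>w\<in>?W. pr ?H (hit w)) \<le> real ?N * real J * \<tau>" .
  qed (use pos in simp)
  also have "\<dots> = lam * \<tau>"
  proof -
    have "q * \<tau> / (q / lam) = lam * \<tau>" if "0 < q / lam" for q :: real using that lam by (auto simp: field_simps)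
    then show ?thesis using pos by blast
  qed
  finally show ?thesis .
qed

text \<open>Expose the cells of \<open>T\<close> first. Except with probability
  \<open>A / t\<close>, at most \<open>2 * t / A\<close> vertices of \<open>T\<close> are in right
  cells. Then at most \<open>t * J + (A * J) * (2 * t / A) = 3 * t * J\<close> crossing pairs of
  cells are met by \<open>T\<close>; two orientations and division by the square of
  \<open>A * J\<close> give \<open>\<eta>'\<close>. As the matching avoids \<open>T\<close>, its
  ends are still uniform, and their count concentrates.\<close>

lemma dirty_pr:
  assumes T: "T \<subseteq> {1..n}" "real (card T) \<le> t" "0 < t"
    and Ms: "disjoint Ms" "\<And>e. e \<in> Ms \<Longrightarrow> e \<subseteq> {1..n} - T \<and> card e = 2"
    and dev: "0 < dev" and AJ: "2 \<le> A" "0 < J"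
  defines "P \<equiv> \<lambda>e c. \<exists>u r. e = {u, r} \<and> J \<le> c u \<and> c r < J \<and> (c u \<in> c ` T \<or> c r \<in> c ` T)"
    and "\<eta>' \<equiv> 6 * t / (real A * real (A * J))"
  shows "pr (cells {1..n} (A * J)) (\<lambda>c. real (card Ms) * \<eta>' + dev \<le> real (card {e \<in> Ms. P e c}))
    \<le> real A / t + real (card Ms) * \<eta>' / dev\<^sup>2"
proof -
  let ?M = "A * J" and ?V = "{1..n}"
  let ?W = "?V - T"
  define U where "U = pmf_of_set {0..<?M}"
  have JM: "J < ?M" using AJ by simp
  have finT: "finite T" using T finite_subset by auto
  have finMs: "finite Ms" by (rule finite_subset[of _ "Pow ?V"]) (use Ms in auto)
  have \<eta>'0: "0 \<le> \<eta>'" using T by (simp add: \<eta>'_def)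
  have split: "cells ?V ?M = bind_pmf (cells T ?M) (\<lambda>f. map_pmf (\<lambda>g v. if v \<in> T then f v else g v) (cells ?W ?M))"
  proof -
    have "?V = T \<union> ?W" using T by auto
    then have "cells ?V ?M = cells (T \<union> ?W) ?M" by simp
    also have "\<dots> = map_pmf (\<lambda>(f, g) v. if v \<in> T then f v else g v) (pair_pmf (cells T ?M) (cells ?W ?M))"
      by (rule Pi_pmf_union) (use finT in auto)
    finally show ?thesis by (simp add: pair_pmf_alt1 map_bind_pmf pmf.map_comp o_def)
  qed
  show ?thesis
    unfolding split
  proof (rule pr_bind_le_good[where G = "\<lambda>f. real (card {v \<in> T. f v < J}) \<le> 2 * t / real A"])
    fix f assume G: "real (card {v \<in> T. f v < J}) \<le> 2 * t / real A"
    define Q where "Q i j = (J \<le> i \<and> j < J \<and> (i \<in> f ` T \<or> j \<in> f ` T))" for i j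
    define \<eta> where "\<eta> = pr (pair_pmf U U) (\<lambda>(i, j). Q i j \<or> Q j i)"
    have Qcard: "real (card {w \<in> {0..<?M} \<times> {0..<?M}. Q (fst w) (snd w)}) \<le> 3 * t * real J"
    proof -
      let ?Z = "f ` {v \<in> T. f v < J}"
      have "card {w \<in> {0..<?M} \<times> {0..<?M}. Q (fst w) (snd w)} \<le> card ((f ` T) \<times> {..<J} \<union> {..<?M} \<times> ?Z)"
        by (rule card_mono) (use finT in \<open>auto simp: Q_def\<close>)
      also have "\<dots> \<le> card (f ` T) * J + ?M * card ?Z"
        by (rule order_trans[OF card_Un_le]) (simp add: card_cartesian_product)
      also have "\<dots> \<le> card T * J + ?M * card {v \<in> T. f v < J}"
        by (intro add_mono mult_mono card_image_le) (use finT in auto)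
      finally have "real (card {w \<in> {0..<?M} \<times> {0..<?M}. Q (fst w) (snd w)}) \<le>
          real (card T) * real J + real ?M * real (card {v \<in> T. f v < J})"
        by (simp only: of_nat_add[symmetric] of_nat_mult[symmetric] of_nat_le_iff)
      also have "\<dots> \<le> t * real J + real ?M * (2 * t / real A)"
        using T G by (intro add_mono mult_mono) auto
      also have "\<dots> = 3 * t * real J" using AJ by (simp add: field_simps)
      finally show ?thesis .
    qed
    have M0: "{0..<?M} \<noteq> {}" using JM by auto
    have avg: "pr (pair_pmf U U) S = real (card {w \<in> {0..<?M} \<times> {0..<?M}. S w}) / (real ?M * real ?M)" for S
      unfolding U_def by (subst pr_pair_pmf_of_set) (use M0 in simp_all)
    have 1: "pr (pair_pmf U U) (\<lambda>w. Q (fst w) (snd w)) \<le> 3 * t * real J / (real ?M * real ?M)"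
      unfolding avg by (rule divide_right_mono[OF Qcard]) simp
    have "{w \<in> {0..<?M} \<times> {0..<?M}. Q (snd w) (fst w)} = prod.swap ` {w \<in> {0..<?M} \<times> {0..<?M}. Q (fst w) (snd w)}"
      by auto
    then have "card {w \<in> {0..<?M} \<times> {0..<?M}. Q (snd w) (fst w)} = card {w \<in> {0..<?M} \<times> {0..<?M}. Q (fst w) (snd w)}"
      by (simp add: card_image inj_on_def)
    then have 2: "pr (pair_pmf U U) (\<lambda>w. Q (snd w) (fst w)) \<le> 3 * t * real J / (real ?M * real ?M)"
      using divide_right_mono[OF Qcard, of "real ?M * real ?M"] unfolding avg by (simp del: of_nat_mult)
    have "\<eta> \<le> pr (pair_pmf U U) (\<lambda>w. Q (fst w) (snd w)) + pr (pair_pmf U U) (\<lambda>w. Q (snd w) (fst w))"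
      unfolding \<eta>_def case_prod_unfold by (rule pr_disj)
    also have "\<dots> \<le> 3 * t * real J / (real ?M * real ?M) + 3 * t * real J / (real ?M * real ?M)"
      by (rule add_mono[OF 1 2])
    also have "\<dots> = \<eta>'" using AJ by (simp add: \<eta>'_def field_simps)
    finally have \<eta>: "\<eta> \<le> \<eta>'" .
    have P: "{e \<in> Ms. P e (\<lambda>v. if v \<in> T then f v else g v)} = {e \<in> Ms. \<exists>u r. e = {u, r} \<and> Q (g u) (g r)}" for g
    proof -
      define c where "c = (\<lambda>v. if v \<in> T then f v else g v)"
      have im: "c ` T = f ` T" by (auto simp: c_def)
      have "P e c = (\<exists>u r. e = {u, r} \<and> Q (g u) (g r))" if e: "e \<in> Ms" for e
      proof -
        have cg: "c v = g v" if "v \<in> e" for v using Ms(2)[OF e] that by (auto simp: c_def)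
        have QQ: "Q (c u) (c r) = Q (g u) (g r)" if "e = {u, r}" for u r
          using cg[of u] cg[of r] that by simp
        have "P e c = (\<exists>u r. e = {u, r} \<and> Q (c u) (c r))" by (simp add: P_def Q_def im)
        also have "\<dots> = (\<exists>u r. e = {u, r} \<and> Q (g u) (g r))"
          by (intro arg_cong[where f = Ex] ext conj_cong refl) (rule QQ)
        finally show ?thesis .
      qed
      then have "{e \<in> Ms. P e c} = {e \<in> Ms. \<exists>u r. e = {u, r} \<and> Q (g u) (g r)}" by blast
      then show ?thesis by (simp add: c_def)
    qed
    have "pr (map_pmf (\<lambda>g v. if v \<in> T then f v else g v) (cells ?W ?M))
        (\<lambda>c. real (card Ms) * \<eta>' + dev \<le> real (card {e \<in> Ms. P e c}))
      \<le> pr (cells ?W ?M) (\<lambda>g. dev \<le> \<bar>real (card {e \<in> Ms. \<exists>u r. e = {u, r} \<and> Q (g u) (g r)}) - real (card Ms) * \<eta>\<bar>)"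
      unfolding pr_map P
    proof (rule pr_mono)
      fix g assume "real (card Ms) * \<eta>' + dev \<le> real (card {e \<in> Ms. \<exists>u r. e = {u, r} \<and> Q (g u) (g r)})"
      moreover have "real (card Ms) * \<eta> \<le> real (card Ms) * \<eta>'" using \<eta> by (intro mult_left_mono) auto
      ultimately show "dev \<le> \<bar>real (card {e \<in> Ms. \<exists>u r. e = {u, r} \<and> Q (g u) (g r)}) - real (card Ms) * \<eta>\<bar>"
        by linarith
    qed
    also have "\<dots> \<le> real (card Ms) * \<eta> / dev\<^sup>2"
      unfolding \<eta>_def U_def by (rule matching_count_deviation[OF _ finMs Ms dev]) auto
    also have "\<dots> \<le> real (card Ms) * \<eta>' / dev\<^sup>2"
      using \<eta> by (intro divide_right_mono mult_left_mono) auto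
    finally show "pr (map_pmf (\<lambda>g v. if v \<in> T then f v else g v) (cells ?W ?M))
        (\<lambda>c. real (card Ms) * \<eta>' + dev \<le> real (card {e \<in> Ms. P e c})) \<le> real (card Ms) * \<eta>' / dev\<^sup>2" .
  next
    have pJ: "pr U (\<lambda>i. i < J) = 1 / real A"
    proof -
      have "{0..<?M} \<inter> {i. i < J} = {..<J}" using less_trans[OF _ JM] by auto
      then show ?thesis unfolding U_def using JM AJ by (subst measure_pmf_of_set) auto
    qed
    have tA: "0 < t / real A" using T AJ by simp
    have "pr (cells T ?M) (\<lambda>f. \<not> real (card {v \<in> T. f v < J}) \<le> 2 * t / real A) \<le>
        pr (cells T ?M) (\<lambda>f. t / real A \<le> \<bar>real (card {v \<in> T. f v < J}) - real (card T) * (1 / real A)\<bar>)"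
    proof (rule pr_mono)
      fix f assume "\<not> real (card {v \<in> T. f v < J}) \<le> 2 * t / real A"
      moreover have "real (card T) * (1 / real A) \<le> t / real A" using T AJ by (simp add: divide_right_mono)
      ultimately show "t / real A \<le> \<bar>real (card {v \<in> T. f v < J}) - real (card T) * (1 / real A)\<bar>" by simp
    qed
    also have "\<dots> \<le> real (card T) * (1 / real A) / (t / real A)\<^sup>2"
    proof (rule chebyshev_card[OF finT _ _ tA])
      show e: "pr (cells T ?M) (\<lambda>f. f v < J) = 1 / real A" if "v \<in> T" for v
        using pr_Pi_component[OF finT that, of ?M "\<lambda>_. U" "\<lambda>i. i < J"] pJ by (simp add: U_def)
      show "pr (cells T ?M) (\<lambda>f. f v < J \<and> f w < J) = 1 / real A * (1 / real A)"
        if "v \<in> T" "w \<in> T" "v \<noteq> w" for v w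
        using pr_Pi_indep[OF finT, of "{v}" "{w}" "\<lambda>f. f v < J" "\<lambda>f. f w < J" ?M "\<lambda>_. pmf_of_set {0..<?M}"]
          that e by simp
    qed
    also have "\<dots> \<le> t * (1 / real A) / (t / real A)\<^sup>2"
      using T by (intro divide_right_mono mult_right_mono) auto
    also have "\<dots> = real A / t" using T AJ by (simp add: field_simps power2_eq_square)
    finally show "pr (cells T ?M) (\<lambda>f. \<not> real (card {v \<in> T. f v < J}) \<le> 2 * t / real A) \<le> real A / t" .
  qed (use \<eta>'0 in simp)
qed

text \<open>An edge crosses with probability \<open>2 * (1 - 1 / A) / A\<close>, which is at least
  \<open>1 / A\<close> as \<open>A \<ge> 2\<close>. The claim is Chebyshev's inequality at half of
  the mean.\<close>

lemma crossing_pr: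
  assumes Ms: "disjoint Ms" "\<And>e. e \<in> Ms \<Longrightarrow> e \<subseteq> {1..n} \<and> card e = 2" "Ms \<noteq> {}" and AJ: "2 \<le> A" "0 < J"
  shows "pr (cells {1..n} (A * J)) (\<lambda>c. real (card {e \<in> Ms. \<exists>u r. e = {u, r} \<and> J \<le> c u \<and> c r < J})
      \<le> real (card Ms) / (2 * real A)) \<le> 4 * real A / real (card Ms)"
proof -
  let ?M = "A * J" and ?N = "A * J - J"
  let ?m = "real (card Ms)"
  have JM: "J < ?M" using AJ by simp
  have finMs: "finite Ms" by (rule finite_subset[of _ "Pow {1..n}"]) (use Ms in auto)
  have m0: "0 < ?m" using Ms(3) finMs by (simp add: card_gt_0_iff)
  define Q where "Q i j = (J \<le> i \<and> j < J)" for i j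
  define \<eta> where "\<eta> = pr (pair_pmf (pmf_of_set {0..<?M}) (pmf_of_set {0..<?M})) (\<lambda>(i, j). Q i j \<or> Q j i)"
  have set: "{w \<in> {0..<?M} \<times> {0..<?M}. case w of (i, j) \<Rightarrow> Q i j \<or> Q j i} =
      {J..<?M} \<times> {..<J} \<union> {..<J} \<times> {J..<?M}"
    using JM by (auto simp: Q_def)
  have "card ({J..<?M} \<times> {..<J} \<union> {..<J} \<times> {J..<?M}) = card ({J..<?M} \<times> {..<J}) + card ({..<J} \<times> {J..<?M})"
    by (rule card_Un_disjoint) auto
  also have "\<dots> = 2 * ?N * J" by (simp add: card_cartesian_product)
  finally have "\<eta> = real (2 * ?N * J) / (real ?M * real ?M)"
    unfolding \<eta>_def using JM by (subst pr_pair_pmf_of_set) (auto simp only: set card_atLeastLessThan; simp)+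
  moreover have "real ?M \<le> 2 * real ?N"
  proof -
    have "2 * J \<le> ?M" using AJ by simp
    then have "?M \<le> 2 * ?N" by linarith
    then have "real ?M \<le> real (2 * ?N)" by (rule of_nat_mono)
    then show ?thesis by (simp only: of_nat_mult[of 2] of_nat_numeral)
  qed
  then have "real ?M * real J \<le> real (2 * ?N * J)" by (simp add: mult_right_mono)
  then have "real ?M * real J / (real ?M * real ?M) \<le> real (2 * ?N * J) / (real ?M * real ?M)"
    by (rule divide_right_mono) simp
  moreover have "real ?M * real J / (real ?M * real ?M) = 1 / real A" using AJ by (simp add: field_simps)
  ultimately have \<eta>: "1 / real A \<le> \<eta>" by simp
  have "0 < 1 / real A" using AJ by simp
  then have \<eta>0: "0 < \<eta>" using \<eta> by linarith
  have d0: "0 < ?m * \<eta> / 2" using m0 \<eta>0 by simp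
  have "pr (cells {1..n} ?M) (\<lambda>c. real (card {e \<in> Ms. \<exists>u r. e = {u, r} \<and> J \<le> c u \<and> c r < J}) \<le> ?m / (2 * real A))
    \<le> pr (cells {1..n} ?M) (\<lambda>c. ?m * \<eta> / 2 \<le> \<bar>real (card {e \<in> Ms. \<exists>u r. e = {u, r} \<and> Q (c u) (c r)}) - ?m * \<eta>\<bar>)"
  proof (rule pr_mono)
    fix c assume "real (card {e \<in> Ms. \<exists>u r. e = {u, r} \<and> J \<le> c u \<and> c r < J}) \<le> ?m / (2 * real A)"
    moreover have "?m / (2 * real A) \<le> ?m * \<eta> / 2" using mult_left_mono[OF \<eta>, of ?m] by simp
    ultimately show "?m * \<eta> / 2 \<le> \<bar>real (card {e \<in> Ms. \<exists>u r. e = {u, r} \<and> Q (c u) (c r)}) - ?m * \<eta>\<bar>"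
      unfolding Q_def by linarith
  qed
  also have "\<dots> \<le> ?m * \<eta> / (?m * \<eta> / 2)\<^sup>2"
    unfolding \<eta>_def by (rule matching_count_deviation[OF _ finMs Ms(1,2)]) (use d0 in \<open>auto simp: \<eta>_def\<close>)
  also have "\<dots> = 4 / (?m * \<eta>)" using m0 \<eta>0 by (simp add: field_simps power2_eq_square)
  also have "\<dots> \<le> 4 / (?m * (1 / real A))"
    using m0 \<eta> \<eta>0 AJ by (intro divide_left_mono mult_left_mono mult_pos_pos) auto
  finally show ?thesis by simp
qed

text \<open>A crossing edge that is not accepted shares a cell with \<open>T\<close> or is spoiled
  in one of the hashings, unless the third count is exceeded there. About \<open>card Ms / A\<close>
  edges cross, so it suffices that each hashing destroys at most a small fraction of that
  number.\<close>

lemma accepted_complete: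
  fixes x :: "nat set \<Rightarrow> int" and p n :: nat
  assumes T: "T \<subseteq> {1..n}" "real (card T) \<le> t" "0 < t"
  defines "G \<equiv> avoid {e \<in> pairs n. \<not> int p dvd x e} T"
  assumes Ms: "Ms \<subseteq> G" "disjoint Ms" "Ms \<noteq> {}"
    and deg: "\<And>v. v \<in> \<Union>Ms \<Longrightarrow> real (degree_in G v) \<le> d"
    and touch: "touch {1..n} (2 / real (A * J)) G \<le> \<tau>"
    and AJ: "2 \<le> A" and lam: "1 \<le> lam" "2 * lam \<le> real J" "2 * lam \<le> real (A * J - J)"
    and C: "1 \<le> C" "96 * t * real C \<le> real (A * J)"
  shows "pr (hashes n C A J) (\<lambda>\<omega>. real (card (accepted n p C J (A * J) lam T \<omega> x \<inter> Ms)) \<le> real (card Ms) / (4 * real A))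
    \<le> 4 * real A / real (card Ms) + real C * (real A / t + 16 * real A * real C / real (card Ms)
       + 96 * real C * lam * (\<tau> + d / real (A * J)) + lam * \<tau>)"
proof -
  let ?M = "A * J" and ?m = "real (card Ms)"
  let ?Acc = "\<lambda>\<omega>. accepted n p C J ?M lam T \<omega> x \<inter> Ms"
  have J0: "0 < J" using lam by linarith
  have GV: "G \<subseteq> pairs n" by (auto simp: G_def avoid_def)
  have Ms2: "e \<subseteq> {1..n} - T \<and> card e = 2" "e \<in> pairs n" if "e \<in> Ms" for e
    using that Ms(1) by (auto simp: G_def avoid_def pairs_def)
  have finMs: "finite Ms" using Ms(1) GV finite_subset finite_pairs by metis
  have m0: "0 < ?m" using Ms(3) finMs by (simp add: card_gt_0_iff)
  have AC: "0 < real A" "0 < real C" using AJ C by auto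
  define X where "X c = {e \<in> Ms. \<exists>u r. e = {u, r} \<and> J \<le> c u \<and> c r < J}" for c :: "nat \<Rightarrow> nat"
  define D where "D c = {e \<in> Ms. \<exists>u r. e = {u, r} \<and> J \<le> c u \<and> c r < J \<and> (c u \<in> c ` T \<or> c r \<in> c ` T)}" for c :: "nat \<Rightarrow> nat"
  define B where "B c = {e \<in> Ms. \<exists>u r. e = {u, r} \<and> spoiled n p J ?M lam T x c u r}" for c
  define K where "K c = (real (?M - J) * real J / lam < real (card {w \<in>
    ({J..<?M} - c ` T) \<times> ({..<J} - c ` T). cell_sum n p c x (fst w) (snd w) \<noteq> 0}))" for c
  \<comment> \<open>The loss allowed per hashing and per cause: \<open>C\<close> hashings with two
    causes lose \<open>card Ms / (4 * A)\<close>, half of the crossing edges that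
    \<open>crossing_pr\<close> guarantees. The constant 96 in the assumption on \<open>A * J\<close>
    brings the mean of \<open>D\<close> below \<open>y / 2\<close>.\<close>
  define y where "y = ?m / (8 * real A * real C)"
  have y0: "0 < y" using m0 AC by (simp add: y_def)
  define bad where "bad c = (y \<le> real (card (D c)) \<or> y \<le> real (card (B c)) \<or> K c)" for c
  have prK: "pr (cells {1..n} ?M) K \<le> lam * \<tau>"
    unfolding K_def using touch lam(1) by (intro many_cells_pr[OF _ AJ J0]) (auto simp: G_def)
  have prD: "pr (cells {1..n} ?M) (\<lambda>c. y \<le> real (card (D c))) \<le> real A / t + 16 * real A * real C / ?m"
  proof -
    define \<eta>' where "\<eta>' = 6 * t / (real A * real ?M)"
    have "\<eta>' \<le> 1 / (16 * real A * real C)"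
    proof -
      have M0: "0 < real ?M" using AJ J0 by simp
      have "\<eta>' = (96 * t * real C) / (16 * real A * real C * real ?M)" using AC M0 by (simp add: \<eta>'_def del: of_nat_mult)
      also have "\<dots> \<le> real ?M / (16 * real A * real C * real ?M)" by (rule divide_right_mono) (use C in auto)
      also have "\<dots> = 1 / (16 * real A * real C)" using M0 by (simp del: of_nat_mult)
      finally show ?thesis .
    qed
    then have \<eta>': "?m * \<eta>' \<le> ?m * (1 / (16 * real A * real C))" by (rule mult_left_mono) simp
    also have yy: "\<dots> = y / 2" by (simp add: y_def)
    finally have \<eta>y: "?m * \<eta>' \<le> y / 2" .
    have "pr (cells {1..n} ?M) (\<lambda>c. y \<le> real (card (D c))) \<le>
        pr (cells {1..n} ?M) (\<lambda>c. ?m * \<eta>' + y / 2 \<le> real (card (D c)))"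
      by (rule pr_mono) (use \<eta>y in linarith)
    also have "\<dots> \<le> real A / t + ?m * \<eta>' / (y / 2)\<^sup>2"
      unfolding D_def \<eta>'_def by (rule dirty_pr[OF T Ms(2) Ms2(1) _ AJ J0]) (use y0 T(3) in auto)
    also have "\<dots> \<le> real A / t + (y / 2) / (y / 2)\<^sup>2"
      by (intro add_left_mono divide_right_mono \<eta>y) simp
    also have "(y / 2) / (y / 2)\<^sup>2 = 16 * real A * real C / ?m"
      using m0 AC by (simp add: y_def power2_eq_square)
    finally show ?thesis .
  qed
  have prB: "pr (cells {1..n} ?M) (\<lambda>c. y \<le> real (card (B c))) \<le> 96 * real C * lam * (\<tau> + d / real ?M)"
  proof -
    define b where "b = 1 / real A * (6 * lam * (\<tau> + d / real ?M))"
    have one: "pr (cells {1..n} ?M) (\<lambda>c. \<exists>u r. e = {u, r} \<and> spoiled n p J ?M lam T x c u r) \<le> 2 * b"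
      if e: "e \<in> Ms" for e
    proof -
      obtain u r where ur: "e = {u, r}" "u \<noteq> r" using Ms2[OF e] by (auto simp: card_2_iff)
      have "pr (cells {1..n} ?M) (\<lambda>c. \<exists>u r. e = {u, r} \<and> spoiled n p J ?M lam T x c u r) \<le>
          pr (cells {1..n} ?M) (\<lambda>c. spoiled n p J ?M lam T x c u r \<or> spoiled n p J ?M lam T x c r u)"
        by (rule pr_mono) (auto simp: ur doubleton_eq_iff)
      also have "\<dots> \<le> pr (cells {1..n} ?M) (\<lambda>c. spoiled n p J ?M lam T x c u r) + pr (cells {1..n} ?M) (\<lambda>c. spoiled n p J ?M lam T x c r u)"
        by (rule pr_disj)
      also have "\<dots> \<le> b + b"
      proof (rule add_mono)
        have G2: "{u, r} \<in> G" "{r, u} \<in> G" using e ur Ms(1) by (auto simp: insert_commute)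
        have dg: "real (degree_in G u) \<le> d" "real (degree_in G r) \<le> d"
          using deg[of u] deg[of r] e ur(1) by blast+
        show "pr (cells {1..n} ?M) (\<lambda>c. spoiled n p J ?M lam T x c u r) \<le> b"
          unfolding b_def using spoiled_pr[OF T(1), of u r p x d] G2 dg ur touch AJ lam by (auto simp: G_def)
        show "pr (cells {1..n} ?M) (\<lambda>c. spoiled n p J ?M lam T x c r u) \<le> b"
          unfolding b_def using spoiled_pr[OF T(1), of r u p x d] G2 dg ur touch AJ lam by (auto simp: G_def)
      qed
      finally show ?thesis by simp
    qed
    have "pr (cells {1..n} ?M) (\<lambda>c. y \<le> real (card (B c))) \<le>
        (\<Sum>e\<in>Ms. pr (cells {1..n} ?M) (\<lambda>c. \<exists>u r. e = {u, r} \<and> spoiled n p J ?M lam T x c u r)) / y"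
      unfolding B_def by (rule pr_card_ge[OF finMs y0])
    also have "\<dots> \<le> (?m * (2 * b)) / y"
      using sum_bounded_above[OF one] y0 by (intro divide_right_mono) auto
    also have "\<dots> = 96 * real C * lam * (\<tau> + d / real ?M)"
      using m0 AC unfolding y_def b_def by (simp add: field_simps)
    finally show ?thesis .
  qed
  have prbad: "pr (cells {1..n} ?M) bad \<le> real A / t + 16 * real A * real C / ?m
       + 96 * real C * lam * (\<tau> + d / real ?M) + lam * \<tau>"
  proof -
    have "pr (cells {1..n} ?M) bad \<le> pr (cells {1..n} ?M) (\<lambda>c. y \<le> real (card (D c)))
        + (pr (cells {1..n} ?M) (\<lambda>c. y \<le> real (card (B c))) + pr (cells {1..n} ?M) K)"
      unfolding bad_def by (intro order_trans[OF pr_disj] add_mono order_refl)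
    then show ?thesis using prD prB prK by linarith
  qed
  have "pr (hashes n C A J) (\<lambda>\<omega>. real (card (?Acc \<omega>)) \<le> ?m / (4 * real A)) \<le>
      pr (hashes n C A J) (\<lambda>\<omega>. real (card (X (\<omega> 0))) \<le> ?m / (2 * real A) \<or> (\<exists>a\<in>{..<C}. bad (\<omega> a)))"
  proof (rule pr_mono, rule ccontr)
    fix \<omega> assume \<omega>: "\<omega> \<in> set_pmf (hashes n C A J)" and few: "real (card (?Acc \<omega>)) \<le> ?m / (4 * real A)"
      and no: "\<not> (real (card (X (\<omega> 0))) \<le> ?m / (2 * real A) \<or> (\<exists>a\<in>{..<C}. bad (\<omega> a)))"
    \<comment> \<open>Hashing 0 stands for all, since they agree on which edges cross.\<close>
    have sub: "X (\<omega> 0) \<subseteq> ?Acc \<omega> \<union> (\<Union>a\<in>{..<C}. D (\<omega> a) \<union> B (\<omega> a))"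
    proof
      fix e assume e: "e \<in> X (\<omega> 0)"
      then obtain u r where ur: "e = {u, r}" "J \<le> \<omega> 0 u" "\<omega> 0 r < J" and eM: "e \<in> Ms" by (auto simp: X_def)
      have V: "u \<in> {1..n}" "r \<in> {1..n}" using Ms2[OF eM] ur by auto
      show "e \<in> ?Acc \<omega> \<union> (\<Union>a\<in>{..<C}. D (\<omega> a) \<union> B (\<omega> a))"
      proof (rule ccontr)
        assume out: "e \<notin> ?Acc \<omega> \<union> (\<Union>a\<in>{..<C}. D (\<omega> a) \<union> B (\<omega> a))"
        have "\<exists>u r. e = {u, r} \<and> good_cell J ?M lam (\<omega> a ` T) (cell_sum n p (\<omega> a) x) (\<omega> a u) (\<omega> a r)"
          if a: "a < C" for a
        proof (rule ccontr)
          assume ng: "\<not> ?thesis"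
          let ?c = "\<omega> a"
          have cu: "J \<le> ?c u" "?c u < ?M" and cr: "?c r < J"
            using hashes_sides[OF AJ J0 \<omega> a, of 0] a V ur by (auto simp: not_less[symmetric])
          have nD: "e \<notin> D ?c" and nB: "e \<notin> B ?c" using out a by blast+
          have "?c u \<notin> ?c ` T" "?c r \<notin> ?c ` T" using nD eM ur(1) cu cr unfolding D_def by blast+
          moreover have "\<not> K ?c" using no a by (auto simp: bad_def)
          moreover have "\<not> good_cell J ?M lam (?c ` T) (cell_sum n p ?c x) (?c u) (?c r)" using ng ur(1) by blast
          ultimately have "spoiled n p J ?M lam T x ?c u r" using cu cr by (simp add: spoiled_def K_def not_less)
          then show False using nB eM ur(1) unfolding B_def by blast
        qed
        moreover have "e \<inter> T = {}" using Ms2[OF eM] by auto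
        ultimately have "e \<in> accepted n p C J ?M lam T \<omega> x"
          using Ms2[OF eM] unfolding accepted_def meas_cell_row by blast
        then show False using out eM by blast
      qed
    qed
    have finA: "finite (?Acc \<omega>)" using finMs by simp
    have finDB: "finite (D c)" "finite (B c)" for c using finMs by (auto simp: D_def B_def)
    have "card (X (\<omega> 0)) \<le> card (?Acc \<omega> \<union> (\<Union>a\<in>{..<C}. D (\<omega> a) \<union> B (\<omega> a)))"
      by (rule card_mono[OF _ sub]) (use finA finDB in auto)
    also have "\<dots> \<le> card (?Acc \<omega>) + card (\<Union>a\<in>{..<C}. D (\<omega> a) \<union> B (\<omega> a))" by (rule card_Un_le)
    also have "\<dots> \<le> card (?Acc \<omega>) + (\<Sum>a\<in>{..<C}. card (D (\<omega> a) \<union> B (\<omega> a)))"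
      by (intro add_left_mono card_UN_le) simp
    also have "\<dots> \<le> card (?Acc \<omega>) + (\<Sum>a\<in>{..<C}. card (D (\<omega> a)) + card (B (\<omega> a)))"
      by (intro add_left_mono sum_mono card_Un_le)
    finally have "real (card (X (\<omega> 0))) \<le> real (card (?Acc \<omega>)) + (\<Sum>a\<in>{..<C}. real (card (D (\<omega> a))) + real (card (B (\<omega> a))))"
      by (simp only: of_nat_add[symmetric] of_nat_sum[symmetric] of_nat_le_iff)
    also have "\<dots> \<le> ?m / (4 * real A) + (\<Sum>a\<in>{..<C}. y + y)"
      using few no by (intro add_mono sum_mono) (auto simp: bad_def not_le intro: less_imp_le)
    also have "\<dots> = ?m / (2 * real A)" using AC by (simp add: y_def field_simps)
    finally show False using no by simp
  qed
  also have "\<dots> \<le> pr (hashes n C A J) (\<lambda>\<omega>. real (card (X (\<omega> 0))) \<le> ?m / (2 * real A))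
      + pr (hashes n C A J) (\<lambda>\<omega>. \<exists>a\<in>{..<C}. bad (\<omega> a))"
    by (rule pr_disj)
  also have "\<dots> \<le> 4 * real A / ?m + real (card {..<C}) * (real A / t + 16 * real A * real C / ?m
       + 96 * real C * lam * (\<tau> + d / real ?M) + lam * \<tau>)"
  proof (rule add_mono)
    have "pr (hashes n C A J) (\<lambda>\<omega>. real (card (X (\<omega> 0))) \<le> ?m / (2 * real A)) =
        pr (cells {1..n} ?M) (\<lambda>c. real (card (X c)) \<le> ?m / (2 * real A))"
      by (rule hashes_component[OF AJ J0]) (use C in simp)
    also have "\<dots> \<le> 4 * real A / ?m"
      unfolding X_def by (rule crossing_pr[OF Ms(2) _ Ms(3) AJ J0]) (use Ms2 in auto)
    finally show "pr (hashes n C A J) (\<lambda>\<omega>. real (card (X (\<omega> 0))) \<le> ?m / (2 * real A)) \<le> 4 * real A / ?m" .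
    show "pr (hashes n C A J) (\<lambda>\<omega>. \<exists>a\<in>{..<C}. bad (\<omega> a)) \<le> real (card {..<C}) * (real A / t + 16 * real A * real C / ?m
       + 96 * real C * lam * (\<tau> + d / real ?M) + lam * \<tau>)"
      by (rule pr_ex_bound) (use prbad hashes_component[OF AJ J0, of _ C n bad] in auto)
  qed
  finally show ?thesis by simp
qed

section \<open>One copy of the scheme\<close>

definition max_matching :: "nat set set \<Rightarrow> nat" where
  "max_matching G = Max (card ` {F. F \<subseteq> G \<and> disjoint F})"

lemma finite_matchings: "finite G \<Longrightarrow> finite {F. F \<subseteq> G \<and> disjoint F}"
  by (rule finite_subset[of _ "Pow G"]) auto

lemma max_matching_ge:
  assumes "finite G" "F \<subseteq> G" "disjoint F"
  shows "card F \<le> max_matching G"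
  unfolding max_matching_def using finite_matchings[OF assms(1)] assms by (intro Max_ge) auto

lemma max_matching_ex:
  assumes "finite G"
  obtains F where "F \<subseteq> G" "disjoint F" "card F = max_matching G"
proof -
  have "max_matching G \<in> card ` {F. F \<subseteq> G \<and> disjoint F}"
    unfolding max_matching_def
    by (rule Max_in) (use finite_matchings[OF assms] in \<open>auto intro!: exI[of _ "{}"]\<close>)
  then show ?thesis using that by auto
qed

lemma max_matching_mono:
  assumes "finite G'" "G \<subseteq> G'"
  shows "max_matching G \<le> max_matching G'"
  using max_matching_ex[of G] max_matching_ge[OF assms(1)] assms finite_subset by (metis order_trans)

lemma card_Union_matching:
  assumes "F \<subseteq> pairs n" "disjoint F"
  shows "card (\<Union>F) = 2 * card F"
proof -
  have "card (\<Union>F) = (\<Sum>f\<in>F. card f)"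
  proof (rule card_Union_disjoint[OF assms(2)])
    fix f assume "f \<in> F"
    then have "card f = 2" using assms(1) by (auto simp: pairs_def)
    then show "finite f" by (intro card_ge_0_finite) simp
  qed
  also have "\<dots> = (\<Sum>f\<in>F. 2)" using assms(1) by (intro sum.cong) (auto simp: pairs_def)
  finally show ?thesis by simp
qed

lemma max_matching_le:
  assumes "G \<subseteq> pairs n"
  shows "2 * max_matching G \<le> n"
proof -
  have "finite G" using assms finite_subset finite_pairs by blast
  then obtain F where F: "F \<subseteq> G" "disjoint F" "card F = max_matching G" by (rule max_matching_ex)
  have "2 * card F = card (\<Union>F)" by (rule card_Union_matching[symmetric, where n = n]) (use F assms in auto)
  also have "\<dots> \<le> card {1..n}" by (rule card_mono) (use F assms in \<open>auto simp: pairs_def\<close>)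
  finally show ?thesis using F by simp
qed

text \<open>In a matching, every vertex of \<open>W\<close> lies in at most one edge.\<close>

lemma matching_avoiding:
  assumes "F \<subseteq> pairs n" "disjoint F" "finite W"
  shows "card F \<le> card {f \<in> F. f \<inter> W = {}} + card W"
proof -
  have finF: "finite F" using assms(1) finite_subset finite_pairs by blast
  define g where "g f = (SOME v. v \<in> f \<inter> W)" for f
  have g: "g f \<in> f \<inter> W" if "f \<in> {f \<in> F. f \<inter> W \<noteq> {}}" for f
    unfolding g_def by (rule someI_ex) (use that in auto)
  have inj: "inj_on g {f \<in> F. f \<inter> W \<noteq> {}}"
  proof (rule inj_onI)
    fix f f' assume f: "f \<in> {f \<in> F. f \<inter> W \<noteq> {}}" "f' \<in> {f \<in> F. f \<inter> W \<noteq> {}}" "g f = g f'"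
    then have "g f \<in> f \<inter> f'" using g[of f] g[of f'] by auto
    then show "f = f'" using disjointD[OF assms(2), of f f'] f by auto
  qed
  have "card {f \<in> F. f \<inter> W \<noteq> {}} = card (g ` {f \<in> F. f \<inter> W \<noteq> {}})" by (rule card_image[OF inj, symmetric])
  also have "\<dots> \<le> card W" by (rule card_mono[OF assms(3)]) (use g in auto)
  finally have "card {f \<in> F. f \<inter> W \<noteq> {}} \<le> card W" .
  moreover have "card F = card {f \<in> F. f \<inter> W = {}} + card {f \<in> F. f \<inter> W \<noteq> {}}"
    using finF by (subst card_Un_disjoint[symmetric]) (auto intro!: arg_cong[where f = card])
  ultimately show ?thesis by simp
qed

text \<open>A maximum matching bounds the size of \<open>T\<close> by the quality of the edges found
  so far; being maximal, it leaves no found edge outside \<open>T\<close>. The choice by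
  \<open>SOME\<close> makes \<open>T\<close> a function of the found edges, hence of the
  measurements.\<close>

definition cover :: "nat set set \<Rightarrow> nat set" where
  "cover F = \<Union>(SOME M. M \<subseteq> F \<and> disjoint M \<and> card M = max_matching F)"

lemma cover:
  assumes "F \<subseteq> pairs n"
  shows "cover F \<subseteq> {1..n}" "card (cover F) = 2 * max_matching F" "\<And>f. f \<in> F \<Longrightarrow> f \<inter> cover F \<noteq> {}"
proof -
  have finF: "finite F" using assms finite_subset finite_pairs by blast
  define M where "M = (SOME M. M \<subseteq> F \<and> disjoint M \<and> card M = max_matching F)"
  have M: "M \<subseteq> F" "disjoint M" "card M = max_matching F"
    using someI_ex[of "\<lambda>M. M \<subseteq> F \<and> disjoint M \<and> card M = max_matching F"] max_matching_ex[OF finF]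
    unfolding M_def by metis+
  have c: "cover F = \<Union>M" by (simp add: cover_def M_def)
  show "cover F \<subseteq> {1..n}" using M(1) assms by (auto simp: c pairs_def)
  show "card (cover F) = 2 * max_matching F" using card_Union_matching[of M n] M assms by (auto simp: c)
  show "f \<inter> cover F \<noteq> {}" if f: "f \<in> F" for f
  proof
    assume e: "f \<inter> cover F = {}"
    have "f \<noteq> {}" using f assms by (auto simp: pairs_def)
    then have "f \<notin> M" using e by (auto simp: c)
    moreover have "disjoint (insert f M)"
      using M(2) e unfolding c by (auto simp: disjoint_def)
    ultimately have "Suc (card M) \<le> max_matching F"
      using max_matching_ge[OF finF, of "insert f M"] M(1) f finite_subset[OF M(1) finF] by simp
    then show False using M(3) by simp
  qed
qed

section \<open>The edges proposed by one copy\<close>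

definition candidates :: "nat \<Rightarrow> nat \<Rightarrow> nat \<Rightarrow> 't set \<Rightarrow> nat \<Rightarrow> nat \<Rightarrow> nat \<Rightarrow> real \<Rightarrow>
    ('t \<Rightarrow> nat set set \<times> (nat \<Rightarrow> nat set \<Rightarrow> int)) \<times> (nat \<Rightarrow> nat \<Rightarrow> nat) \<Rightarrow> (nat set \<Rightarrow> int) \<Rightarrow> nat set set" where
  "candidates n p K I C J M lam w x = (let F = found n p K I (fst w) x in
     F \<union> accepted n p C J M lam (cover F) (snd w) x)"

lemma candidates_pairs: "candidates n p K I C J M lam w x \<subseteq> pairs n"
  by (auto simp: candidates_def found_def accepted_def Let_def)

text \<open>The hashings are independent of the probes, so \<open>accepted_sound\<close> applies
  with \<open>T\<close> fixed, whatever the probes were.\<close>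

lemma candidates_sound:
  assumes p: "prime p" and B: "finite B" and AJ: "2 \<le> A" "0 < J" and lam: "0 < lam"
  shows "pr (pair_pmf (probes n p L K \<rho> B s) (hashes n C A J))
      (\<lambda>w. \<exists>e\<in>candidates n p K (B \<times> {..<s}) C J (A * J) lam w x. int p dvd x e)
    \<le> real (card B * s) * (real (n choose 2) * (real p * (1 / real p) ^ K))
      + real (n choose 2) * (3 / lam + 2 / real J + 2 / real (A * J - J)) ^ C"
  unfolding pair_pmf_alt1
proof (rule pr_bind_le_good[where G = "\<lambda>\<omega>. \<not> (\<exists>e\<in>found n p K (B \<times> {..<s}) \<omega> x. int p dvd x e)"])
  fix \<omega> assume G: "\<not> (\<exists>e\<in>found n p K (B \<times> {..<s}) \<omega> x. int p dvd x e)"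
  let ?T = "cover (found n p K (B \<times> {..<s}) \<omega> x)"
  have "pr (map_pmf (Pair \<omega>) (hashes n C A J))
      (\<lambda>w. \<exists>e\<in>candidates n p K (B \<times> {..<s}) C J (A * J) lam w x. int p dvd x e) \<le>
    pr (hashes n C A J) (\<lambda>\<omega>'. \<exists>e\<in>accepted n p C J (A * J) lam ?T \<omega>' x. int p dvd x e)"
    unfolding pr_map by (rule pr_mono) (use G in \<open>auto simp: candidates_def Let_def\<close>)
  also have "\<dots> \<le> real (n choose 2) * (3 / lam + 2 / real J + 2 / real (A * J - J)) ^ C"
    by (rule accepted_sound[OF AJ lam])
  finally show "pr (map_pmf (Pair \<omega>) (hashes n C A J))
      (\<lambda>w. \<exists>e\<in>candidates n p K (B \<times> {..<s}) C J (A * J) lam w x. int p dvd x e) \<le>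
    real (n choose 2) * (3 / lam + 2 / real J + 2 / real (A * J - J)) ^ C" .
next
  show "pr (probes n p L K \<rho> B s) (\<lambda>\<omega>. \<not> \<not> (\<exists>e\<in>found n p K (B \<times> {..<s}) \<omega> x. int p dvd x e))
    \<le> real (card B * s) * (real (n choose 2) * (real p * (1 / real p) ^ K))"
    using found_sound[OF p B, of n L K \<rho> s x] by simp
qed (use lam in simp)

text \<open>The number of sets \<open>T\<close> is at most \<open>exp (2 * y * ln (n + 1))\<close>,
  and \<tau> makes the exponent of a single failure at least twice that; 64 is this 4 times the 16
  of \<open>edge_probe_hit\<close>. By \<open>y \<ge> 1\<close> the surplus is at least
  \<open>ln (n + 1)\<close>.\<close>

lemma found_blocks_log:
  fixes x :: "nat set \<Rightarrow> int"
  assumes p: "prime p" and B: "finite B" "b \<in> B" and \<rho>: "0 \<le> \<rho> b" "\<rho> b \<le> 1"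
    and L: "4 * card (pairs n) \<le> 2 ^ L" and y: "1 \<le> y" and s: "0 < s"
    and \<tau>: "64 * (real L + 1) * y * ln (real n + 1) / real s \<le> \<tau>"
  defines "E \<equiv> {e \<in> pairs n. \<not> int p dvd x e}"
  shows "pr (probes n p L K \<rho> B s) (\<lambda>\<omega>. \<exists>T. T \<subseteq> {1..n} \<and> real (card T) \<le> 2 * y \<and> real (card T) * \<rho> b \<le> 1 / 2 \<and>
      \<tau> \<le> touch {1..n} (\<rho> b) (avoid E T) \<and> (\<forall>f\<in>found n p K (B \<times> {..<s}) \<omega> x. f \<inter> T \<noteq> {}))
    \<le> 1 / (real n + 1)"
proof -
  define t where "t = nat \<lfloor>2 * y\<rfloor>"
  have t: "real k \<le> 2 * y \<Longrightarrow> k \<le> t" for k unfolding t_def by (simp add: le_nat_floor)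
  have t2: "real t \<le> 2 * y" using y by (simp add: t_def)
  have ln0: "0 \<le> ln (real n + 1)" by simp
  have \<tau>0: "0 \<le> \<tau>" by (rule order_trans[OF _ \<tau>]) (use y in simp)
  have "pr (probes n p L K \<rho> B s) (\<lambda>\<omega>. \<exists>T. T \<subseteq> {1..n} \<and> real (card T) \<le> 2 * y \<and> real (card T) * \<rho> b \<le> 1 / 2 \<and>
      \<tau> \<le> touch {1..n} (\<rho> b) (avoid E T) \<and> (\<forall>f\<in>found n p K (B \<times> {..<s}) \<omega> x. f \<inter> T \<noteq> {}))
    \<le> pr (probes n p L K \<rho> B s) (\<lambda>\<omega>. \<exists>T. T \<subseteq> {1..n} \<and> card T \<le> t \<and> real (card T) * \<rho> b \<le> 1 / 2 \<and>
      \<tau> \<le> touch {1..n} (\<rho> b) (avoid E T) \<and> (\<forall>f\<in>found n p K (B \<times> {..<s}) \<omega> x. f \<inter> T \<noteq> {}))"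
    by (rule pr_mono) (use t in blast)
  also have "\<dots> \<le> real ((n + 1) ^ t) * exp (- (real s * \<tau> / (16 * (real L + 1))))"
    unfolding E_def by (rule found_blocks[where x = x and b = b and \<rho> = \<rho>, OF p B \<rho> L \<tau>0])
  also have "real ((n + 1) ^ t) = exp (real t * ln (real n + 1))"
    by (simp add: exp_of_nat_mult add.commute)
  also have "exp (real t * ln (real n + 1)) * exp (- (real s * \<tau> / (16 * (real L + 1)))) =
      exp (real t * ln (real n + 1) - real s * \<tau> / (16 * (real L + 1)))" by (simp add: exp_diff exp_minus divide_inverse)
  also have "\<dots> \<le> exp (- ln (real n + 1))"
  proof -
    have gen: "4 * y * l = \<sigma> * (64 * q * y * l / \<sigma>) / (16 * q)" if "0 < q" "0 < \<sigma>" for l q \<sigma> :: real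
      using that by (simp add: field_simps)
    have "4 * y * ln (real n + 1) = real s * (64 * (real L + 1) * y * ln (real n + 1) / real s) / (16 * (real L + 1))"
      by (rule gen) (use s in auto)
    also have "\<dots> \<le> real s * \<tau> / (16 * (real L + 1))"
      by (intro divide_right_mono mult_left_mono \<tau>) auto
    finally have "4 * y * ln (real n + 1) \<le> real s * \<tau> / (16 * (real L + 1))" .
    moreover have "real t * ln (real n + 1) \<le> 2 * y * ln (real n + 1)" using t2 ln0 by (rule mult_right_mono)
    moreover have "ln (real n + 1) \<le> y * ln (real n + 1)" using mult_right_mono[OF y ln0] by simp
    moreover have "A - S \<le> - l" if "4 * y * l \<le> S" "A \<le> 2 * y * l" "l \<le> y * l" "0 \<le> l" for A S l :: real
      using that by linarith
    ultimately show ?thesis using ln0 unfolding exp_le_cancel_iff by blast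
  qed
  also have "\<dots> = 1 / (real n + 1)" by (simp add: exp_minus divide_inverse)
  finally show ?thesis .
qed

text \<open>The rates serve matching numbers above \<open>n / lam\<close>, between \<open>\<alpha>\<close> and \<open>n / lam\<close>, and up to
  \<open>\<alpha>\<close>, in this order. In the last two cases the probes alone find enough edges.\<close>

lemma candidates_complete:
  fixes x :: "nat set \<Rightarrow> int" and n p :: nat and lam \<alpha> b :: real
  assumes p: "prime p" and L: "4 * card (pairs n) \<le> 2 ^ L"
    and lam: "64 * (64 * (real L + 1) * ln (real n + 1)) \<le> lam" "64 * (real L + 1) \<le> lam" "64 \<le> lam" "b \<le> lam"
    and s: "real n ^ 2 / (\<alpha> ^ 3 * lam) \<le> real s"
    and \<alpha>: "32 \<le> \<alpha>" "\<alpha>\<^sup>2 * lam ^ 10 \<le> real n"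
    and A: "2 \<le> A" "16 * real A \<le> \<alpha>"
    and AJ: "4 * real n / \<alpha> \<le> real (A * J)" "96 * (real n / \<alpha>) * real C \<le> real (A * J)" "real (A * J) \<le> b * (real n / \<alpha>)"
    and J: "2 * lam \<le> real J" and C: "1 \<le> C"
    and \<rho>: "\<rho> 0 = 2 / real (A * J)" "\<rho> (Suc 0) = lam * \<alpha> / (4 * real n)" "\<rho> 2 = 1"
  defines "E \<equiv> {e \<in> pairs n. \<not> int p dvd x e}" and "B \<equiv> {..<3 :: nat}"
  shows "pr (pair_pmf (probes n p L K \<rho> B s) (hashes n C A J))
      (\<lambda>w. real (max_matching (candidates n p K (B \<times> {..<s}) C J (A * J) lam w x)) < real (max_matching E) / \<alpha>)
    \<le> 400 * real C ^ 2 / lam"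
proof -
  let ?P1 = "probes n p L K \<rho> B s" and ?P2 = "hashes n C A J"
  let ?F = "\<lambda>\<omega>. found n p K (B \<times> {..<s}) \<omega> x"
  let ?cand = "\<lambda>w. candidates n p K (B \<times> {..<s}) C J (A * J) lam w x"
  define \<mu> where "\<mu> = max_matching E"
  define y where "y = real \<mu> / \<alpha>"
  define M where "M = real (A * J)"
  have lam0: "0 < lam" using lam by linarith
  have \<alpha>0: "0 < \<alpha>" using \<alpha> by linarith
  have lam10: "lam ^ 10 \<ge> 1" by (rule one_le_power) (use lam in linarith)
  have lamk: "lam ^ i \<le> lam ^ j" if "i \<le> j" for i j by (rule power_increasing[OF that]) (use lam in linarith)
  have \<alpha>2: "1024 \<le> \<alpha>\<^sup>2" using power_mono[OF \<alpha>(1), of 2] by simp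
  have n0: "0 < real n"
  proof -
    have "0 < \<alpha>\<^sup>2 * lam ^ 10" using \<alpha>0 lam0 by simp
    then show ?thesis using \<alpha>(2) by linarith
  qed
  have lamn: "lam \<le> real n"
  proof -
    have "1 * lam ^ 1 \<le> \<alpha>\<^sup>2 * lam ^ 10" using \<alpha>2 by (intro mult_mono lamk) (use lam0 in auto)
    then show ?thesis using \<alpha>(2) by simp
  qed
  have sl: "lam ^ 2 \<le> real s"
  proof -
    have "\<alpha> ^ 3 * lam ^ 3 \<le> \<alpha> ^ 4 * lam ^ 20"
      by (intro mult_mono power_increasing lamk) (use \<alpha> lam0 in auto)
    also have "\<dots> = (\<alpha>\<^sup>2 * lam ^ 10)\<^sup>2" by (simp add: power_mult_distrib flip: power_mult)
    also have "\<dots> \<le> real n ^ 2" by (rule power_mono[OF \<alpha>(2)]) (use lam0 in simp)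
    finally have "lam ^ 2 * (\<alpha> ^ 3 * lam) \<le> real n ^ 2" by (simp add: power2_eq_square power3_eq_cube mult_ac)
    then have "lam ^ 2 \<le> real n ^ 2 / (\<alpha> ^ 3 * lam)" using \<alpha>0 lam0 by (simp add: pos_le_divide_eq)
    then show ?thesis using s by linarith
  qed
  then have s0: "0 < s" using lam0 by (metis of_nat_0_less_iff less_le_trans zero_less_power)
  have EV: "E \<subseteq> pairs n" by (auto simp: E_def)
  have finE: "finite E" using EV finite_subset finite_pairs by blast
  have FV: "?F \<omega> \<subseteq> pairs n" for \<omega> by (auto simp: found_def)
  have fincand: "finite (?cand w)" for w using candidates_pairs finite_subset finite_pairs by metis
  have Fcand: "max_matching (?F (fst w)) \<le> max_matching (?cand w)" for w
    by (rule max_matching_mono[OF fincand]) (auto simp: candidates_def Let_def)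
  have \<mu>n: "real \<mu> \<le> real n / 2" using max_matching_le[OF EV] by (simp add: \<mu>_def)
  have B: "finite B" by (simp add: B_def)
  have C2: "1 \<le> real C ^ 2" using C by simp
  have goal1: "1 / lam \<le> 400 * real C ^ 2 / lam" using C2 lam0 by (intro divide_right_mono) auto
  have first: "pr (pair_pmf ?P1 ?P2) (\<lambda>w. real (max_matching (?cand w)) < y) \<le>
      pr ?P1 (\<lambda>\<omega>. real (max_matching (?F \<omega>)) < y)"
  proof -
    have "pr (pair_pmf ?P1 ?P2) (\<lambda>w. real (max_matching (?cand w)) < y) \<le>
        pr (pair_pmf ?P1 ?P2) (\<lambda>w. real (max_matching (?F (fst w))) < y)"
    proof (rule pr_mono)
      fix w assume "real (max_matching (?cand w)) < y"
      then show "real (max_matching (?F (fst w))) < y" using Fcand[of w] by linarith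
    qed
    also have "\<dots> = pr ?P1 (\<lambda>\<omega>. real (max_matching (?F \<omega>)) < y)"
      by (rule pr_pair_fst[where P = "\<lambda>\<omega>. real (max_matching (?F \<omega>)) < y"])
    finally show ?thesis .
  qed
  have cov: "cover (?F \<omega>) \<subseteq> {1..n}" "real (card (cover (?F \<omega>))) \<le> 2 * y" "\<forall>f\<in>?F \<omega>. f \<inter> cover (?F \<omega>) \<noteq> {}"
    if "real (max_matching (?F \<omega>)) < y" for \<omega>
    using cover[OF FV[of \<omega>]] that by auto
  have M0: "0 < M"
  proof -
    have "0 < 4 * real n / \<alpha>" using n0 \<alpha>0 by simp
    then show ?thesis using AJ(1) by (simp only: M_def)
  qed
  have inv_n: "1 / (real n + 1) \<le> 1 / lam" using lamn lam0 by (intro divide_left_mono) auto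
  have removed: "real \<mu> - 2 * y \<le> real (card {f \<in> Fm. f \<inter> T = {}})"
    if "Fm \<subseteq> E" "disjoint Fm" "card Fm = \<mu>" "T \<subseteq> {1..n}" "real (card T) \<le> 2 * y" for Fm T
  proof -
    have "Fm \<subseteq> pairs n" using that EV by blast
    from matching_avoiding[OF this that(2), of T] that finite_subset[OF that(4)] show ?thesis by auto
  qed
  have y_small: "2 * y \<le> real \<mu> / 16"
    using \<alpha> by (simp add: y_def divide_le_eq mult_mono field_simps) (metis mult.commute mult_left_mono of_nat_0_le_iff)
  obtain Fm where Fm: "Fm \<subseteq> E" "disjoint Fm" "card Fm = \<mu>" using max_matching_ex[OF finE] unfolding \<mu>_def by metis
  consider (zero) "\<mu> = 0" | (small) "0 < \<mu>" "y \<le> 1" | (mid) "1 < y" "real \<mu> \<le> real n / lam" | (large) "1 < y" "real n / lam < real \<mu>"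
    by linarith
  then have "pr (pair_pmf ?P1 ?P2) (\<lambda>w. real (max_matching (?cand w)) < y) \<le> 400 * real C ^ 2 / lam"
  proof cases
    case zero
    then have "pr (pair_pmf ?P1 ?P2) (\<lambda>w. real (max_matching (?cand w)) < y) = 0" by (simp add: y_def)
    then show ?thesis using C2 lam0 by simp
  next
    case small
    have "E \<noteq> {}"
    proof
      assume "E = {}"
      then show False using Fm small by simp
    qed
    then obtain f where f: "f \<in> E" by blast
    \<comment> \<open>With rate 1 every vertex is sampled, so one edge is enough. As
      \<open>y \<le> 1\<close>, failure means that no edge was found at all and \<open>T\<close> is
      empty.\<close>
    have t1: "1 \<le> touch {1..n} (\<rho> 2) (avoid E {})"
    proof -
      have "1 = pr (Pi_pmf {1..n} False (\<lambda>_. bernoulli_pmf (\<rho> 2))) (\<lambda>S. \<forall>v\<in>f. S v)"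
        using f EV by (subst pr_Pi_bernoulli_all) (auto simp: pairs_def \<rho>)
      also have "\<dots> \<le> touch {1..n} (\<rho> 2) (avoid E {})"
        unfolding touch_def by (rule pr_mono) (use f in \<open>auto simp: avoid_def\<close>)
      finally show ?thesis .
    qed
    have "pr ?P1 (\<lambda>\<omega>. real (max_matching (?F \<omega>)) < y) \<le>
      pr ?P1 (\<lambda>\<omega>. \<exists>T. T \<subseteq> {1..n} \<and> card T \<le> 0 \<and> real (card T) * \<rho> 2 \<le> 1 / 2 \<and>
        1 \<le> touch {1..n} (\<rho> 2) (avoid E T) \<and> (\<forall>f\<in>?F \<omega>. f \<inter> T \<noteq> {}))"
    proof (rule pr_mono)
      fix \<omega> assume "real (max_matching (?F \<omega>)) < y"
      then have "max_matching (?F \<omega>) = 0" using small by linarith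
      then have "card (cover (?F \<omega>)) = 0" using cover(2)[OF FV] by simp
      then have "cover (?F \<omega>) = {}" using finite_subset[OF cover(1)[OF FV[of \<omega>]]] by simp
      then have "?F \<omega> = {}" using cover(3)[OF FV[of \<omega>]] by auto
      then show "\<exists>T. T \<subseteq> {1..n} \<and> card T \<le> 0 \<and> real (card T) * \<rho> 2 \<le> 1 / 2 \<and>
        1 \<le> touch {1..n} (\<rho> 2) (avoid E T) \<and> (\<forall>f\<in>?F \<omega>. f \<inter> T \<noteq> {})"
        using t1 by (intro exI[of _ "{}"]) simp
    qed
    also have "\<dots> \<le> real ((n + 1) ^ 0) * exp (- (real s * 1 / (16 * (real L + 1))))"
      unfolding E_def by (rule found_blocks[where x = x and b = 2 and \<rho> = \<rho>, OF p B _ _ _ L]) (auto simp: \<rho> B_def)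
    also have "\<dots> \<le> exp (- lam)"
    proof -
      have "lam * (16 * (real L + 1)) \<le> lam * lam" using lam lam0 by (intro mult_left_mono) auto
      also have "\<dots> \<le> real s" using sl by (simp add: power2_eq_square)
      finally have "lam \<le> real s / (16 * (real L + 1))" by (simp add: pos_le_divide_eq)
      then show ?thesis by simp
    qed
    also have "\<dots> \<le> 1 / lam"
    proof -
      have "lam \<le> exp lam" using exp_ge_add_one_self[of lam] by linarith
      then show ?thesis using lam0 by (simp add: exp_minus divide_inverse le_imp_inverse_le)
    qed
    finally show ?thesis using first goal1 by linarith
  next
    case mid
    \<comment> \<open>At least \<open>\<mu> / 2\<close> edges of \<open>Fm\<close> avoid
      \<open>T\<close>, and \<open>touch_matching\<close> turns them into this bound. The rate is
      chosen such that it reaches what the \<open>s\<close> probes detect while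
      \<open>\<mu> \<le> n / lam\<close> still lets them miss \<open>T\<close>.\<close>
    define \<tau> where "\<tau> = real \<mu> * (\<rho> (Suc 0))\<^sup>2 / 4"
    have \<rho>10: "0 \<le> \<rho> (Suc 0)" using lam0 \<alpha>0 n0 by (simp add: \<rho>)
    have la: "lam * \<alpha>\<^sup>2 \<le> real n"
    proof -
      have "\<alpha>\<^sup>2 * lam ^ 1 \<le> \<alpha>\<^sup>2 * lam ^ 10" by (intro mult_left_mono lamk) auto
      then show ?thesis using \<alpha>(2) by (simp add: mult.commute)
    qed
    have la1: "lam * \<alpha> * 2 \<le> real n"
    proof -
      have "lam * (\<alpha> * 2) \<le> lam * (\<alpha> * \<alpha>)" using \<alpha> lam0 by (intro mult_left_mono) auto
      then show ?thesis using la by (simp add: power2_eq_square)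
    qed
    have \<rho>11: "\<rho> (Suc 0) \<le> 1 / 8" unfolding \<rho> using la1 n0 by (simp add: field_simps)
    have \<rho>sq: "(\<rho> (Suc 0))\<^sup>2 = lam\<^sup>2 * \<alpha>\<^sup>2 / (16 * real n ^ 2)"
      by (simp add: \<rho> power_divide power_mult_distrib)
    have \<mu>\<rho>: "real \<mu> * (\<rho> (Suc 0))\<^sup>2 \<le> 1 / 2"
    proof -
      have "real \<mu> * (\<rho> (Suc 0))\<^sup>2 \<le> real n / lam * (lam\<^sup>2 * \<alpha>\<^sup>2 / (16 * real n ^ 2))"
        unfolding \<rho>sq by (rule mult_right_mono[OF mid(2)]) simp
      also have "\<dots> = (lam * \<alpha>\<^sup>2) / real n / 16" using n0 lam0 by (simp add: field_simps power2_eq_square)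
      also have "\<dots> \<le> 1 / 2"
      proof -
        have "(lam * \<alpha>\<^sup>2) / real n \<le> 1" using la n0 by (simp add: divide_le_eq)
        moreover have "q / 16 \<le> 1 / 2" if "q \<le> 1" for q :: real using that by simp
        ultimately show ?thesis by blast
      qed
      finally show ?thesis .
    qed
    have \<tau>: "64 * (real L + 1) * y * ln (real n + 1) / real s \<le> \<tau>"
    proof -
      have "64 * (real L + 1) * y * ln (real n + 1) / real s \<le>
          64 * (real L + 1) * y * ln (real n + 1) / (real n ^ 2 / (\<alpha> ^ 3 * lam))"
        using s mid n0 \<alpha>0 lam0 s0 by (intro divide_left_mono mult_nonneg_nonneg mult_pos_pos) auto
      also have "\<dots> = (64 * (real L + 1) * ln (real n + 1)) * (y * (\<alpha> ^ 3 * lam) / real n ^ 2)"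
        using n0 by (simp add: field_simps)
      also have "\<dots> \<le> (lam / 64) * (y * (\<alpha> ^ 3 * lam) / real n ^ 2)"
        using lam(1) mid \<alpha>0 lam0 n0 by (intro mult_right_mono) auto
      also have "\<dots> = \<tau>"
        unfolding \<tau>_def \<rho>sq y_def using \<alpha>0 n0 by (simp add: field_simps power2_eq_square power3_eq_cube)
      finally show ?thesis .
    qed
    have "pr ?P1 (\<lambda>\<omega>. real (max_matching (?F \<omega>)) < y) \<le>
      pr ?P1 (\<lambda>\<omega>. \<exists>T. T \<subseteq> {1..n} \<and> real (card T) \<le> 2 * y \<and> real (card T) * \<rho> (Suc 0) \<le> 1 / 2 \<and>
        \<tau> \<le> touch {1..n} (\<rho> (Suc 0)) (avoid E T) \<and> (\<forall>f\<in>?F \<omega>. f \<inter> T \<noteq> {}))"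
    proof (rule pr_mono)
      fix \<omega> assume lt: "real (max_matching (?F \<omega>)) < y"
      let ?T = "cover (?F \<omega>)" and ?Z = "{f \<in> Fm. f \<inter> cover (?F \<omega>) = {}}"
      have "real (card ?T) * \<rho> (Suc 0) \<le> 2 * y * \<rho> (Suc 0)" using cov(2)[OF lt] \<rho>10 by (rule mult_right_mono)
      also have "\<dots> = real \<mu> * lam / (2 * real n)" using \<alpha>0 by (simp add: y_def \<rho>)
      also have "\<dots> \<le> 1 / 2" using mid(2) lam0 n0 by (simp add: field_simps)
      finally have T\<rho>: "real (card ?T) * \<rho> (Suc 0) \<le> 1 / 2" .
      have Z: "real \<mu> / 2 \<le> real (card ?Z)" "card ?Z \<le> \<mu>"
      proof -
        show "real \<mu> / 2 \<le> real (card ?Z)" using removed[OF Fm cov(1,2)[OF lt]] y_small by linarith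
        show "card ?Z \<le> \<mu>" unfolding Fm(3)[symmetric] using Fm(1) finE finite_subset by (intro card_mono) auto
      qed
      have "\<tau> \<le> real (card ?Z) * (\<rho> (Suc 0))\<^sup>2 / 2"
        unfolding \<tau>_def using mult_right_mono[OF Z(1), of "(\<rho> (Suc 0))\<^sup>2"] by simp
      also have "\<dots> \<le> touch {1..n} (\<rho> (Suc 0)) (avoid E ?T)"
      proof (rule touch_matching)
        show "avoid E ?T \<subseteq> pairs n" using EV by (auto simp: avoid_def)
        show "disjoint ?Z" using Fm(2) by (auto simp: disjoint_def)
        show "?Z \<subseteq> avoid E ?T" using Fm(1) by (auto simp: avoid_def)
        have "real (card ?Z) * (\<rho> (Suc 0))\<^sup>2 \<le> real \<mu> * (\<rho> (Suc 0))\<^sup>2" using Z(2) by (intro mult_right_mono) auto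
        then show "real (card ?Z) * (\<rho> (Suc 0))\<^sup>2 \<le> 1 / 2" using \<mu>\<rho> by linarith
      qed (use \<rho>10 \<rho>11 in auto)
      finally show "\<exists>T. T \<subseteq> {1..n} \<and> real (card T) \<le> 2 * y \<and> real (card T) * \<rho> (Suc 0) \<le> 1 / 2 \<and>
        \<tau> \<le> touch {1..n} (\<rho> (Suc 0)) (avoid E T) \<and> (\<forall>f\<in>?F \<omega>. f \<inter> T \<noteq> {})"
        using cov[OF lt] T\<rho> by blast
    qed
    also have "\<dots> \<le> 1 / (real n + 1)"
      unfolding E_def by (rule found_blocks_log[where x = x and b = "Suc 0" and \<rho> = \<rho>, OF p B _ _ _ L _ s0 \<tau>]) (use \<rho>10 \<rho>11 mid in \<open>auto simp: B_def\<close>)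
    finally show ?thesis using first goal1 inv_n by linarith
  next
    case large
    \<comment> \<open>Above \<tau> the probes would find an edge outside \<open>T\<close>. The
      degree \<open>d\<close> is at most \<open>M / lam\<close> squared, so that the error
      \<open>lam * d / M\<close> in \<open>accepted_complete\<close> is at most
      \<open>1 / lam\<close>. Then \<open>h\<close> is large enough that \<open>h\<close> vertices
      of degree \<open>d\<close> would force a touch probability of \<tau>, and small compared with
      \<mu>.\<close>
    define \<tau> where "\<tau> = \<alpha>\<^sup>2 * lam\<^sup>2 / real n"
    define d where "d = nat \<lfloor>M / lam\<^sup>2\<rfloor>"
    define h where "h = nat \<lceil>2 * lam ^ 5 * \<alpha>\<rceil>"
    have an: "\<alpha>\<^sup>2 * lam ^ i \<le> real n" if "i \<le> 10" for i
      using \<alpha>(2) mult_left_mono[OF lamk[OF that], of "\<alpha>\<^sup>2"] by simp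
    have M4: "4 * real n / \<alpha> \<le> M" using AJ(1) by (simp only: M_def)
    have Mb: "M \<le> lam * (real n / \<alpha>)"
    proof -
      have "M \<le> b * (real n / \<alpha>)" using AJ(3) by (simp only: M_def)
      also have "\<dots> \<le> lam * (real n / \<alpha>)" using lam(4) n0 \<alpha>0 by (intro mult_right_mono) auto
      finally show ?thesis .
    qed
    have \<rho>0: "\<rho> 0 = 2 / M" unfolding \<rho> M_def ..
    have M2: "2 * lam\<^sup>2 \<le> M"
    proof -
      have "\<alpha> * lam\<^sup>2 * \<alpha> \<le> real n" using an[of 2] by (simp add: power2_eq_square mult_ac)
      then have "\<alpha> * lam\<^sup>2 \<le> real n / \<alpha>" using \<alpha>0 by (simp add: pos_le_divide_eq)
      moreover have "2 * lam\<^sup>2 \<le> \<alpha> * lam\<^sup>2" using \<alpha> by (intro mult_right_mono) auto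
      moreover have "real n / \<alpha> \<le> 4 * real n / \<alpha>" using n0 \<alpha>0 by (intro divide_right_mono) auto
      ultimately show ?thesis using M4 by linarith
    qed
    have Ml2: "2 \<le> M / lam\<^sup>2" using M2 lam0 by (simp add: pos_le_divide_eq)
    have d: "real d \<le> M / lam\<^sup>2" "M / lam\<^sup>2 / 2 \<le> real d"
  proof -
      have "real (nat \<lfloor>q\<rfloor>) \<le> q \<and> q / 2 \<le> real (nat \<lfloor>q\<rfloor>)" if "2 \<le> q" for q :: real using that by linarith
      from this[OF Ml2, folded d_def] show "real d \<le> M / lam\<^sup>2" "M / lam\<^sup>2 / 2 \<le> real d" by blast+
    qed
    have h: "2 * lam ^ 5 * \<alpha> \<le> real h" "real h \<le> 3 * lam ^ 5 * \<alpha>"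
    proof -
      have "1 \<le> lam ^ 5 * \<alpha>" using mult_mono[of 1 "lam ^ 5" 1 \<alpha>] lamk[of 0 5] \<alpha> lam0 by simp
      then show "2 * lam ^ 5 * \<alpha> \<le> real h" "real h \<le> 3 * lam ^ 5 * \<alpha>" unfolding h_def by linarith+
    qed
    have \<tau>0: "0 \<le> \<tau>" using n0 by (simp add: \<tau>_def)
    have \<tau>log: "64 * (real L + 1) * y * ln (real n + 1) / real s \<le> \<tau>"
    proof -
      have "64 * (real L + 1) * y * ln (real n + 1) / real s \<le>
          64 * (real L + 1) * y * ln (real n + 1) / (real n ^ 2 / (\<alpha> ^ 3 * lam))"
        using s large n0 \<alpha>0 lam0 s0 by (intro divide_left_mono mult_nonneg_nonneg mult_pos_pos) auto
      also have "\<dots> = (64 * (real L + 1) * ln (real n + 1)) * (y * (\<alpha> ^ 3 * lam) / real n ^ 2)"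
        using n0 by (simp add: field_simps)
      also have "\<dots> \<le> lam * (y * (\<alpha> ^ 3 * lam) / real n ^ 2)"
        using lam(1) lam0 large \<alpha>0 n0 by (intro mult_right_mono) auto
      also have "\<dots> = real \<mu> * (\<alpha>\<^sup>2 * lam\<^sup>2) / real n ^ 2"
        unfolding y_def using \<alpha>0 n0 by (simp add: field_simps power2_eq_square power3_eq_cube)
      also have "\<dots> \<le> real n * (\<alpha>\<^sup>2 * lam\<^sup>2) / real n ^ 2"
        using \<mu>n by (intro divide_right_mono mult_right_mono) auto
      also have "\<dots> = \<tau>" using n0 by (simp add: \<tau>_def power2_eq_square)
      finally show ?thesis .
    qed
    have \<tau>hd: "\<tau> \<le> real h * real d * (\<rho> 0)\<^sup>2 / 4"
    proof -
      have "\<tau> = (lam\<^sup>2 * \<alpha>) * \<alpha> / real n" by (simp add: \<tau>_def power2_eq_square mult_ac)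
      also have "\<dots> \<le> (lam\<^sup>2 * \<alpha>) * (lam / M)"
      proof -
        have "\<alpha> / real n \<le> lam / M" using Mb M0 n0 \<alpha>0 by (simp add: field_simps)
        then show ?thesis using \<alpha>0 mult_left_mono[of "\<alpha> / real n" "lam / M" "lam\<^sup>2 * \<alpha>"] by simp
      qed
      also have "\<dots> = (2 * lam ^ 5 * \<alpha>) * (M / lam\<^sup>2 / 2) / M\<^sup>2"
        using M0 lam0 by (simp add: field_simps power2_eq_square power3_eq_cube eval_nat_numeral)
      also have "\<dots> \<le> real h * real d / M\<^sup>2"
        using h d \<alpha>0 lam0 M0 by (intro divide_right_mono mult_mono) auto
      also have "\<dots> = real h * real d * (\<rho> 0)\<^sup>2 / 4" by (simp add: \<rho>0 power_divide)
      finally show ?thesis .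
    qed
    have \<rho>00: "0 \<le> \<rho> 0" using M0 by (simp add: \<rho>0)
    have "64 * 64 \<le> lam * lam" using lam by (intro mult_mono) auto
    then have lamsq: "4096 \<le> lam\<^sup>2" by (simp add: power2_eq_square)
    then have l2: "lam ^ i * 4096 \<le> lam ^ (i + 2)" for i
      unfolding power_add using lamsq lam0 by (intro mult_left_mono) auto
    have d\<rho>: "real d * \<rho> 0 \<le> 1 / 16"
    proof -
      have "real d * \<rho> 0 \<le> M / lam\<^sup>2 * \<rho> 0" by (rule mult_right_mono[OF d(1) \<rho>00])
      also have "\<dots> = 2 / lam\<^sup>2" using M0 by (simp add: \<rho>0)
      also have "\<dots> \<le> 1 / 16" using lamsq by (simp add: divide_le_eq)
      finally show ?thesis .
    qed
    have M41: "1 / M \<le> \<alpha> / (4 * real n)" using M4 M0 n0 \<alpha>0 by (simp add: field_simps)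
    have h\<rho>: "real h * \<rho> 0 \<le> 1 / 16"
    proof -
      have "real h * \<rho> 0 = 2 * real h * (1 / M)" by (simp add: \<rho>0)
      also have "\<dots> \<le> 2 * (3 * lam ^ 5 * \<alpha>) * (\<alpha> / (4 * real n))"
        using h M41 M0 \<alpha>0 lam0 by (intro mult_mono) auto
      also have "\<dots> = (\<alpha>\<^sup>2 * lam ^ 5 * 24) / real n / 16" by (simp add: power2_eq_square)
      also have "\<dots> \<le> 1 / 16"
      proof -
        have "\<alpha>\<^sup>2 * lam ^ 5 * 24 \<le> \<alpha>\<^sup>2 * (lam ^ 5 * 4096)" using lam0 by simp
        also have "\<dots> \<le> \<alpha>\<^sup>2 * lam ^ 7" using l2[of 5] by (intro mult_left_mono) auto
        also have "\<dots> \<le> real n" by (rule an) simp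
        finally show ?thesis using n0 by (simp add: divide_le_eq)
      qed
      finally show ?thesis .
    qed
    have \<rho>01: "\<rho> 0 \<le> 1"
    proof -
      have "2 * 1 \<le> 2 * lam\<^sup>2" using lamsq by simp
      then have "2 \<le> M" using M2 by linarith
      then show ?thesis by (simp add: \<rho>0)
    qed
    have h\<mu>: "real h \<le> real \<mu> / 16"
    proof -
      have "(3 * lam ^ 5 * \<alpha>) * (16 * lam) = (lam ^ 6 * 48) * \<alpha>" by (simp add: eval_nat_numeral)
      also have "\<dots> \<le> lam ^ 8 * \<alpha>\<^sup>2"
      proof (rule mult_mono)
        have "lam ^ 6 * 48 \<le> lam ^ 6 * 4096" using lam0 by simp
        moreover have "lam ^ 6 * 4096 \<le> lam ^ 8" using l2[of 6] by simp
        ultimately show "lam ^ 6 * 48 \<le> lam ^ 8" by (rule order_trans)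
        show "\<alpha> \<le> \<alpha>\<^sup>2" using \<alpha> by (simp add: power2_eq_square)
      qed (use lam0 \<alpha>0 in auto)
      also have "\<dots> \<le> real n" using an[of 8] by (simp add: mult.commute)
      finally have "3 * lam ^ 5 * \<alpha> \<le> real n / (16 * lam)" using lam0 by (simp add: pos_le_divide_eq)
      also have "\<dots> = real n / lam / 16" by simp
      finally have a: "3 * lam ^ 5 * \<alpha> \<le> real n / lam / 16" .
      have "h' \<le> m / 16" if "a \<le> u / 16" "h' \<le> a" "u < m" for a u h' m :: real using that by linarith
      from this[OF a h(2) large(2)] show ?thesis .
    qed
    define bad1 where "bad1 \<omega> = (\<exists>T. T \<subseteq> {1..n} \<and> real (card T) \<le> 2 * y \<and> real (card T) * \<rho> 0 \<le> 1 / 2 \<and>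
        \<tau> \<le> touch {1..n} (\<rho> 0) (avoid E T) \<and> (\<forall>f\<in>?F \<omega>. f \<inter> T \<noteq> {}))" for \<omega>
    have "pr ?P1 (\<lambda>\<omega>. \<not> \<not> bad1 \<omega>) \<le> 1 / (real n + 1)"
      unfolding bad1_def not_not E_def
      by (rule found_blocks_log[where x = x and b = 0 and \<rho> = \<rho>, OF p B _ _ _ L _ s0 \<tau>log]) (use \<rho>00 \<rho>01 large in \<open>auto simp: B_def\<close>)
    then have bad1: "pr ?P1 (\<lambda>\<omega>. \<not> \<not> bad1 \<omega>) \<le> 1 / lam" using inv_n by linarith
    have second: "pr ?P2 (\<lambda>\<omega>'. real (max_matching (?cand (\<omega>, \<omega>'))) < y) \<le> 399 * real C ^ 2 / lam"
      if good: "\<not> bad1 \<omega>" for \<omega>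
    proof (cases "real (max_matching (?F \<omega>)) < y")
      case False
      then have "\<not> real (max_matching (?cand (\<omega>, \<omega>'))) < y" for \<omega>' using Fcand[of "(\<omega>, \<omega>')"] by simp
      then show ?thesis using C2 lam0 by simp
    next
      case lt: True
      let ?T = "cover (?F \<omega>)"
      define G where "G = avoid E ?T"
      have GV: "G \<subseteq> pairs n" using EV by (auto simp: G_def avoid_def)
      define H where "H = {v \<in> {1..n}. d \<le> degree_in G v}"
      \<comment> \<open>Removing \<open>T\<close> costs at most
        \<open>2 * y \<le> \<mu> / 16\<close> edges and removing \<open>H\<close> fewer than
        \<open>h \<le> \<mu> / 16\<close>, so at least half of the maximum matching remains.\<close>
      define Ms where "Ms = {f \<in> Fm. f \<inter> (?T \<union> H) = {}}"
      have T\<rho>: "real (card ?T) * \<rho> 0 \<le> 1 / 2"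
      proof -
        have "2 * y \<le> real n / \<alpha>" using \<mu>n \<alpha>0 by (simp add: y_def divide_right_mono)
        then have "real (card ?T) * \<rho> 0 \<le> real n / \<alpha> * (2 * (\<alpha> / (4 * real n)))"
          using cov(2)[OF lt] M41 M0 n0 \<alpha>0 unfolding \<rho>0 by (intro mult_mono) auto
        also have "\<dots> = 1 / 2" using n0 \<alpha>0 by simp
        finally show ?thesis .
      qed
      have touch: "touch {1..n} (\<rho> 0) G < \<tau>"
        using good cov[OF lt] T\<rho> unfolding bad1_def G_def by (meson not_le)
      have H: "card H < h"
        unfolding H_def by (rule high_degree_few[OF GV d\<rho> h\<rho> \<rho>00 \<rho>01]) (use touch \<tau>hd in linarith)
      have Fmp: "Fm \<subseteq> pairs n" using Fm(1) EV by blast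
      have finTH: "finite (?T \<union> H)" using cov(1)[OF lt] finite_subset by (auto simp: H_def)
      have "\<mu> \<le> card Ms + card (?T \<union> H)"
        using matching_avoiding[OF Fmp Fm(2) finTH] Fm(3) by (simp add: Ms_def)
      also have "\<dots> \<le> card Ms + (card ?T + card H)" by (intro add_left_mono card_Un_le)
      finally have "real \<mu> \<le> real (card Ms) + (real (card ?T) + real (card H))"
        by (simp only: of_nat_add[symmetric] of_nat_le_iff)
      then have Ms: "real \<mu> / 2 \<le> real (card Ms)"
        using cov(2)[OF lt] y_small h\<mu> H by linarith
      have "0 < real n / lam" using n0 lam0 by simp
      then have \<mu>pos: "0 < real \<mu>" using large(2) by (rule less_trans)
      have MsG: "Ms \<subseteq> G" using Fm(1) by (auto simp: Ms_def G_def avoid_def)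
      have deg: "real (degree_in G v) \<le> M / lam\<^sup>2" if "v \<in> \<Union>Ms" for v
      proof -
        obtain f where f: "f \<in> Ms" "v \<in> f" using \<open>v \<in> \<Union>Ms\<close> by blast
        then have "f \<in> pairs n" using MsG GV by blast
        then have "v \<in> {1..n}" "v \<notin> H" using f by (auto simp: Ms_def pairs_def)
        then have "degree_in G v \<le> d" by (auto simp: H_def)
        then show ?thesis using d(1) by linarith
      qed
      have t: "real (card ?T) \<le> real n / \<alpha>"
        using cov(2)[OF lt] \<mu>n \<alpha>0 by (auto simp: y_def divide_right_mono intro: order_trans)
      have disM: "disjoint Ms" using Fm(2) by (auto simp: Ms_def disjoint_def)
      have Mpos: "0 < real (card Ms)" using Ms \<mu>pos by linarith
      have AJJ: "2 * lam \<le> real (A * J - J)"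
      proof -
        have "2 * J \<le> A * J" using A by simp
        then have "J \<le> A * J - J" by linarith
        then have "real J \<le> real (A * J - J)" by (rule of_nat_mono)
        then show ?thesis using J by linarith
      qed
      have t0: "0 < real n / \<alpha>" using n0 \<alpha>0 by simp
      have "pr ?P2 (\<lambda>\<omega>'. real (max_matching (?cand (\<omega>, \<omega>'))) < y) \<le>
        pr ?P2 (\<lambda>\<omega>'. real (card (accepted n p C J (A * J) lam ?T \<omega>' x \<inter> Ms)) \<le> real (card Ms) / (4 * real A))"
      proof (rule pr_mono)
        fix \<omega>' assume less: "real (max_matching (?cand (\<omega>, \<omega>'))) < y"
        have "card (accepted n p C J (A * J) lam ?T \<omega>' x \<inter> Ms) \<le> max_matching (?cand (\<omega>, \<omega>'))"
          by (rule max_matching_ge[OF fincand]) (use disM in \<open>auto simp: candidates_def Let_def disjoint_def\<close>)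
        then have "real (card (accepted n p C J (A * J) lam ?T \<omega>' x \<inter> Ms)) < y" using less by linarith
        also have "y \<le> real (card Ms) / (4 * real A)"
        proof -
          \<comment> \<open>Here \<open>16 * A \<le> \<alpha>\<close> enters: the surviving fraction
            \<open>1 / (4 * A)\<close> of half a maximum matching exceeds the required fraction
            \<open>1 / \<alpha>\<close>.\<close>
          have "y * (4 * real A) \<le> y * (\<alpha> / 4)" using A large by (intro mult_left_mono) auto
          also have "\<dots> = real \<mu> / 4" using \<alpha>0 by (simp add: y_def)
          also have "\<dots> \<le> real (card Ms)" using Ms \<mu>pos by linarith
          finally show ?thesis using A by (simp add: pos_le_divide_eq)
        qed
        finally show "real (card (accepted n p C J (A * J) lam ?T \<omega>' x \<inter> Ms)) \<le> real (card Ms) / (4 * real A)" by simp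
      qed
      also have "\<dots> \<le> 4 * real A / real (card Ms) + real C * (real A / (real n / \<alpha>) + 16 * real A * real C / real (card Ms)
       + 96 * real C * lam * (\<tau> + (M / lam\<^sup>2) / real (A * J)) + lam * \<tau>)"
        by (rule accepted_complete[OF cov(1)[OF lt] t t0, where x = x and p = p, folded E_def, folded G_def, OF MsG disM _ deg _ A(1) _ J AJJ C])
          (use Mpos touch lam AJ(2) in \<open>auto simp: \<rho>(1)[symmetric] simp del: of_nat_mult\<close>)
      also have "\<dots> \<le> 4 * (1 / lam) + real C * (1 / lam + 16 * real C * (1 / lam)
       + 96 * real C * (1 / lam + 1 / lam) + 1 / lam)"
      proof -
        have Am: "real A / real (card Ms) \<le> 1 / lam"
        proof -
          have "real A * lam \<le> \<alpha> / 16 * lam" using A lam0 by (intro mult_right_mono) auto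
          also have "\<dots> \<le> real n / lam / 2"
          proof -
            have "\<alpha> * lam\<^sup>2 \<le> \<alpha>\<^sup>2 * lam\<^sup>2" using \<alpha> by (intro mult_right_mono) (auto simp: power2_eq_square)
            then have "\<alpha> * lam\<^sup>2 \<le> real n" using an[of 2] by simp
            then show ?thesis using lam0 n0 by (simp add: field_simps power2_eq_square)
          qed
          also have "\<dots> \<le> real \<mu> / 2" using large(2) by (intro divide_right_mono) auto
          also note Ms
          finally show ?thesis using Mpos lam0 by (simp add: field_simps)
        qed
        have At: "real A / (real n / \<alpha>) \<le> 1 / lam"
        proof -
          have "real A * \<alpha> * lam \<le> \<alpha> * \<alpha> * lam" using A \<alpha>0 lam0 by (intro mult_right_mono) auto
          also have "\<dots> \<le> real n" using an[of 1] by (simp add: power2_eq_square)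
          finally show ?thesis using n0 \<alpha>0 lam0 by (simp add: field_simps)
        qed
        have lt: "lam * \<tau> \<le> 1 / lam"
        proof -
          have "lam * \<tau> = \<alpha>\<^sup>2 * lam ^ 4 / real n / lam"
            using lam0 by (simp add: \<tau>_def eval_nat_numeral)
          also have "\<dots> \<le> 1 / lam" using an[of 4] n0 lam0 by (intro divide_right_mono) (auto simp: divide_le_eq)
          finally show ?thesis .
        qed
        have lM: "lam * ((M / lam\<^sup>2) / real (A * J)) = 1 / lam"
          unfolding M_def[symmetric] using M0 lam0 by (simp add: power2_eq_square)
        have e1: "4 * real A / real (card Ms) = 4 * (real A / real (card Ms))"
          and e2: "16 * real A * real C / real (card Ms) = 16 * real C * (real A / real (card Ms))"
          and e3: "96 * real C * lam * (\<tau> + (M / lam\<^sup>2) / real (A * J)) =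
            96 * real C * (lam * \<tau> + lam * ((M / lam\<^sup>2) / real (A * J)))"
          by (simp_all add: distrib_left)
        show ?thesis unfolding e1 e2 e3 lM
          by (intro add_mono mult_left_mono Am At lt order_refl) auto
      qed
      also have "\<dots> = (4 + 2 * real C + 208 * real C ^ 2) / lam"
        using lam0 by (simp add: field_simps power2_eq_square)
      also have "\<dots> \<le> 399 * real C ^ 2 / lam"
      proof (rule divide_right_mono)
        have "real C \<le> real C ^ 2" using C by (simp add: power2_eq_square)
        then show "4 + 2 * real C + 208 * real C ^ 2 \<le> 399 * real C ^ 2" using C2 by linarith
      qed (use lam0 in simp)
      finally show ?thesis .
    qed
    have "pr (pair_pmf ?P1 ?P2) (\<lambda>w. real (max_matching (?cand w)) < y) \<le> 1 / lam + 399 * real C ^ 2 / lam"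
      unfolding pair_pmf_alt1
    proof (rule pr_bind_le_good[OF _ bad1])
      fix \<omega> assume "\<not> bad1 \<omega>"
      from second[OF this] show "pr (map_pmf (Pair \<omega>) ?P2) (\<lambda>w. real (max_matching (?cand w)) < y) \<le> 399 * real C ^ 2 / lam"
        unfolding pr_map .
    next
      show "0 \<le> 399 * real C ^ 2 / lam" using lam0 by simp
    qed
    also have "\<dots> \<le> 400 * real C ^ 2 / lam"
      using C2 lam0 by (simp add: add_divide_distrib[symmetric] divide_right_mono)
    finally show ?thesis .
  qed
  then show ?thesis unfolding y_def \<mu>_def .
qed

section \<open>Choice of the parameters\<close>

definition best_matching :: "nat set set \<Rightarrow> nat set set" where
  "best_matching G = (SOME F. F \<subseteq> G \<and> disjoint F \<and> card F = max_matching G)"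

lemma best_matching:
  assumes "finite G"
  shows "best_matching G \<subseteq> G" "disjoint (best_matching G)" "card (best_matching G) = max_matching G"
  using someI_ex[of "\<lambda>F. F \<subseteq> G \<and> disjoint F \<and> card F = max_matching G"] max_matching_ex[OF assms]
  unfolding best_matching_def by metis+

text \<open>Multiplicities are below \<open>p\<close>, so none of them vanishes modulo
  \<open>p\<close> unless it is 0.\<close>

lemma graph_on_support:
  assumes "graph_on n k E" "k < p"
  shows "{e \<in> pairs n. \<not> int p dvd int (count E e)} = set_mset E"
proof -
  have "\<not> p dvd count E e \<longleftrightarrow> e \<in># E" for e
  proof -
    have "count E e < p" using assms by (auto simp: graph_on_def intro: le_less_trans)
    then show ?thesis by (metis count_eq_zero_iff dvd_0_right gr0I nat_dvd_not_less)
  qed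
  moreover have "set_mset E \<subseteq> pairs n" using assms(1) by (auto simp: graph_on_def pairs_def)
  ultimately show ?thesis by auto
qed

lemma matching_number_eq: "matching_number E = max_matching (set_mset E)"
  by (simp add: matching_number_def max_matching_def is_matching_def)

lemma approx_best_matching:
  assumes "G \<subseteq> set_mset E" "real (matching_number E) / \<alpha> \<le> real (max_matching G)"
  shows "approx_matching \<alpha> E (best_matching G)"
proof -
  have "finite G" using assms(1) finite_subset by blast
  from best_matching[OF this] show ?thesis
    using assms by (auto simp: approx_matching_def is_matching_def)
qed

text \<open>The identity matrix, with an empty seed and no error. It serves bounded \<open>n\<close>
  and bounded \<alpha>, where all pairs fit into the space bound up to a constant.\<close>

lemma store_everything:
  assumes p: "prime p" and k: "k < p" and \<alpha>: "1 \<le> \<alpha>"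
  shows "\<exists>S. linear_sketch (n choose 2) (2 * int p) S \<and>
    (\<forall>E. graph_on n k E \<longrightarrow>
      measure_pmf.prob (sk_code S) {b. approx_matching \<alpha> E (sketch_output S (edge_vec n E) b)} \<ge> 1 - 0 \<and>
      (\<forall>b\<in>set_pmf (sk_code S). sketch_bits S (edge_vec n E) b = 0 + card (pairs n) * nat \<lceil>log 2 (real p)\<rceil>))"
proof (rule sketch_of_seeds[where W = "\<lambda>_. ()" and \<Phi> = "\<lambda>_ f e. of_bool (e = f)"
      and Out = "\<lambda>_ x. best_matching {e \<in> pairs n. \<not> int p dvd x e}"])
  have meas: "meas n p (\<lambda>f e. of_bool (e = f)) x f = x f mod int p" if "f \<in> pairs n" for x f
  proof -
    have "(\<Sum>e\<in>pairs n. of_bool (e = f) * x e) = (\<Sum>e\<in>pairs n. if e = f then x f else 0)"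
      by (intro sum.cong) auto
    then show ?thesis using that by (simp add: meas_def)
  qed
  show "best_matching {e \<in> pairs n. \<not> int p dvd x e} = best_matching {e \<in> pairs n. \<not> int p dvd y e}"
    if eq: "\<And>i. i \<in> pairs n \<Longrightarrow> meas n p (\<lambda>f e. of_bool (e = f)) x i = meas n p (\<lambda>f e. of_bool (e = f)) y i" for x y
  proof -
    have "int p dvd x e \<longleftrightarrow> int p dvd y e" if "e \<in> pairs n" for e
      using eq[OF that] meas[OF that] by (simp add: dvd_eq_mod_eq_0)
    then have "{e \<in> pairs n. \<not> int p dvd x e} = {e \<in> pairs n. \<not> int p dvd y e}" by blast
    then show ?thesis by simp
  qed
  fix E assume E: "graph_on n k E"
  have "real (matching_number E) / \<alpha> \<le> real (matching_number E)"
    using \<alpha> by (simp add: divide_le_eq mult_le_cancel_left1)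
  then have "approx_matching \<alpha> E (best_matching {e \<in> pairs n. \<not> int p dvd int (count E e)})"
    unfolding graph_on_support[OF E k] by (intro approx_best_matching) (auto simp: matching_number_eq)
  then show "real (card {b :: bool list. length b = 0 \<and> \<not> approx_matching \<alpha> E
      (best_matching {e \<in> pairs n. \<not> int p dvd int (count E e)})}) \<le> 0 * 2 ^ 0"
    by simp
qed (use p in auto)

text \<open>\<open>D\<close> is both the number of copies and the number of hashings in each of
  them. \<open>L\<close> is at once the number of levels, the number of fingerprint rows and the
  seed length, so that \<open>2 ^ L\<close> exceeds every power of \<open>n\<close> needed. A copy
  accepts a wrong pair with probability at most \<open>n powr (- c) / (8 * D)\<close>, so all copies
  may be trusted; it finds too little with probability at most
  \<open>n powr (- (\<delta> / 20))\<close>, and one successful copy out of \<open>D\<close> is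
  enough.\<close>

lemma sketch_of_parameters:
  fixes \<delta> c \<alpha> b :: real and k n p L s A J D :: nat
  defines "lam \<equiv> real n powr (\<delta> / 10)"
  assumes p: "prime p" "k < p" and c: "0 < c" and \<delta>: "0 < \<delta>"
    and \<alpha>: "32 \<le> \<alpha>" "\<alpha> \<le> real n powr (1 / 2 - \<delta>)"
    and b: "b = 96 * real D + 1" "b \<le> lam" "64 \<le> lam"
    and D: "2 * (c + 4) \<le> \<delta> / 10 * real D" "1 \<le> D"
    and D2: "400 * real D ^ 2 \<le> real n powr (\<delta> / 20)"
    and L: "L = nat \<lceil>(c + 10) * log 2 (real n)\<rceil>" "64 * (64 * (real L + 1) * ln (real n + 1)) \<le> lam" "64 * (real L + 1) \<le> lam"
      "L \<le> n choose 2"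
    and n: "96 * real p * real D \<le> real n" "16 * real (k + 1) \<le> real n"
    and s: "s = nat \<lceil>real n ^ 2 / (\<alpha> ^ 3 * lam)\<rceil>"
    and A: "A = nat \<lfloor>\<alpha> / 16\<rfloor>" and J: "J = nat \<lceil>96 * real D * real n / (\<alpha> * real A)\<rceil>"
  shows "\<exists>S. linear_sketch (n choose 2) (2 * int p) S \<and>
    (\<forall>E. graph_on n k E \<longrightarrow>
      measure_pmf.prob (sk_code S) {b. approx_matching \<alpha> E (sketch_output S (edge_vec n E) b)} \<ge> 1 - real n powr (- c) \<and>
      (\<forall>z\<in>set_pmf (sk_code S). real (sketch_bits S (edge_vec n E) z) \<le>
        (1 + real D * (1 + 32 * real D * b\<^sup>2) * real (nat \<lceil>log 2 (real p)\<rceil>)) * (real n ^ 2 / \<alpha> ^ 3)))"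
proof -
  have lam0: "0 < lam" "1 \<le> lam" using b by linarith+
  have p2: "2 \<le> p" using p(1) prime_ge_2_nat by blast
  have \<alpha>0: "0 < \<alpha>" using \<alpha> by linarith
  have n0: "0 < real n"
  proof -
    have "0 < real p * real D" using p2 D by simp
    then show ?thesis using n(1) by linarith
  qed
  have n1: "1 \<le> real n" using n0 by (cases n) auto
  have npow: "real n powr x \<le> real n powr y" if "x \<le> y" for x y using that n1 by (rule powr_mono)
  \<comment> \<open>The budget of exponents: the square of \<alpha> leaves room for
    \<open>n powr (2 * \<delta>)\<close>, of which the tenth power of \<open>lam\<close> uses
    half.\<close>
  have \<alpha>lam: "\<alpha>\<^sup>2 * lam ^ 10 \<le> real n"
  proof -
    have "\<alpha>\<^sup>2 \<le> (real n powr (1 / 2 - \<delta>))\<^sup>2" using \<alpha> \<alpha>0 by (intro power_mono) auto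
    also have "\<dots> = real n powr (1 - 2 * \<delta>)" using n0 by (simp add: power2_eq_square powr_add[symmetric])
    finally have "\<alpha>\<^sup>2 * lam ^ 10 \<le> real n powr (1 - 2 * \<delta>) * lam ^ 10" using lam0 by (intro mult_right_mono) auto
    also have "\<dots> = real n powr (1 - 2 * \<delta>) * real n powr (10 * (\<delta> / 10))"
      unfolding lam_def using n0 by (simp add: powr_power)
    also have "\<dots> = real n powr (1 - \<delta>)" by (simp add: powr_add[symmetric])
    also have "\<dots> \<le> real n powr 1" using \<delta> by (intro npow) simp
    finally show ?thesis using n0 by simp
  qed
  have lamk: "lam ^ i \<le> lam ^ j" if "i \<le> j" for i j by (rule power_increasing[OF that]) (use lam0 in simp)
  have al: "\<alpha>\<^sup>2 * lam ^ i \<le> real n" if "i \<le> 10" for i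
    using \<alpha>lam mult_left_mono[OF lamk[OF that], of "\<alpha>\<^sup>2"] by simp
  have big: "\<alpha> ^ 3 * lam \<le> real n ^ 2"
  proof -
    have "\<alpha> \<le> \<alpha>\<^sup>2" using \<alpha> by (simp add: power2_eq_square)
    moreover have "\<alpha>\<^sup>2 * lam \<le> real n" using al[of 1] by simp
    moreover have "\<alpha>\<^sup>2 \<le> real n" using al[of 0] by simp
    ultimately have "\<alpha> * (\<alpha>\<^sup>2 * lam) \<le> real n * real n" using \<alpha>0 lam0 by (intro mult_mono) auto
    then show ?thesis by (simp add: power2_eq_square power3_eq_cube mult_ac)
  qed
  define R where "R = real n ^ 2 / \<alpha> ^ 3"
  have R: "lam \<le> R" using big \<alpha>0 by (simp add: R_def pos_le_divide_eq mult.commute)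
  have A1: "2 \<le> A" "16 * real A \<le> \<alpha>" "\<alpha> / 32 \<le> real A"
  proof -
    have "2 \<le> nat \<lfloor>q\<rfloor> \<and> real (nat \<lfloor>q\<rfloor>) \<le> q \<and> q / 2 \<le> real (nat \<lfloor>q\<rfloor>)" if "2 \<le> q" for q :: real
      using that by linarith
    from this[of "\<alpha> / 16"] \<alpha> show "2 \<le> A" "16 * real A \<le> \<alpha>" "\<alpha> / 32 \<le> real A" by (auto simp: A)
  qed
  have A0: "0 < real A" using A1 by simp
  \<comment> \<open>Up to rounding, \<open>A * J\<close> is \<open>96 * D * n / \<alpha>\<close>,
    the least that \<open>accepted_complete\<close> permits for \<open>t = n / \<alpha>\<close> and
    \<open>D\<close> hashings. The rounding adds at most \<open>A \<le> n / \<alpha>\<close>, which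
    is the 1 in \<open>b\<close>.\<close>
  define j where "j = 96 * real D * real n / (\<alpha> * real A)"
  have j0: "0 < j" using D n0 \<alpha>0 A0 by (simp add: j_def)
  have Jj: "j \<le> real J" "real J \<le> j + 1"
    unfolding J j_def[symmetric] using j0 by linarith+
  have jA: "real A * j = 96 * real D * (real n / \<alpha>)" unfolding j_def using A0 \<alpha>0 by (simp add: field_simps)
  have D1: "1 \<le> real D" using D by simp
  have AJ2: "96 * (real n / \<alpha>) * real D \<le> real (A * J)"
  proof -
    have "96 * (real n / \<alpha>) * real D = real A * j" unfolding jA by simp
    also have "\<dots> \<le> real A * real J" using Jj A0 by (intro mult_left_mono) auto
    finally show ?thesis by simp
  qed
  have AJ1: "4 * real n / \<alpha> \<le> real (A * J)"
  proof -
    have "4 * (real n / \<alpha>) \<le> 96 * (real n / \<alpha>) * real D"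
      using D1 n0 \<alpha>0 by (simp add: field_simps)
    then show ?thesis using AJ2 by simp
  qed
  have AJ3: "real (A * J) \<le> b * (real n / \<alpha>)"
  proof -
    have "real (A * J) \<le> real A * (j + 1)" using Jj A0 by (simp add: mult_left_mono)
    also have "\<dots> = 96 * real D * (real n / \<alpha>) + real A" by (simp add: jA distrib_left)
    also have "real A \<le> real n / \<alpha>"
    proof -
      have "real A * \<alpha> \<le> \<alpha> * \<alpha>" using A1 \<alpha>0 by (intro mult_right_mono) auto
      also have "\<dots> \<le> real n" using al[of 0] by (simp add: power2_eq_square)
      finally show ?thesis using \<alpha>0 by (simp add: pos_le_divide_eq)
    qed
    finally show ?thesis by (simp add: b distrib_right add_divide_distrib)
  qed
  have J2: "2 * lam \<le> real J"
  proof -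
    have "2 * lam * (\<alpha> * real A) \<le> 2 * lam * (\<alpha> * \<alpha>)" using A1 \<alpha>0 lam0 by (intro mult_left_mono) auto
    also have "\<dots> = 2 * (\<alpha>\<^sup>2 * lam ^ 1)" by (simp add: power2_eq_square)
    also have "\<dots> \<le> 2 * real n" using al[of 1] by simp
    also have "\<dots> \<le> 96 * real D * real n" using D1 n0 by (intro mult_right_mono) auto
    finally have "2 * lam \<le> j" using \<alpha>0 A0 by (simp add: j_def pos_le_divide_eq)
    then show ?thesis using Jj by linarith
  qed
  have J0: "0 < J" using J2 lam0 by (cases J) auto
  have AJJ: "J \<le> A * J - J"
  proof -
    have "2 * J \<le> A * J" using A1 by simp
    then show ?thesis by linarith
  qed
  have "0 < A * J - J" using AJJ J0 by linarith
  then have AJp: "0 < real (A * J - J)" by (rule of_nat_0_less_iff[THEN iffD2])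
  have powL: "real n powr (c + 10) \<le> 2 ^ L"
  proof -
    have "real n powr (c + 10) = 2 powr ((c + 10) * log 2 (real n))"
      using n0 by (metis powr_log_cancel powr_powr mult.commute numeral_One numeral_eq_iff one_eq_numeral_iff zero_less_numeral semiring_norm(85))
    also have "\<dots> \<le> 2 powr real L" unfolding L by (intro powr_mono) linarith+
    finally show ?thesis by (simp add: powr_realpow)
  qed
  have n10: "real n ^ i * real n powr c \<le> 2 ^ L" if "i \<le> 10" for i
  proof -
    have "real n ^ i * real n powr c = real n powr (real i + c)"
      using n0 by (simp add: powr_add powr_realpow)
    also have "\<dots> \<le> real n powr (c + 10)" using that by (intro npow) simp
    finally show ?thesis using powL by linarith
  qed
  have nc: "1 \<le> real n powr c" using npow[of 0 c] c n0 by simp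
  have choose: "n choose 2 \<le> n ^ 2" by (simp add: choose_two power2_eq_square) (metis diff_le_self div_le_dividend le_trans mult_le_mono2)
  have ch: "real (n choose 2) \<le> real n ^ 2" using of_nat_mono[OF choose, where 'a = real] by simp
  have L4: "4 * card (pairs n) \<le> 2 ^ L"
  proof -
    have "4 * real (n choose 2) \<le> real n * real n ^ 2" using ch n(2) n0 by (intro mult_mono) auto
    also have "\<dots> \<le> real n ^ 3 * real n powr c" using nc n0 by (simp add: power3_eq_cube power2_eq_square)
    also have "\<dots> \<le> 2 ^ L" by (rule n10) simp
    finally have "real (4 * card (pairs n)) \<le> real (2 ^ L)" by (simp add: card_pairs)
    then show ?thesis by (simp only: of_nat_le_iff)
  qed
  define \<rho> where "\<rho> i = (if i = 0 then 2 / real (A * J) else if i = Suc 0 then lam * \<alpha> / (4 * real n) else 1)" for i :: nat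
  define T where "T = {..<3 :: nat} \<times> {..<s}"
  define M where "M = A * J"
  define one where "one = pair_pmf (probes n p L L \<rho> {..<3} s) (hashes n D A J)"
  define cand where "cand w x = candidates n p L T D J M lam w x"
    for w :: "(nat \<times> nat \<Rightarrow> nat set set \<times> (nat \<Rightarrow> nat set \<Rightarrow> int)) \<times> (nat \<Rightarrow> nat \<Rightarrow> nat)" and x
  have s1: "real n ^ 2 / (\<alpha> ^ 3 * lam) \<le> real s" "real s \<le> 2 * (R / lam)"
  proof -
    have e: "real n ^ 2 / (\<alpha> ^ 3 * lam) = R / lam" by (simp add: R_def)
    have "1 \<le> R / lam" using R lam0 by (simp add: pos_le_divide_eq)
    moreover have "q \<le> real (nat \<lceil>q\<rceil>) \<and> real (nat \<lceil>q\<rceil>) \<le> 2 * q" if "1 \<le> q" for q :: real using that by linarith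
    ultimately show "real n ^ 2 / (\<alpha> ^ 3 * lam) \<le> real s" "real s \<le> 2 * (R / lam)" unfolding s e by blast+
  qed
  have s2: "real s \<le> 2 * real n ^ 2"
  proof -
    have "R \<le> real n ^ 2" using \<alpha> by (simp add: R_def divide_le_eq mult_le_cancel_left1 one_le_power)
    then have "R / lam \<le> real n ^ 2" using lam0 R by (simp add: divide_le_eq mult_le_cancel_left1) (metis mult_left_mono mult.right_neutral order_trans zero_le_power2)
    then show ?thesis using s1 by linarith
  qed
  have half: "(real n powr (- (\<delta> / 20))) ^ D \<le> real n powr (- (c + 4))"
  proof -
    have "(real n powr (- (\<delta> / 20))) ^ D = real n powr (- (\<delta> / 20) * real D)"
      using n0 by (simp add: powr_power mult.commute)
    also have "\<dots> \<le> real n powr (- (c + 4))" using D by (intro npow) simp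
    finally show ?thesis .
  qed
  have lamh: "1 / lam = real n powr (- (\<delta> / 20)) / real n powr (\<delta> / 20)"
    unfolding lam_def powr_diff[symmetric] powr_minus_divide[symmetric] by simp
  have n4: "real n powr (- (c + i)) = real n powr (- c) / real n ^ i'" if "i = real i'" for i i'
  proof -
    have "- (c + i) = - c - real i'" using that by simp
    then show ?thesis using n0 by (simp only: powr_diff powr_realpow)
  qed
  have sound: "pr one (\<lambda>w. \<exists>e\<in>cand w x. int p dvd x e) \<le> real n powr (- c) / (8 * real D)" for x
  proof -
    have "pr one (\<lambda>w. \<exists>e\<in>cand w x. int p dvd x e) \<le>
      real (card {..<3 :: nat} * s) * (real (n choose 2) * (real p * (1 / real p) ^ L))
      + real (n choose 2) * (3 / lam + 2 / real J + 2 / real (A * J - J)) ^ D"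
      unfolding one_def cand_def T_def M_def
      by (rule candidates_sound) (use p A1 J0 lam0 in auto)
    also have "\<dots> \<le> (6 * real n ^ 4 * real p) * (1 / 2 ^ L) + real n ^ 2 * real n powr (- (c + 4))"
    proof (rule add_mono)
      have "(1 / real p) ^ L \<le> 1 / 2 ^ L"
        unfolding power_one_over using p2 by (intro divide_left_mono power_mono) auto
      then have "real (card {..<3 :: nat} * s) * (real (n choose 2) * (real p * (1 / real p) ^ L)) \<le>
          3 * (2 * real n ^ 2) * (real n ^ 2 * (real p * (1 / 2 ^ L)))"
        using s2 ch by (intro mult_mono) auto
      then show "real (card {..<3 :: nat} * s) * (real (n choose 2) * (real p * (1 / real p) ^ L)) \<le>
          (6 * real n ^ 4 * real p) * (1 / 2 ^ L)"
        by (simp add: power2_eq_square power4_eq_xxxx)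
      have "3 / lam + 2 / real J + 2 / real (A * J - J) \<le> 3 / lam + 2 / lam + 2 / lam"
      proof (intro add_mono order_refl divide_left_mono)
        show "lam \<le> real J" using J2 lam0 by linarith
        then show "lam \<le> real (A * J - J)" using of_nat_mono[OF AJJ, where 'a = real] by linarith
      qed (use lam0 J0 AJp in auto)
      also have "\<dots> = 7 * (1 / lam)" by simp
      also have "\<dots> \<le> real n powr (\<delta> / 20) * (1 / lam)"
      proof (rule mult_right_mono)
        have "1 \<le> real D ^ 2" using D1 by (rule one_le_power)
        then show "7 \<le> real n powr (\<delta> / 20)" using D2 by linarith
      qed (use lam0 in simp)
      also have "\<dots> = real n powr (- (\<delta> / 20))" using n0 by (simp add: lamh)
      finally have "(3 / lam + 2 / real J + 2 / real (A * J - J)) ^ D \<le> (real n powr (- (\<delta> / 20))) ^ D"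
        using lam0 by (intro power_mono) auto
      also note half
      finally show "real (n choose 2) * (3 / lam + 2 / real J + 2 / real (A * J - J)) ^ D \<le> real n ^ 2 * real n powr (- (c + 4))"
        using ch lam0 by (intro mult_mono) auto
    qed
    also have "\<dots> \<le> real n powr (- c) / (16 * real D) + real n powr (- c) / (16 * real D)"
    proof (rule add_mono)
      have "(6 * real n ^ 4 * real p) * (16 * real D) = real n ^ 4 * (96 * real p * real D)" by simp
      also have "\<dots> \<le> real n ^ 4 * real n" using n(1) by (intro mult_left_mono) auto
      finally have "(6 * real n ^ 4 * real p) * (16 * real D) * real n powr c \<le> real n ^ 5 * real n powr c"
        using nc by (intro mult_right_mono) (auto simp: eval_nat_numeral)
      also have "\<dots> \<le> 2 ^ L" by (rule n10) simp
      finally have le: "(6 * real n ^ 4 * real p) * (16 * real D) * real n powr c \<le> 2 ^ L" .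
      have "X * (1 / Y) \<le> 1 / N / W" if "X * W * N \<le> Y" "0 < Y" "0 < N" "0 < W" for X Y N W :: real
        using that by (simp add: pos_divide_le_eq pos_le_divide_eq mult_ac)
      from this[OF le] show "(6 * real n ^ 4 * real p) * (1 / 2 ^ L) \<le> real n powr (- c) / (16 * real D)"
        unfolding powr_minus_divide using D1 nc n0 by simp
      have "16 * real D \<le> real n"
      proof -
        have "16 * real D \<le> (96 * real p) * real D" using p2 D1 by (intro mult_right_mono) auto
        then show ?thesis using n(1) by linarith
      qed
      also have "\<dots> \<le> real n ^ 2" using n1 by (simp add: power2_eq_square)
      finally have "1 / real n ^ 2 \<le> 1 / (16 * real D)" using D1 n0 by (intro divide_left_mono) auto
      then have "real n powr (- c) * (1 / real n ^ 2) \<le> real n powr (- c) * (1 / (16 * real D))" by (intro mult_left_mono) auto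
      moreover have "real n ^ 2 * real n powr (- (c + 4)) = real n powr (- c) * (1 / real n ^ 2)"
        using n4[of 4 4] n0 by (simp add: power2_eq_square power4_eq_xxxx)
      ultimately show "real n ^ 2 * real n powr (- (c + 4)) \<le> real n powr (- c) / (16 * real D)" by simp
    qed
    also have "\<dots> = real n powr (- c) / (8 * real D)" using D1 by (simp add: field_simps)
    finally show ?thesis .
  qed
  have complete: "pr one (\<lambda>w. real (max_matching (cand w x)) < real (max_matching {e \<in> pairs n. \<not> int p dvd x e}) / \<alpha>)
      \<le> real n powr (- (\<delta> / 20))" for x
  proof -
    have "pr one (\<lambda>w. real (max_matching (cand w x)) < real (max_matching {e \<in> pairs n. \<not> int p dvd x e}) / \<alpha>)
      \<le> 400 * real D ^ 2 / lam"
      unfolding one_def cand_def T_def M_def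
      by (rule candidates_complete[where b = b and \<rho> = \<rho>, OF p(1) L4 L(2,3) b(3,2) s1(1) \<alpha>(1) \<alpha>lam A1(1,2)
        AJ1 AJ2 AJ3 J2 D(2)]) (simp_all add: \<rho>_def)
    also have "\<dots> = (400 * real D ^ 2) * (1 / lam)" by simp
    also have "\<dots> \<le> real n powr (\<delta> / 20) * (1 / lam)" using D2 lam0 by (intro mult_right_mono) auto
    also have "\<dots> = real n powr (- (\<delta> / 20))" using n0 by (simp add: lamh)
    finally show ?thesis .
  qed
  define DD where "DD = Pi_pmf {..<D} undefined (\<lambda>_. one)"
  define \<Phi> where "\<Phi> w i e = (case i of (q, Inl t) \<Rightarrow> probe_row (fst (w q)) t e | (q, Inr t) \<Rightarrow> cell_row (snd (w q)) t e)"
    for w :: "nat \<Rightarrow> (nat \<times> nat \<Rightarrow> nat set set \<times> (nat \<Rightarrow> nat set \<Rightarrow> int)) \<times> (nat \<Rightarrow> nat \<Rightarrow> nat)"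
      and i :: "nat \<times> ((nat \<times> nat) \<times> nat + nat \<times> nat \<times> nat)" and e
  define I where "I = {..<D} \<times> ((T \<times> {..<L}) <+> ({..<D} \<times> {J..<M} \<times> {..<J}))"
  define Out where "Out w x = best_matching (\<Union>q<D. cand (w q) x)" for w x
  have finI: "finite I" by (simp add: I_def T_def)
  have meas: "meas n p (\<Phi> w) x (q, Inl t) = meas n p (probe_row (fst (w q))) x t"
    "meas n p (\<Phi> w) x (q, Inr u) = meas n p (cell_row (snd (w q))) x u" for w x q t u
    by (simp_all add: meas_def \<Phi>_def)
  have factor: "Out w x = Out w y" if eq: "\<And>i. i \<in> I \<Longrightarrow> meas n p (\<Phi> w) x i = meas n p (\<Phi> w) y i" for w x y
  proof -
    have "cand (w q) x = cand (w q) y" if q: "q < D" for q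
    proof -
      have 1: "found n p L T (fst (w q)) x = found n p L T (fst (w q)) y"
      proof (rule found_cong)
        fix t \<kappa> assume "t \<in> T" "\<kappa> < L"
        then have "(q, Inl (t, \<kappa>)) \<in> I" using q by (auto simp: I_def)
        from eq[OF this] show "meas n p (probe_row (fst (w q))) x (t, \<kappa>) = meas n p (probe_row (fst (w q))) y (t, \<kappa>)"
          unfolding meas .
      qed
      have 2: "accepted n p D J M lam U (snd (w q)) x = accepted n p D J M lam U (snd (w q)) y" for U
      proof (rule accepted_cong)
        fix a i j assume "a < D" "i \<in> {J..<M}" "j < J"
        then have "(q, Inr (a, i, j)) \<in> I" using q by (auto simp: I_def)
        from eq[OF this] show "meas n p (cell_row (snd (w q))) x (a, i, j) = meas n p (cell_row (snd (w q))) y (a, i, j)"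
          unfolding meas .
      qed
      show ?thesis by (simp add: cand_def candidates_def 1 2)
    qed
    then show ?thesis by (simp add: Out_def)
  qed
  have bad: "pr DD (\<lambda>w. \<not> approx_matching \<alpha> E (Out w (\<lambda>e. int (count E e)))) \<le> real n powr (- c) / 4"
    if E: "graph_on n k E" for E
  proof -
    let ?x = "\<lambda>e. int (count E e)"
    have supp: "{e \<in> pairs n. \<not> int p dvd ?x e} = set_mset E" by (rule graph_on_support[OF E p(2)])
    have "pr DD (\<lambda>w. \<not> approx_matching \<alpha> E (Out w ?x)) \<le>
      pr DD (\<lambda>w. (\<exists>q\<in>{..<D}. \<exists>e\<in>cand (w q) ?x. int p dvd ?x e) \<or>
        (\<forall>q\<in>{..<D}. real (max_matching (cand (w q) ?x)) < real (max_matching {e \<in> pairs n. \<not> int p dvd ?x e}) / \<alpha>))"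
    \<comment> \<open>If every copy is sound, then the union of all candidates consists of edges,
      and a single complete copy already makes its maximum matching large enough.\<close>
    proof (rule pr_mono, rule ccontr)
      fix w assume no: "\<not> approx_matching \<alpha> E (Out w ?x)"
        and ok: "\<not> ((\<exists>q\<in>{..<D}. \<exists>e\<in>cand (w q) ?x. int p dvd ?x e) \<or>
        (\<forall>q\<in>{..<D}. real (max_matching (cand (w q) ?x)) < real (max_matching {e \<in> pairs n. \<not> int p dvd ?x e}) / \<alpha>))"
      then obtain q where q: "q < D" "real (max_matching (set_mset E)) / \<alpha> \<le> real (max_matching (cand (w q) ?x))"
        unfolding supp by (auto simp: not_less)
      have sub: "(\<Union>q<D. cand (w q) ?x) \<subseteq> set_mset E"
      proof safe
        fix q e assume "q < D" "e \<in> cand (w q) ?x"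
        then have "e \<in> {e \<in> pairs n. \<not> int p dvd ?x e}"
          using ok subsetD[OF candidates_pairs, of e] unfolding cand_def by blast
        then show "e \<in># E" unfolding supp .
      qed
      have "max_matching (cand (w q) ?x) \<le> max_matching (\<Union>q<D. cand (w q) ?x)"
        by (rule max_matching_mono) (use q finite_subset[OF sub] in auto)
      then have "approx_matching \<alpha> E (Out w ?x)"
        unfolding Out_def by (intro approx_best_matching sub) (use q in \<open>simp add: matching_number_eq\<close>)
      then show False using no by simp
    qed
    also have "\<dots> \<le> pr DD (\<lambda>w. \<exists>q\<in>{..<D}. \<exists>e\<in>cand (w q) ?x. int p dvd ?x e) +
        pr DD (\<lambda>w. \<forall>q\<in>{..<D}. real (max_matching (cand (w q) ?x)) < real (max_matching {e \<in> pairs n. \<not> int p dvd ?x e}) / \<alpha>)"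
      by (rule pr_disj)
    also have "\<dots> \<le> real (card {..<D}) * (real n powr (- c) / (8 * real D)) + (real n powr (- (\<delta> / 20))) ^ D"
    proof (rule add_mono)
      show "pr DD (\<lambda>w. \<exists>q\<in>{..<D}. \<exists>e\<in>cand (w q) ?x. int p dvd ?x e) \<le> real (card {..<D}) * (real n powr (- c) / (8 * real D))"
      proof (rule pr_ex_bound)
        fix q assume "q \<in> {..<D}"
        then have "pr DD (\<lambda>w. \<exists>e\<in>cand (w q) ?x. int p dvd ?x e) = pr one (\<lambda>w. \<exists>e\<in>cand w ?x. int p dvd ?x e)"
          unfolding DD_def by (intro pr_Pi_component) auto
        then show "pr DD (\<lambda>w. \<exists>e\<in>cand (w q) ?x. int p dvd ?x e) \<le> real n powr (- c) / (8 * real D)"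
          using sound[of ?x] by (simp only:)
      qed simp
      have "pr DD (\<lambda>w. \<forall>q\<in>{..<D}. real (max_matching (cand (w q) ?x)) < real (max_matching {e \<in> pairs n. \<not> int p dvd ?x e}) / \<alpha>)
        = (\<Prod>q\<in>{..<D}. pr one (\<lambda>w. real (max_matching (cand w ?x)) < real (max_matching {e \<in> pairs n. \<not> int p dvd ?x e}) / \<alpha>))"
        unfolding DD_def by (rule pr_Pi_all) simp
      also have "\<dots> \<le> (\<Prod>q\<in>{..<D}. real n powr (- (\<delta> / 20)))"
        by (intro prod_mono conjI complete) auto
      finally show "pr DD (\<lambda>w. \<forall>q\<in>{..<D}. real (max_matching (cand (w q) ?x)) < real (max_matching {e \<in> pairs n. \<not> int p dvd ?x e}) / \<alpha>)
        \<le> (real n powr (- (\<delta> / 20))) ^ D" by simp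
    qed
    also have "\<dots> \<le> real n powr (- c) / 8 + real n powr (- c) / 8"
    proof (rule add_mono)
      have "8 \<le> real n ^ 4"
      proof -
        have "16 * 1 \<le> 16 * real (k + 1)" by simp
        then have "16 \<le> real n" using n(2) by linarith
        moreover have "real n ^ 1 \<le> real n ^ 4" using n1 by (intro power_increasing) auto
        ultimately show ?thesis unfolding power_one_right by linarith
      qed
      then have h: "real n powr (- c) / real n ^ 4 \<le> real n powr (- c) / 8" using n0 by (intro divide_left_mono) auto
      have e: "real n powr (- (c + 4)) = real n powr (- c) / real n ^ 4" by (rule n4) simp
      show "(real n powr (- (\<delta> / 20))) ^ D \<le> real n powr (- c) / 8" using half h unfolding e by (rule order_trans)
    qed (use D1 in simp)
    finally show ?thesis by simp
  qed
  \<comment> \<open>The logarithm of the number of graphs is at most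
    \<open>(n choose 2) * k\<close>, less than a quarter of
    \<open>2 ^ L * n powr (- c)\<close>.\<close>
  have seeds: "real ((k + 1) ^ (n choose 2)) * exp (- (2 ^ L * real n powr (- c) / 4)) < 1"
  proof -
    have "real ((k + 1) ^ (n choose 2)) \<le> exp (real k) ^ (n choose 2)"
      unfolding of_nat_power using exp_ge_add_one_self[of "real k"] by (intro power_mono) simp_all
    also have "\<dots> = exp (real (n choose 2) * real k)" by (simp add: exp_of_nat_mult)
    finally have "real ((k + 1) ^ (n choose 2)) * exp (- (2 ^ L * real n powr (- c) / 4)) \<le>
        exp (real (n choose 2) * real k) * exp (- (2 ^ L * real n powr (- c) / 4))" by (intro mult_right_mono) auto
    also have "\<dots> = exp (real (n choose 2) * real k - 2 ^ L * real n powr (- c) / 4)"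
      by (subst exp_add[symmetric]) (simp only: diff_conv_add_uminus)
    also have "\<dots> < exp 0"
    proof -
      have "4 * (real (n choose 2) * real k) * real n powr c \<le> 4 * (real n ^ 2 * real k) * real n powr c"
        using ch nc by (intro mult_right_mono mult_left_mono) auto
      also have "\<dots> < real n ^ 3 * real n powr c"
      proof -
        have "4 * real k < real n" using n(2) by simp
        then have "real n ^ 2 * (4 * real k) < real n ^ 2 * real n" using n0 by (intro mult_strict_left_mono) auto
        then have "real n ^ 2 * (4 * real k) * real n powr c < real n ^ 2 * real n * real n powr c"
          using nc n0 by (intro mult_strict_right_mono) auto
        then show ?thesis by (simp add: power3_eq_cube power2_eq_square mult_ac)
      qed
      also have "\<dots> \<le> 2 ^ L" by (rule n10) simp
      finally have less: "4 * (real (n choose 2) * real k) * real n powr c < 2 ^ L" .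
      have "X < Y * (1 / N) / 4" if "4 * X * N < Y" "0 < N" for X Y N :: real using that by (simp add: pos_less_divide_eq mult_ac)
      from this[OF less] have "real (n choose 2) * real k < 2 ^ L * real n powr (- c) / 4"
        unfolding powr_minus_divide using nc n0 by simp
      then show ?thesis by simp
    qed
    finally show ?thesis by simp
  qed
  define P where "P = real (nat \<lceil>log 2 (real p)\<rceil>)"
  have cardI: "real (card I) \<le> real D * (1 + 32 * real D * b\<^sup>2) * R"
  proof -
    have "card I = D * (3 * s * L + D * ((M - J) * J))"
      by (simp add: I_def T_def card_Plus card_cartesian_product)
    then have "real (card I) = real D * (3 * real s * real L + real D * (real (M - J) * real J))" by simp
    \<comment> \<open>The factor \<open>lam\<close> saved in the number of probes absorbs the
      \<open>L\<close> rows of each. The sums number at most the square of \<open>A * J\<close> over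
      \<open>A\<close>, where one more factor \<alpha> is gained.\<close>
    also have "\<dots> \<le> real D * (R + real D * (32 * b\<^sup>2 * R))"
    proof (intro mult_left_mono add_mono)
      have "3 * real s * real L \<le> 3 * (2 * (R / lam)) * (lam / 64)"
        using s1 L(3) lam0 R by (intro mult_mono) auto
      also have "\<dots> \<le> R" using lam0 R by simp
      finally show "3 * real s * real L \<le> R" .
      have "real (M - J) * real J \<le> real M * (real M / real A)"
      proof (rule mult_mono)
        show "real J \<le> real M / real A" using A0 by (simp add: M_def)
      qed auto
      also have "\<dots> \<le> (b * (real n / \<alpha>)) * ((b * (real n / \<alpha>)) / (\<alpha> / 32))"
        using AJ3 A1 \<alpha>0 n0 b D1 unfolding M_def by (intro mult_mono frac_le) auto
      also have "\<dots> = 32 * b\<^sup>2 * R" using \<alpha>0 by (simp add: R_def power2_eq_square power3_eq_cube field_simps)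
      finally show "real (M - J) * real J \<le> 32 * b\<^sup>2 * R" .
    qed auto
    also have "\<dots> = real D * (1 + 32 * real D * b\<^sup>2) * R" by (simp add: algebra_simps)
    finally show ?thesis .
  qed
  have bits: "real (L + card I * nat \<lceil>log 2 (real p)\<rceil>) \<le> (1 + real D * (1 + 32 * real D * b\<^sup>2) * P) * R"
  proof -
    have "real L \<le> R" using L(3) R of_nat_0_le_iff[of L, where 'a = real] by argo
    moreover have "real (card I) * P \<le> real D * (1 + 32 * real D * b\<^sup>2) * R * P"
      using cardI by (intro mult_right_mono) (auto simp: P_def)
    ultimately show ?thesis by (simp add: P_def algebra_simps)
  qed
  have "J < M" using J0 AJJ unfolding M_def by linarith
  \<comment> \<open>Some row must exist to carry the seed.\<close>
  then have "(0, Inr (0, J, 0)) \<in> I" using D(2) J0 by (auto simp: I_def)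
  then have "I \<noteq> {}" by blast
  then obtain S where S: "linear_sketch (n choose 2) (2 * int p) S"
    "\<And>E. graph_on n k E \<Longrightarrow>
      measure_pmf.prob (sk_code S) {b. approx_matching \<alpha> E (sketch_output S (edge_vec n E) b)} \<ge> 1 - real n powr (- c) \<and>
      (\<forall>b\<in>set_pmf (sk_code S). sketch_bits S (edge_vec n E) b = L + card I * nat \<lceil>log 2 (real p)\<rceil>)"
    using sketch_of_randomised_scheme[where D = DD and \<Phi> = \<Phi> and Out = Out and ok = "approx_matching \<alpha>"
      and \<xi> = "real n powr (- c)" and k = k, OF p(1) finI L(4) _ _ factor seeds bad] by auto
  then show ?thesis using bits unfolding P_def R_def by (intro exI[of _ S]) auto
qed

theorem theorem4p1:
  fixes \<delta> c :: real and k :: nat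
  assumes "\<delta> > 0" and "c > 0"
  shows "\<exists>(S :: nat \<Rightarrow> real \<Rightarrow> nat set set linear_sketch) (C :: real) (P :: int poly).
    \<forall>(n :: nat) (\<alpha> :: real). 1 \<le> \<alpha> \<and> \<alpha> \<le> real n powr (1 / 2 - \<delta>) \<longrightarrow>
      linear_sketch (n choose 2) (poly P (int (n choose 2))) (S n \<alpha>) \<and>
      (\<forall>E. graph_on n k E \<longrightarrow>
        measure_pmf.prob (sk_code (S n \<alpha>))
            {b. approx_matching \<alpha> E (sketch_output (S n \<alpha>) (edge_vec n E) b)}
          \<ge> 1 - real n powr (- c) \<and>
        (\<forall>b \<in> set_pmf (sk_code (S n \<alpha>)).
          real (sketch_bits (S n \<alpha>) (edge_vec n E) b) \<le> C * (real n ^ 2 / \<alpha> ^ 3)))"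
proof -
  obtain p where p: "prime p" "k < p" using bigger_prime[of k] by blast
  \<comment> \<open>\<open>D\<close> copies must push \<open>n powr (- (\<delta> / 20))\<close>
    below \<open>n powr (- (c + 4))\<close>; the extra 4 absorbs the number of pairs and the
    constants.\<close>
  define D where "D = nat \<lceil>20 * (c + 4) / \<delta>\<rceil> + 1"
  define b where "b = 96 * real D + 1"
  define P where "P = real (nat \<lceil>log 2 (real p)\<rceil>)"
  have D: "2 * (c + 4) \<le> \<delta> / 10 * real D" "1 \<le> D"
  proof -
    have "20 * (c + 4) / \<delta> \<le> real D" unfolding D_def by linarith
    then show "2 * (c + 4) \<le> \<delta> / 10 * real D" using assms by (simp add: field_simps)
  qed (simp add: D_def)
  have "\<forall>\<^sub>F n :: nat in at_top. b \<le> real n powr (\<delta> / 10)" using assms by real_asymp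
  moreover have "\<forall>\<^sub>F n :: nat in at_top. 64 \<le> real n powr (\<delta> / 10)" using assms by real_asymp
  moreover have "\<forall>\<^sub>F n :: nat in at_top. 400 * real D ^ 2 \<le> real n powr (\<delta> / 20)" using assms by real_asymp
  moreover have "\<forall>\<^sub>F n :: nat in at_top. 4096 * (((c + 10) * log 2 (real n) + 2) * ln (real n + 1)) \<le> real n powr (\<delta> / 10)"
    using assms by real_asymp
  moreover have "\<forall>\<^sub>F n :: nat in at_top. 64 * ((c + 10) * log 2 (real n) + 2) \<le> real n powr (\<delta> / 10)"
    using assms by real_asymp
  moreover have "\<forall>\<^sub>F n :: nat in at_top. (c + 10) * log 2 (real n) + 1 \<le> real n - 1" using assms by real_asymp
  moreover have "\<forall>\<^sub>F n :: nat in at_top. 96 * real p * real D \<le> real n" by real_asymp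
  moreover have "\<forall>\<^sub>F n :: nat in at_top. 16 * real (k + 1) \<le> real n" by real_asymp
  ultimately have "\<forall>\<^sub>F n :: nat in at_top. b \<le> real n powr (\<delta> / 10) \<and> 64 \<le> real n powr (\<delta> / 10) \<and>
      400 * real D ^ 2 \<le> real n powr (\<delta> / 20) \<and>
      4096 * (((c + 10) * log 2 (real n) + 2) * ln (real n + 1)) \<le> real n powr (\<delta> / 10) \<and>
      64 * ((c + 10) * log 2 (real n) + 2) \<le> real n powr (\<delta> / 10) \<and>
      (c + 10) * log 2 (real n) + 1 \<le> real n - 1 \<and> 96 * real p * real D \<le> real n \<and> 16 * real (k + 1) \<le> real n"
    by eventually_elim blast
  then obtain n0 where n0: "\<And>n. n0 \<le> n \<Longrightarrow> b \<le> real n powr (\<delta> / 10) \<and> 64 \<le> real n powr (\<delta> / 10) \<and>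
      400 * real D ^ 2 \<le> real n powr (\<delta> / 20) \<and>
      4096 * (((c + 10) * log 2 (real n) + 2) * ln (real n + 1)) \<le> real n powr (\<delta> / 10) \<and>
      64 * ((c + 10) * log 2 (real n) + 2) \<le> real n powr (\<delta> / 10) \<and>
      (c + 10) * log 2 (real n) + 1 \<le> real n - 1 \<and> 96 * real p * real D \<le> real n \<and> 16 * real (k + 1) \<le> real n"
    unfolding eventually_at_top_linorder by blast
  define C1 where "C1 = 1 + real D * (1 + 32 * real D * b\<^sup>2) * P"
  \<comment> \<open>\<open>C1\<close> serves large \<open>n\<close> and \<alpha>. The other terms
    pay for storing everything: there are at most \<open>n0 ^ 2\<close> pairs if
    \<open>n < n0\<close>, and 32768 is the cube of 32, for \<open>\<alpha> < 32\<close>.\<close>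
  define C where "C = C1 + (real n0 ^ 2 * P + 32768 * P)"
  have P0: "0 \<le> P" by (simp add: P_def)
  have C1: "0 \<le> C1" using P0 by (simp add: C1_def)
  have sketch: "\<exists>S. linear_sketch (n choose 2) (2 * int p) S \<and>
    (\<forall>E. graph_on n k E \<longrightarrow>
      measure_pmf.prob (sk_code S) {b. approx_matching \<alpha> E (sketch_output S (edge_vec n E) b)} \<ge> 1 - real n powr (- c) \<and>
      (\<forall>z\<in>set_pmf (sk_code S). real (sketch_bits S (edge_vec n E) z) \<le> C * (real n ^ 2 / \<alpha> ^ 3)))"
    if \<alpha>: "1 \<le> \<alpha> \<and> \<alpha> \<le> real n powr (1 / 2 - \<delta>)" for n \<alpha>
  proof -
    define R where "R = real n ^ 2 / \<alpha> ^ 3"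
    have npos: "0 < n" using \<alpha> by (cases n) auto
    then have n1: "1 \<le> real n" by simp
    \<comment> \<open>The space bound never drops below 1, so constants can be absorbed into
      it.\<close>
    have R1: "1 \<le> R"
    proof -
      have "real n powr (1 / 2 - \<delta>) \<le> real n powr (1 / 2)" using assms n1 by (intro powr_mono) auto
      then have "\<alpha> ^ 3 \<le> (real n powr (1 / 2)) ^ 3" using \<alpha> by (intro power_mono) auto
      also have "\<dots> = real n powr (3 / 2)" using n1 by (simp add: powr_power)
      also have "\<dots> \<le> real n powr 2" using n1 by (intro powr_mono) auto
      also have "\<dots> = real n ^ 2" using n1 by (simp add: powr_realpow[of _ 2, simplified])
      finally show ?thesis using \<alpha> by (simp add: R_def)
    qed
    show ?thesis
    proof (cases "n0 \<le> n \<and> 32 \<le> \<alpha>")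
      case True
      note large = n0[OF conjunct1[OF True]]
      have lg: "4096 * (((c + 10) * log 2 (real n) + 2) * ln (real n + 1)) \<le> real n powr (\<delta> / 10)"
        "64 * ((c + 10) * log 2 (real n) + 2) \<le> real n powr (\<delta> / 10)"
        "(c + 10) * log 2 (real n) + 1 \<le> real n - 1" "16 * real (k + 1) \<le> real n"
        using large by blast+
      define L where "L = nat \<lceil>(c + 10) * log 2 (real n)\<rceil>"
      have log0: "0 \<le> (c + 10) * log 2 (real n)" using assms n1 by simp
      have L: "real L \<le> (c + 10) * log 2 (real n) + 1" unfolding L_def using log0 by linarith
      have ln0: "0 \<le> ln (real n + 1)" by simp
      have "\<exists>S. linear_sketch (n choose 2) (2 * int p) S \<and>
        (\<forall>E. graph_on n k E \<longrightarrow>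
          measure_pmf.prob (sk_code S) {b. approx_matching \<alpha> E (sketch_output S (edge_vec n E) b)} \<ge> 1 - real n powr (- c) \<and>
          (\<forall>z\<in>set_pmf (sk_code S). real (sketch_bits S (edge_vec n E) z) \<le>
            (1 + real D * (1 + 32 * real D * b\<^sup>2) * real (nat \<lceil>log 2 (real p)\<rceil>)) * (real n ^ 2 / \<alpha> ^ 3)))"
      proof (rule sketch_of_parameters[OF p assms(2,1) _ _ b_def _ _ D _ L_def])
        have "(real L + 1) * ln (real n + 1) \<le> ((c + 10) * log 2 (real n) + 2) * ln (real n + 1)"
          using L ln0 by (intro mult_right_mono) auto
        then show "64 * (64 * (real L + 1) * ln (real n + 1)) \<le> real n powr (\<delta> / 10)" using lg(1) by linarith
        show "64 * (real L + 1) \<le> real n powr (\<delta> / 10)" using L lg(2) by argo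
        have "real L \<le> real n - 1" using L lg(3) by linarith
        then have "L + 1 \<le> n" using npos by linarith
        moreover have "16 \<le> n" using lg(4) by simp
        then have "2 * (n - 1) \<le> n * (n - 1)" by (intro mult_right_mono) auto
        then have "n - 1 \<le> n choose 2" unfolding choose_two by linarith
        ultimately show "L \<le> n choose 2" by linarith
      qed (use True \<alpha> large in auto)
      then obtain S where S: "linear_sketch (n choose 2) (2 * int p) S"
        "\<And>E. graph_on n k E \<Longrightarrow>
          measure_pmf.prob (sk_code S) {b. approx_matching \<alpha> E (sketch_output S (edge_vec n E) b)} \<ge> 1 - real n powr (- c) \<and>
          (\<forall>z\<in>set_pmf (sk_code S). real (sketch_bits S (edge_vec n E) z) \<le> C1 * R)"
        unfolding C1_def P_def R_def by blast
      have "C1 * R \<le> C * R" using R1 P0 by (intro mult_right_mono) (auto simp: C_def)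
      then show ?thesis using S unfolding R_def[symmetric] by (intro exI[of _ S]) (auto intro: order_trans)
    next
      case False
      have "real (card (pairs n)) * P \<le> C * R"
      proof -
        have "real (card (pairs n)) \<le> real n ^ 2"
        proof -
          have "(n choose 2) \<le> n\<^sup>2" using binomial_le_pow2[of n 2] binomial_le_pow[of 2 n] npos
            by (cases "2 \<le> n") (auto simp: binomial_eq_0)
          then show ?thesis by (metis card_pairs of_nat_le_iff of_nat_power)
        qed
        moreover have "real n ^ 2 \<le> (real n0 ^ 2 + 32768) * R"
        proof (cases "n0 \<le> n")
          case True
          then have "\<alpha> \<le> 32" using False by simp
          then have "\<alpha> ^ 3 \<le> 32 ^ 3" using \<alpha> by (intro power_mono) auto
          then have "\<alpha> ^ 3 * R \<le> 32768 * R" using R1 by (intro mult_right_mono) auto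
          moreover have "\<alpha> ^ 3 * R = real n ^ 2" using \<alpha> by (simp add: R_def)
          moreover have "0 \<le> real n0 ^ 2 * R" using R1 by simp
          ultimately show ?thesis by (simp add: distrib_right)
        next
          case False
          then have "real n ^ 2 \<le> real n0 ^ 2" by (intro power_mono) auto
          also have "\<dots> \<le> (real n0 ^ 2 + 32768) * 1" by simp
          also have "\<dots> \<le> (real n0 ^ 2 + 32768) * R" using R1 by (intro mult_left_mono) auto
          finally show ?thesis .
        qed
        ultimately have "real (card (pairs n)) \<le> (real n0 ^ 2 + 32768) * R" by (rule order_trans)
        then have "real (card (pairs n)) * P \<le> (real n0 ^ 2 + 32768) * R * P"
          using P0 by (rule mult_right_mono)
        also have "\<dots> \<le> C * R"
        proof -
          have "0 \<le> C1 * R" using C1 R1 by simp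
          then show ?thesis by (simp add: C_def algebra_simps)
        qed
        finally show ?thesis .
      qed
      then have bits: "real (0 + card (pairs n) * nat \<lceil>log 2 (real p)\<rceil>) \<le> C * (real n ^ 2 / \<alpha> ^ 3)"
        by (simp add: P_def R_def)
      obtain S where S: "linear_sketch (n choose 2) (2 * int p) S"
        "\<And>E. graph_on n k E \<Longrightarrow>
          measure_pmf.prob (sk_code S) {b. approx_matching \<alpha> E (sketch_output S (edge_vec n E) b)} \<ge> 1 - 0 \<and>
          (\<forall>z\<in>set_pmf (sk_code S). sketch_bits S (edge_vec n E) z = 0 + card (pairs n) * nat \<lceil>log 2 (real p)\<rceil>)"
        using store_everything[OF p, of \<alpha> n] \<alpha> by blast
      show ?thesis
      proof (intro exI[of _ S] conjI allI impI ballI)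
        fix E assume "graph_on n k E"
        note SE = S(2)[OF this]
        have "0 \<le> real n powr (- c)" by simp
        then show "1 - real n powr (- c) \<le>
            measure_pmf.prob (sk_code S) {b. approx_matching \<alpha> E (sketch_output S (edge_vec n E) b)}"
          using conjunct1[OF SE] by linarith
        fix z assume "z \<in> set_pmf (sk_code S)"
        then show "real (sketch_bits S (edge_vec n E) z) \<le> C * (real n ^ 2 / \<alpha> ^ 3)"
          using bits SE by metis
      qed (rule S(1))
    qed
  qed
  \<comment> \<open>Collects the sketches into one function of \<open>n\<close> and \<alpha>. As
    \<open>p\<close> depends on \<open>k\<close> only, a constant polynomial bounds the
    entries.\<close>
  have "\<exists>S. \<forall>n \<alpha>. 1 \<le> \<alpha> \<and> \<alpha> \<le> real n powr (1 / 2 - \<delta>) \<longrightarrow>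
    linear_sketch (n choose 2) (2 * int p) (S n \<alpha>) \<and>
    (\<forall>E. graph_on n k E \<longrightarrow>
      measure_pmf.prob (sk_code (S n \<alpha>)) {b. approx_matching \<alpha> E (sketch_output (S n \<alpha>) (edge_vec n E) b)} \<ge> 1 - real n powr (- c) \<and>
      (\<forall>z\<in>set_pmf (sk_code (S n \<alpha>)). real (sketch_bits (S n \<alpha>) (edge_vec n E) z) \<le> C * (real n ^ 2 / \<alpha> ^ 3)))"
    by (rule exI[of _ "\<lambda>n \<alpha>. SOME S. linear_sketch (n choose 2) (2 * int p) S \<and>
      (\<forall>E. graph_on n k E \<longrightarrow>
        measure_pmf.prob (sk_code S) {b. approx_matching \<alpha> E (sketch_output S (edge_vec n E) b)} \<ge> 1 - real n powr (- c) \<and>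
        (\<forall>z\<in>set_pmf (sk_code S). real (sketch_bits S (edge_vec n E) z) \<le> C * (real n ^ 2 / \<alpha> ^ 3)))"],
      intro allI impI, rule someI_ex, rule sketch)
  then obtain S where "\<forall>n \<alpha>. 1 \<le> \<alpha> \<and> \<alpha> \<le> real n powr (1 / 2 - \<delta>) \<longrightarrow>
    linear_sketch (n choose 2) (2 * int p) (S n \<alpha>) \<and>
    (\<forall>E. graph_on n k E \<longrightarrow>
      measure_pmf.prob (sk_code (S n \<alpha>)) {b. approx_matching \<alpha> E (sketch_output (S n \<alpha>) (edge_vec n E) b)} \<ge> 1 - real n powr (- c) \<and>
      (\<forall>z\<in>set_pmf (sk_code (S n \<alpha>)). real (sketch_bits (S n \<alpha>) (edge_vec n E) z) \<le> C * (real n ^ 2 / \<alpha> ^ 3)))"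
    by blast
  then show ?thesis by (intro exI[of _ S] exI[of _ C] exI[of _ "[:2 * int p:]"]) simp
qed

end
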